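(* Let $X$ be a path-connected based space. Then $X$ is a Dold space if and only if the counit $$v:\|\Omega_\bullet X\|\to X$$ of the adjoint pair consisting of the fat realization functor from reduced semisimplicial spaces to based spaces and its right adjoint $\Omega_\bullet$ is a homotopy equivalence.
   Context: A subset $U$ of a space $X$ is ambiently contractible if the inclusion $U\to X$ is nullhomotopic. A cover $\{U_\alpha\}$ of $X$ (by subsets, not necessarily open) is numerable if there is a partition of unity $\{f_\alpha:X\to[0,1]\}$ whose closed supports form a locally finite family with $\mathrm{Supp}(f_\alpha)\subset U_\alpha$ for all $\alpha$. A Dold space (numerably contractible space) is a space having a numerable cover by ambiently contractible subsets. A semisimplicial space is a functor $(\mathrm{Mon}\,\Delta)^{op}\to\mathrm{Top}$, where $\mathrm{Mon}\,\Delta$ is the category of the finite ordered sets $[n]=\{0<\dots<n\}$, $n\geq 0$, and injective order-preserving maps; $Y_\bullet$ is reduced if $Y_0$ is a point. $\|Y_\bullet\|$ denotes the (fat) realization, the quotient of $\coprod_n Y_n\times\Delta^n$ by the face identifications; for a reduced $Y_\bullet$ it is based at the point given by $Y_0$. For a based space $(X,\ast)$, $\Omega_nX=\mathrm{Top}((\Delta^n,\Delta^n_0),(X,\ast))$ with the function space topology, where $\Delta^n_0$ is the $0$-skeleton (set of vertices) of the standard $n$-simplex $\Delta^n$; boundaries (and degeneracies) are defined as for the singular functor. The functor $\Omega_\bullet$ is right adjoint to $\|\,\cdot\,\|$ from reduced semisimplicial spaces to based spaces, and the counit $v$ is induced by the evaluation maps $\Omega_nX\times\Delta^n\to X$, $(\sigma,t)\mapsto\sigma(t)$.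 *)

theory Defs
  imports "HOL-Analysis.Analysis" "HOL-Homology.Homology"
begin

section \<open>Dold spaces\<close>

definition ambiently_contractible :: "'a topology \<Rightarrow> 'a set \<Rightarrow> bool" where
  "ambiently_contractible X U \<longleftrightarrow>
     U \<subseteq> topspace X \<and>
     (\<exists>c \<in> topspace X. homotopic_with (\<lambda>_. True) (subtopology X U) X id (\<lambda>_. c))"

definition closed_support :: "'a topology \<Rightarrow> ('a \<Rightarrow> real) \<Rightarrow> 'a set" where
  "closed_support X f = X closure_of {x \<in> topspace X. f x \<noteq> 0}"

text \<open>Local finiteness is that of the indexed family of supports, so the pointwise sum
  in the third clause is over a finite set.\<close>

definition partition_of_unity_on :: "'a topology \<Rightarrow> 'i set \<Rightarrow> ('i \<Rightarrow> 'a \<Rightarrow> real) \<Rightarrow> bool" where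
  "partition_of_unity_on X I f \<longleftrightarrow>
     (\<forall>i\<in>I. continuous_map X (top_of_set {0..1}) (f i)) \<and>
     (\<forall>x \<in> topspace X. \<exists>V. openin X V \<and> x \<in> V \<and> finite {i \<in> I. V \<inter> closed_support X (f i) \<noteq> {}}) \<and>
     (\<forall>x \<in> topspace X. (\<Sum>i | i \<in> I \<and> f i x \<noteq> 0. f i x) = 1)"

definition numerable_cover :: "'a topology \<Rightarrow> 'i set \<Rightarrow> ('i \<Rightarrow> 'a set) \<Rightarrow> bool" where
  "numerable_cover X I U \<longleftrightarrow>
     (\<Union>i\<in>I. U i) = topspace X \<and>
     (\<exists>f. partition_of_unity_on X I f \<and> (\<forall>i\<in>I. closed_support X (f i) \<subseteq> U i))"

text \<open>A cover is taken here as a set of subsets, indexed by itself, since one cannot quantify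
  over index types.  Covers indexed by an arbitrary type give nothing more: see
  \<open>dold_spaceI\<close> below.\<close>

definition dold_space :: "'a topology \<Rightarrow> bool" where
  "dold_space X \<longleftrightarrow>
     (\<exists>\<U>. numerable_cover X \<U> (\<lambda>U. U) \<and> (\<forall>U\<in>\<U>. ambiently_contractible X U))"

lemma dold_spaceI:
  fixes U :: "'i \<Rightarrow> 'a set"
  assumes cov: "numerable_cover X I U"
    and amb: "\<And>i. i \<in> I \<Longrightarrow> ambiently_contractible X (U i)"
  shows "dold_space X"
proof -
  from cov obtain f where UI: "(\<Union>i\<in>I. U i) = topspace X"
    and cont: "\<And>i. i \<in> I \<Longrightarrow> continuous_map X (top_of_set {0..1}) (f i)"
    and lf: "\<And>x. x \<in> topspace X \<Longrightarrow>
         \<exists>V. openin X V \<and> x \<in> V \<and> finite {i \<in> I. V \<inter> closed_support X (f i) \<noteq> {}}"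
    and sum1: "\<And>x. x \<in> topspace X \<Longrightarrow> (\<Sum>i | i \<in> I \<and> f i x \<noteq> 0. f i x) = 1"
    and supp: "\<And>i. i \<in> I \<Longrightarrow> closed_support X (f i) \<subseteq> U i"
    unfolding numerable_cover_def partition_of_unity_on_def by (elim conjE exE) blast
  have insupp: "x \<in> closed_support X (f i)" if "x \<in> topspace X" "f i x \<noteq> 0" for i x
    unfolding closed_support_def
    by (rule subsetD[OF closure_of_subset]) (use that in auto)
  obtain V where V: "\<And>x. x \<in> topspace X \<Longrightarrow> openin X (V x)"
      "\<And>x. x \<in> topspace X \<Longrightarrow> x \<in> V x"
      "\<And>x. x \<in> topspace X \<Longrightarrow> finite {i \<in> I. V x \<inter> closed_support X (f i) \<noteq> {}}"
    using lf by metis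
  define F where "F x = {i \<in> I. V x \<inter> closed_support X (f i) \<noteq> {}}" for x
  have finF: "finite (F x)" if "x \<in> topspace X" for x
    using V(3) that by (simp add: F_def)
  have Vsub: "V x \<subseteq> topspace X" if "x \<in> topspace X" for x
    using V(1) that openin_subset by blast
  have inF: "i \<in> F x" if "x \<in> topspace X" "y \<in> V x" "i \<in> I" "f i y \<noteq> 0" for i x y
    unfolding F_def using that insupp[of y i] Vsub by auto
  define g where "g W y = (\<Sum>i | i \<in> I \<and> f i y \<noteq> 0 \<and> U i = W. f i y)" for W y
  have g_local: "g W y = (\<Sum>i \<in> {i \<in> F x. U i = W}. f i y)" if "x \<in> topspace X" "y \<in> V x" for W x y
    unfolding g_def
  proof (rule sum.mono_neutral_left)
    show "finite {i \<in> F x. U i = W}" using finF that by simp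
    show "{i. i \<in> I \<and> f i y \<noteq> 0 \<and> U i = W} \<subseteq> {i \<in> F x. U i = W}"
      using inF that by blast
    show "\<forall>i\<in>{i \<in> F x. U i = W} - {i. i \<in> I \<and> f i y \<noteq> 0 \<and> U i = W}. f i y = 0"
      by (auto simp: F_def)
  qed
  have fcont: "continuous_map X euclideanreal (f i)" if "i \<in> I" for i
    using cont[OF that] by (simp add: continuous_map_in_subtopology)
  have f01: "0 \<le> f i x" if "i \<in> I" "x \<in> topspace X" for i x
    using cont[OF that(1)] that(2) by (auto simp: continuous_map_in_subtopology)
  have gcont: "continuous_map X euclideanreal (g W)" for W
  proof (rule pasting_lemma[where I = "topspace X" and T = V
                             and f = "\<lambda>x y. \<Sum>i \<in> {i \<in> F x. U i = W}. f i y"])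
    fix x assume x: "x \<in> topspace X"
    show "openin X (V x)" using V x by blast
    show "continuous_map (subtopology X (V x)) euclideanreal (\<lambda>y. \<Sum>i \<in> {i \<in> F x. U i = W}. f i y)"
      using finite_subset[OF _ finF[OF x], of "{i \<in> F x. U i = W}"]
      by (intro continuous_map_from_subtopology continuous_map_sum fcont) (auto simp: F_def)
  next
    fix i j x assume "i \<in> topspace X" "j \<in> topspace X" "x \<in> topspace X \<inter> V i \<inter> V j"
    then show "(\<Sum>k | k \<in> F i \<and> U k = W. f k x) = (\<Sum>k | k \<in> F j \<and> U k = W. f k x)"
      using g_local by (metis (no_types, lifting) IntD1 IntD2)
  next
    fix x assume "x \<in> topspace X"
    then show "\<exists>j. j \<in> topspace X \<and> x \<in> V j \<and> g W x = (\<Sum>i | i \<in> F j \<and> U i = W. f i x)"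
      using V(2) g_local by blast
  qed
  have finS: "finite {i. i \<in> I \<and> f i x \<noteq> 0}" if x: "x \<in> topspace X" for x
    by (rule finite_subset[OF _ finF[OF x]]) (use inF[OF x V(2)[OF x]] in auto)
  have g_ge0: "0 \<le> g W x" if "x \<in> topspace X" for W x
    unfolding g_def using f01 that by (intro sum_nonneg) auto
  have g_le1: "g W x \<le> 1" if x: "x \<in> topspace X" for W x
    unfolding g_def sum1[OF x, symmetric]
    using f01 x by (intro sum_mono2 finS) auto
  have gcont': "continuous_map X (top_of_set {0..1}) (g W)" for W
    using gcont g_ge0 g_le1 by (auto simp: continuous_map_in_subtopology)
  have g_nz: "\<exists>i\<in>I. f i x \<noteq> 0 \<and> U i = W" if "g W x \<noteq> 0" for W x
    proof (rule ccontr)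
    assume "\<not> ?thesis"
    then have *: "{i. i \<in> I \<and> f i x \<noteq> 0 \<and> U i = W} = {}" by blast
    show False using that unfolding g_def * by simp
  qed
  have gsum: "(\<Sum>W | W \<in> U ` I \<and> g W x \<noteq> 0. g W x) = 1" if x: "x \<in> topspace X" for x
  proof -
    let ?S = "{i. i \<in> I \<and> f i x \<noteq> 0}"
    have "1 = (\<Sum>i\<in>?S. f i x)" using sum1[OF x] by simp
    also have "\<dots> = (\<Sum>W\<in>U ` ?S. sum (\<lambda>i. f i x) {i. i \<in> ?S \<and> U i = W})"
      by (rule sum.image_gen[OF finS[OF x]])
    also have "\<dots> = (\<Sum>W\<in>U ` ?S. g W x)"
      by (intro sum.cong) (auto simp: g_def intro!: sum.cong)
    also have "\<dots> = (\<Sum>W | W \<in> U ` I \<and> g W x \<noteq> 0. g W x)"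
    proof (rule sum.mono_neutral_right)
      show "finite (U ` ?S)" using finS[OF x] by simp
      show "{W \<in> U ` I. g W x \<noteq> 0} \<subseteq> U ` ?S"
      proof
        fix W assume "W \<in> {W \<in> U ` I. g W x \<noteq> 0}"
        then obtain i where "i \<in> I" "f i x \<noteq> 0" "W = U i" using g_nz[of W x] by auto
        then show "W \<in> U ` ?S" by simp
      qed
      show "\<forall>W\<in>U ` ?S - {W \<in> U ` I. g W x \<noteq> 0}. g W x = 0" by blast
    qed
    finally show ?thesis by simp
  qed
  have glf: "{W \<in> U ` I. V x \<inter> closed_support X (g W) \<noteq> {}} \<subseteq> U ` F x" if x: "x \<in> topspace X" for x
  proof
    fix W assume "W \<in> {W \<in> U ` I. V x \<inter> closed_support X (g W) \<noteq> {}}"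
    then have "V x \<inter> {y \<in> topspace X. g W y \<noteq> 0} \<noteq> {}"
      using V(1)[OF x] openin_Int_closure_of_eq_empty unfolding closed_support_def by blast
    then show "W \<in> U ` F x"
      using g_nz inF[OF x] by blast
  qed
  have gsupp: "closed_support X (g W) \<subseteq> W" for W
  proof
    fix x assume xs: "x \<in> closed_support X (g W)"
    then have x: "x \<in> topspace X"
      unfolding closed_support_def by (meson closure_of_subset_topspace subsetD)
    let ?A = "{y \<in> topspace X. g W y \<noteq> 0}"
    have "x \<in> X closure_of (V x \<inter> ?A)"
      using xs V(1,2)[OF x] openin_Int_closure_of_subset[OF V(1)[OF x], of ?A]
      unfolding closed_support_def by blast
    also have "\<dots> \<subseteq> X closure_of (\<Union>i \<in> {i \<in> F x. U i = W}. {y \<in> topspace X. f i y \<noteq> 0})"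
    proof (rule closure_of_mono, rule)
      fix y assume "y \<in> V x \<inter> ?A"
      with g_nz[of W y] inF[OF x]
      show "y \<in> (\<Union>i \<in> {i \<in> F x. U i = W}. {y \<in> topspace X. f i y \<noteq> 0})" by blast
    qed
    also have "\<dots> = (\<Union>i \<in> {i \<in> F x. U i = W}. closed_support X (f i))"
      using finF[OF x] by (subst closure_of_Union) (auto simp: closed_support_def)
    also have "\<dots> \<subseteq> W"
      using supp by (auto simp: F_def)
    finally show "x \<in> W" .
  qed
  have "numerable_cover X (U ` I) (\<lambda>W. W)"
    unfolding numerable_cover_def partition_of_unity_on_def
  proof (intro conjI exI[of _ g] ballI)
    fix x assume x: "x \<in> topspace X"
    show "\<exists>Va. openin X Va \<and> x \<in> Va \<and> finite {W \<in> U ` I. Va \<inter> closed_support X (g W) \<noteq> {}}"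
      using V(1,2)[OF x] finite_subset[OF glf[OF x]] finF[OF x] by blast
  qed (use UI gcont' gsum gsupp in auto)
  then show ?thesis
    unfolding dold_space_def using amb by blast
qed

section \<open>Homotopy equivalences\<close>

definition homotopy_equivalence_map :: "'a topology \<Rightarrow> 'b topology \<Rightarrow> ('a \<Rightarrow> 'b) \<Rightarrow> bool" where
  "homotopy_equivalence_map X Y f \<longleftrightarrow>
     continuous_map X Y f \<and>
     (\<exists>g. continuous_map Y X g \<and>
          homotopic_with (\<lambda>_. True) X X (g \<circ> f) id \<and>
          homotopic_with (\<lambda>_. True) Y Y (f \<circ> g) id)"

section \<open>Quotients and function spaces\<close>

definition quotient_topology :: "'a topology \<Rightarrow> 'a rel \<Rightarrow> 'a set topology" where
  "quotient_topology T E =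
     topology (\<lambda>\<C>. \<C> \<subseteq> topspace T // E \<and> openin T {x \<in> topspace T. E `` {x} \<in> \<C>})"

lemma openin_quotient_topology:
  "openin (quotient_topology T E) \<C> \<longleftrightarrow>
     \<C> \<subseteq> topspace T // E \<and> openin T {x \<in> topspace T. E `` {x} \<in> \<C>}"
proof -
  have "istopology (\<lambda>\<C>. \<C> \<subseteq> topspace T // E \<and> openin T {x \<in> topspace T. E `` {x} \<in> \<C>})"
    unfolding istopology_def
  proof (intro conjI allI impI)
    fix S S'
    assume "S \<subseteq> topspace T // E \<and> openin T {x \<in> topspace T. E `` {x} \<in> S}"
      and "S' \<subseteq> topspace T // E \<and> openin T {x \<in> topspace T. E `` {x} \<in> S'}"
    moreover have "{x \<in> topspace T. E `` {x} \<in> S \<inter> S'} =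
        {x \<in> topspace T. E `` {x} \<in> S} \<inter> {x \<in> topspace T. E `` {x} \<in> S'}" by auto
    ultimately show "S \<inter> S' \<subseteq> topspace T // E" "openin T {x \<in> topspace T. E `` {x} \<in> S \<inter> S'}"
      by auto
  next
    fix \<K> assume K: "\<forall>S\<in>\<K>. S \<subseteq> topspace T // E \<and> openin T {x \<in> topspace T. E `` {x} \<in> S}"
    then show "\<Union>\<K> \<subseteq> topspace T // E" by auto
    have "{x \<in> topspace T. E `` {x} \<in> \<Union>\<K>} = (\<Union>S\<in>\<K>. {x \<in> topspace T. E `` {x} \<in> S})" by auto
    with K show "openin T {x \<in> topspace T. E `` {x} \<in> \<Union>\<K>}" by auto
  qed
  then show ?thesis by (simp add: quotient_topology_def)
qed

lemma topspace_quotient_topology [simp]: "topspace (quotient_topology T E) = topspace T // E"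
proof -
  have "{x \<in> topspace T. E `` {x} \<in> topspace T // E} = topspace T"
    by (auto simp: quotient_def)
  then have "openin (quotient_topology T E) (topspace T // E)"
    by (simp add: openin_quotient_topology)
  then show ?thesis
    by (meson openin_quotient_topology openin_subset openin_topspace subset_antisym)
qed

lemma quotient_map_quotient_topology:
  "quotient_map T (quotient_topology T E) (\<lambda>x. E `` {x})"
  by (auto simp: quotient_map_def openin_quotient_topology quotient_def)

text \<open>The compact-open topology on the set of continuous maps; maps are made extensional so
  that equality of elements is equality of maps.  The subbasic set for \<open>K = {}\<close> is everything,
  so the generated topology lives on the whole type before it is cut down.\<close>

definition compact_open_topology :: "'a topology \<Rightarrow> 'b topology \<Rightarrow> ('a \<Rightarrow> 'b) topology" where
  "compact_open_topology S X =
     subtopology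
       (topology_generated_by {{f. f ` K \<subseteq> U} |K U. compactin S K \<and> openin X U})
       {f. continuous_map S X f \<and> f \<in> extensional (topspace S)}"

lemma topspace_compact_open_topology [simp]:
  "topspace (compact_open_topology S X) = {f. continuous_map S X f \<and> f \<in> extensional (topspace S)}"
proof -
  have "(UNIV :: ('a \<Rightarrow> 'b) set) \<in> {{f. f ` K \<subseteq> U} |K U. compactin S K \<and> openin X U}"
    by (rule CollectI, rule exI[of _ "{}"], rule exI[of _ "{}"]) auto
  then have "\<Union>{{f. f ` K \<subseteq> U} |K U. compactin S K \<and> openin X U} = (UNIV :: ('a \<Rightarrow> 'b) set)"
    by blast
  then show ?thesis
    by (simp add: compact_open_topology_def)
qed

lemma openin_compact_open_subbasis:
  assumes "compactin S K" "openin X U"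
  shows "openin (compact_open_topology S X) {f \<in> topspace (compact_open_topology S X). f ` K \<subseteq> U}"
proof -
  have "openin (topology_generated_by {{f. f ` K \<subseteq> U} |K U. compactin S K \<and> openin X U}) {f. f ` K \<subseteq> U}"
    by (rule topology_generated_by_Basis) (use assms in auto)
  then show ?thesis
    unfolding topspace_compact_open_topology unfolding compact_open_topology_def
    by (auto simp: openin_subtopology)
qed

lemma continuous_map_into_compact_open:
  assumes "\<And>z. z \<in> topspace Z \<Longrightarrow> h z \<in> topspace (compact_open_topology S X)"
    and "\<And>K U. compactin S K \<Longrightarrow> openin X U \<Longrightarrow> openin Z {z \<in> topspace Z. h z ` K \<subseteq> U}"
  shows "continuous_map Z (compact_open_topology S X) h"
proof -
  let ?B = "{{f. f ` K \<subseteq> U} |K U. compactin S K \<and> openin X U}"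
  have "UNIV \<in> ?B"
    by (rule CollectI, rule exI[of _ "{}"], rule exI[of _ "{}"]) auto
  then have "\<Union>?B = UNIV" by blast
  moreover have "openin Z (h -` B \<inter> topspace Z)" if B: "B \<in> ?B" for B
  proof -
    from B obtain K U where KU: "B = {f. f ` K \<subseteq> U}" "compactin S K" "openin X U" by blast
    have "h -` B \<inter> topspace Z = {z \<in> topspace Z. h z ` K \<subseteq> U}" using KU(1) by auto
    then show ?thesis using assms(2) KU by metis
  qed
  ultimately have "continuous_map Z (topology_generated_by ?B) h"
    by (intro continuous_on_generated_topo) auto
  then show ?thesis
    using assms(1) unfolding topspace_compact_open_topology
    by (auto simp: compact_open_topology_def continuous_map_in_subtopology)
qed

lemma continuous_map_evaluation:
  assumes S: "compact_space S" "Hausdorff_space S"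
  shows "continuous_map (prod_topology (compact_open_topology S X) S) X (\<lambda>(f, t). f t)"
  unfolding continuous_map_def
proof (intro conjI allI impI)
  show "(\<lambda>(f, t). f t) \<in> topspace (prod_topology (compact_open_topology S X) S) \<rightarrow> topspace X"
    by (auto simp: continuous_map_def)
  fix U assume U: "openin X U"
  let ?C = "compact_open_topology S X"
  let ?P = "{x \<in> topspace (prod_topology ?C S). (case x of (f, t) \<Rightarrow> f t) \<in> U}"
  show "openin (prod_topology ?C S) ?P"
  proof (subst openin_subopen, intro ballI)
    fix x assume "x \<in> ?P"
    then obtain f t where x: "x = (f, t)" and f: "f \<in> topspace ?C" and t: "t \<in> topspace S" "f t \<in> U"
      by auto
    have op: "openin S {s \<in> topspace S. f s \<in> U}"
      using f U by (auto simp: continuous_map_def)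
    have "regular_space S"
      using S compact_Hausdorff_imp_regular_space by blast
    then obtain W K where W: "openin S W" "closedin S K" "t \<in> W" "W \<subseteq> K" "K \<subseteq> {s \<in> topspace S. f s \<in> U}"
      using op t unfolding neighbourhood_base_of_closedin[symmetric] neighbourhood_base_of
      by (metis (mono_tags, lifting) mem_Collect_eq)
    have K: "compactin S K" using W S closedin_compact_space by blast
    let ?N = "{g \<in> topspace ?C. g ` K \<subseteq> U} \<times> W"
    have "openin (prod_topology ?C S) ?N"
      using openin_compact_open_subbasis[OF K U] W by (simp add: openin_prod_Times_iff)
    moreover have "x \<in> ?N" using x f W by auto
    moreover have "?N \<subseteq> ?P" using W(4) openin_subset[OF W(1)] by (auto simp: image_subset_iff dest: subsetD)
    ultimately show "\<exists>T. openin (prod_topology ?C S) T \<and> x \<in> T \<and> T \<subseteq> ?P" by blast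
  qed
qed

lemma continuous_map_curry:
  assumes g: "continuous_map (prod_topology Z S) X (\<lambda>(z, t). g z t)"
  shows "continuous_map Z (compact_open_topology S X) (\<lambda>z. restrict (g z) (topspace S))"
proof (rule continuous_map_into_compact_open)
  fix z assume z: "z \<in> topspace Z"
  have "continuous_map S (prod_topology Z S) (\<lambda>t. (z, t))"
    using z by (simp add: continuous_map_pairwise o_def)
  from continuous_map_compose[OF this g] have "continuous_map S X (g z)"
    by (simp add: o_def)
  then show "restrict (g z) (topspace S) \<in> topspace (compact_open_topology S X)"
    by (auto elim: continuous_map_eq)
next
  fix K U assume K: "compactin S K" and U: "openin X U"
  have KS: "K \<subseteq> topspace S" using K compactin_subset_topspace by blast
  let ?W = "{p \<in> topspace (prod_topology Z S). (case p of (z, t) \<Rightarrow> g z t) \<in> U}"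
  have W: "openin (prod_topology Z S) ?W"
    using g U unfolding continuous_map_def by blast
  show "openin Z {z \<in> topspace Z. restrict (g z) (topspace S) ` K \<subseteq> U}" (is "openin Z ?A")
  proof (subst openin_subopen, intro ballI)
    fix z assume "z \<in> ?A"
    then have z: "z \<in> topspace Z" "\<And>t. t \<in> K \<Longrightarrow> g z t \<in> U" using KS by auto
    have "{z} \<times> K \<subseteq> ?W" using z KS by auto
    then obtain A B where "openin Z A" "openin S B" "{z} \<subseteq> A" "K \<subseteq> B" "A \<times> B \<subseteq> ?W"
      using Wallace_theorem_prod_topology[of Z "{z}" S K ?W] K W z(1) by auto
    then show "\<exists>T. openin Z T \<and> z \<in> T \<and> T \<subseteq> ?A"
      using KS openin_subset by (intro exI[of _ A]) fastforce
  qed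
qed

section \<open>Semisimplicial spaces and the fat realization\<close>

text \<open>Morphisms \<open>[m] \<rightarrow> [n]\<close> of the category of the finite ordered sets \<open>[n] = {0, ..., n}\<close>
  and injective order-preserving maps.\<close>

definition mon_delta :: "nat \<Rightarrow> nat \<Rightarrow> (nat \<Rightarrow> nat) set" where
  "mon_delta m n = {\<theta> \<in> {..m} \<rightarrow>\<^sub>E {..n}. strict_mono_on {..m} \<theta>}"

text \<open>\<open>act m n \<theta> : Y n \<rightarrow> Y m\<close> is the value of the contravariant functor on \<open>\<theta> : [m] \<rightarrow> [n]\<close>.\<close>

locale semisimplicial_space =
  fixes Y :: "nat \<Rightarrow> 'a topology"
    and act :: "nat \<Rightarrow> nat \<Rightarrow> (nat \<Rightarrow> nat) \<Rightarrow> 'a \<Rightarrow> 'a"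
  assumes act_continuous: "\<theta> \<in> mon_delta m n \<Longrightarrow> continuous_map (Y n) (Y m) (act m n \<theta>)"
    and act_id: "y \<in> topspace (Y n) \<Longrightarrow> act n n (\<lambda>i\<in>{..n}. i) y = y"
    and act_compose: "\<theta> \<in> mon_delta l m \<Longrightarrow> \<eta> \<in> mon_delta m n \<Longrightarrow> y \<in> topspace (Y n) \<Longrightarrow>
           act l n (compose {..l} \<eta> \<theta>) y = act l m \<theta> (act m n \<eta> y)"

locale reduced_semisimplicial_space = semisimplicial_space +
  assumes reduced: "\<exists>p. topspace (Y 0) = {p}"

abbreviation simplex_space :: "nat \<Rightarrow> (nat \<Rightarrow> real) topology" where
  "simplex_space n \<equiv> subtopology (powertop_real UNIV) (standard_simplex n)"

definition simplex_vertex :: "nat \<Rightarrow> nat \<Rightarrow> real" where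
  "simplex_vertex i = (\<lambda>j. if j = i then 1 else 0)"

text \<open>The affine map \<open>\<theta>\<^sub>* : \<Delta>\<^sup>m \<rightarrow> \<Delta>\<^sup>n\<close> sending the \<open>i\<close>-th vertex to the \<open>\<theta> i\<close>-th one.\<close>

definition simplex_push :: "nat \<Rightarrow> (nat \<Rightarrow> nat) \<Rightarrow> (nat \<Rightarrow> real) \<Rightarrow> nat \<Rightarrow> real" where
  "simplex_push m \<theta> t = (\<lambda>j. \<Sum>i | i \<le> m \<and> \<theta> i = j. t i)"

definition fat_coproduct :: "(nat \<Rightarrow> 'a topology) \<Rightarrow> (nat \<times> 'a \<times> (nat \<Rightarrow> real)) topology" where
  "fat_coproduct Y = sum_topology (\<lambda>n. prod_topology (Y n) (simplex_space n)) UNIV"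

definition face_identifications ::
  "(nat \<Rightarrow> 'a topology) \<Rightarrow> (nat \<Rightarrow> nat \<Rightarrow> (nat \<Rightarrow> nat) \<Rightarrow> 'a \<Rightarrow> 'a) \<Rightarrow>
   (nat \<times> 'a \<times> (nat \<Rightarrow> real)) rel" where
  "face_identifications Y act =
     {((m, act m n \<theta> y, t), (n, y, simplex_push m \<theta> t)) |m n \<theta> y t.
        \<theta> \<in> mon_delta m n \<and> y \<in> topspace (Y n) \<and> t \<in> standard_simplex m}"

text \<open>The equivalence relation on the coproduct generated by the face identifications.\<close>

definition face_equivalence ::
  "(nat \<Rightarrow> 'a topology) \<Rightarrow> (nat \<Rightarrow> nat \<Rightarrow> (nat \<Rightarrow> nat) \<Rightarrow> 'a \<Rightarrow> 'a) \<Rightarrow>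
   (nat \<times> 'a \<times> (nat \<Rightarrow> real)) rel" where
  "face_equivalence Y act =
     Restr ((face_identifications Y act \<union> (face_identifications Y act)\<inverse>)\<^sup>*)
           (topspace (fat_coproduct Y))"

definition fat_realization ::
  "(nat \<Rightarrow> 'a topology) \<Rightarrow> (nat \<Rightarrow> nat \<Rightarrow> (nat \<Rightarrow> nat) \<Rightarrow> 'a \<Rightarrow> 'a) \<Rightarrow>
   (nat \<times> 'a \<times> (nat \<Rightarrow> real)) set topology" where
  "fat_realization Y act = quotient_topology (fat_coproduct Y) (face_equivalence Y act)"

section \<open>The functor \<open>\<Omega>\<close> and the counit\<close>

definition Omega_space :: "'a topology \<Rightarrow> 'a \<Rightarrow> nat \<Rightarrow> ((nat \<Rightarrow> real) \<Rightarrow> 'a) topology" where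
  "Omega_space X x0 n =
     subtopology (compact_open_topology (simplex_space n) X)
                 {\<sigma>. \<forall>i\<le>n. \<sigma> (simplex_vertex i) = x0}"

text \<open>The action depends only on \<open>m\<close> and \<open>\<theta> : [m] \<rightarrow> [n]\<close>, since the argument \<open>\<sigma>\<close> is a map on
  \<open>\<Delta>\<^sup>n\<close> already.\<close>

definition Omega_act ::
  "nat \<Rightarrow> nat \<Rightarrow> (nat \<Rightarrow> nat) \<Rightarrow> ((nat \<Rightarrow> real) \<Rightarrow> 'a) \<Rightarrow> ((nat \<Rightarrow> real) \<Rightarrow> 'a)" where
  "Omega_act m n \<theta> \<sigma> = restrict (\<sigma> \<circ> simplex_push m \<theta>) (standard_simplex m)"

text \<open>The map induced on equivalence classes by evaluation; it is well defined by
  \<open>Omega_counit_class\<close> below.\<close>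

definition Omega_counit :: "(nat \<times> ((nat \<Rightarrow> real) \<Rightarrow> 'a) \<times> (nat \<Rightarrow> real)) set \<Rightarrow> 'a" where
  "Omega_counit c = the_elem ((\<lambda>(n, \<sigma>, t). \<sigma> t) ` c)"

lemma mon_deltaD:
  assumes "\<theta> \<in> mon_delta m n"
  shows "\<And>i. i \<le> m \<Longrightarrow> \<theta> i \<le> n" "inj_on \<theta> {..m}"
  using assms by (auto simp: mon_delta_def intro: strict_mono_on_imp_inj_on)

lemma simplex_push_in:
  assumes \<theta>: "\<theta> \<in> mon_delta m n" and t: "t \<in> standard_simplex m"
  shows "simplex_push m \<theta> t \<in> standard_simplex n"
proof -
  have t0: "\<And>i. 0 \<le> t i" and t1: "(\<Sum>i\<le>m. t i) = 1"
    using t by (auto simp: standard_simplex_def)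
  have "(\<Sum>j\<le>n. simplex_push m \<theta> t j) = (\<Sum>j\<le>n. \<Sum>i | i \<in> {..m} \<and> \<theta> i = j. t i)"
    by (simp add: simplex_push_def)
  also have "\<dots> = (\<Sum>i\<le>m. t i)"
    by (rule sum.group) (use mon_deltaD[OF \<theta>] in auto)
  finally have s: "(\<Sum>j\<le>n. simplex_push m \<theta> t j) = 1" using t1 by simp
  have ge0: "0 \<le> simplex_push m \<theta> t j" for j
    unfolding simplex_push_def by (intro sum_nonneg t0)
  have le1: "simplex_push m \<theta> t j \<le> 1" for j
    unfolding simplex_push_def t1[symmetric] by (rule sum_mono2) (auto simp: t0)
  have "simplex_push m \<theta> t j = 0" if "j > n" for j
    unfolding simplex_push_def by (rule sum.neutral) (use mon_deltaD(1)[OF \<theta>] that in \<open>auto dest: leD\<close>)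
  with s ge0 le1 show ?thesis by (simp add: standard_simplex_def)
qed

lemma simplex_push_vertex:
  assumes "i \<le> m"
  shows "simplex_push m \<theta> (simplex_vertex i) = simplex_vertex (\<theta> i)"
proof
  fix j
  have "simplex_push m \<theta> (simplex_vertex i) j = (\<Sum>k\<in>{k. k \<le> m \<and> \<theta> k = j}. if k = i then 1 else 0)"
    by (simp add: simplex_push_def simplex_vertex_def)
  also have "\<dots> = (if i \<in> {k. k \<le> m \<and> \<theta> k = j} then 1 else 0)"
    by (subst sum.delta) auto
  finally show "simplex_push m \<theta> (simplex_vertex i) j = simplex_vertex (\<theta> i) j"
    using assms by (auto simp: simplex_vertex_def)
qed

lemma simplex_push_id:
  assumes "t \<in> standard_simplex n"
  shows "simplex_push n (\<lambda>i\<in>{..n}. i) t = t"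
proof
  fix j
  show "simplex_push n (\<lambda>i\<in>{..n}. i) t j = t j"
  proof (cases "j \<le> n")
    case True
    then have "{i. i \<le> n \<and> (\<lambda>i\<in>{..n}. i) i = j} = {j}" by auto
    then show ?thesis by (simp add: simplex_push_def)
  next
    case False
    then have *: "{i. i \<le> n \<and> (\<lambda>i\<in>{..n}. i) i = j} = {}" by auto
    show ?thesis unfolding simplex_push_def * using False assms by (simp add: standard_simplex_def)
  qed
qed

lemma simplex_push_compose:
  assumes \<theta>: "\<theta> \<in> mon_delta l m"
  shows "simplex_push m \<eta> (simplex_push l \<theta> t) = simplex_push l (compose {..l} \<eta> \<theta>) t"
proof
  fix k
  let ?S = "{i. i \<le> l \<and> compose {..l} \<eta> \<theta> i = k}"
  have "simplex_push l (compose {..l} \<eta> \<theta>) t k = (\<Sum>i\<in>?S. t i)"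
    by (simp add: simplex_push_def)
  also have "\<dots> = (\<Sum>j | j \<le> m \<and> \<eta> j = k. \<Sum>i | i \<in> ?S \<and> \<theta> i = j. t i)"
    by (rule sum.group[symmetric]) (use mon_deltaD(1)[OF \<theta>] in \<open>auto simp: compose_def\<close>)
  also have "\<dots> = (\<Sum>j | j \<le> m \<and> \<eta> j = k. \<Sum>i | i \<le> l \<and> \<theta> i = j. t i)"
    by (intro sum.cong) (auto simp: compose_def)
  finally show "simplex_push m \<eta> (simplex_push l \<theta> t) k = simplex_push l (compose {..l} \<eta> \<theta>) t k"
    by (simp add: simplex_push_def)
qed

lemma continuous_map_simplex_push:
  assumes "\<theta> \<in> mon_delta m n"
  shows "continuous_map (simplex_space m) (simplex_space n) (simplex_push m \<theta>)"
proof -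
  have "continuous_map (simplex_space m) euclideanreal (\<lambda>t. simplex_push m \<theta> t j)" for j
    unfolding simplex_push_def
    by (intro continuous_map_from_subtopology continuous_map_sum continuous_map_product_projection) auto
  then show ?thesis
    using simplex_push_in[OF assms]
    by (auto simp: continuous_map_in_subtopology continuous_map_componentwise)
qed

lemma topspace_Omega_space:
  "topspace (Omega_space X x0 n) =
     {\<sigma>. singular_simplex n X \<sigma> \<and> (\<forall>i\<le>n. \<sigma> (simplex_vertex i) = x0)}"
  by (auto simp: Omega_space_def singular_simplex_def)

lemma vertex_in [simp]: "i \<le> n \<Longrightarrow> simplex_vertex i \<in> standard_simplex n"
  by (simp add: simplex_vertex_def)

lemma id_in_mon_delta: "(\<lambda>i\<in>{..n}. i) \<in> mon_delta n n"
  by (auto simp: mon_delta_def strict_mono_on_def)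

lemma Omega_act_in:
  assumes \<theta>: "\<theta> \<in> mon_delta m n" and \<sigma>: "\<sigma> \<in> topspace (Omega_space X x0 n)"
  shows "Omega_act m n \<theta> \<sigma> \<in> topspace (Omega_space X x0 m)"
proof -
  have "continuous_map (simplex_space m) X (\<sigma> \<circ> simplex_push m \<theta>)"
    using continuous_map_simplex_push[OF \<theta>] \<sigma>
    by (auto simp: topspace_Omega_space singular_simplex_def intro: continuous_map_compose)
  then have "singular_simplex m X (Omega_act m n \<theta> \<sigma>)"
    by (auto simp: singular_simplex_def Omega_act_def elim: continuous_map_eq)
  moreover have "Omega_act m n \<theta> \<sigma> (simplex_vertex i) = x0" if "i \<le> m" for i
    using that \<sigma> mon_deltaD(1)[OF \<theta> that]
    by (simp add: Omega_act_def topspace_Omega_space simplex_push_vertex)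
  ultimately show ?thesis by (simp add: topspace_Omega_space)
qed

lemma Omega_act_continuous:
  assumes \<theta>: "\<theta> \<in> mon_delta m n"
  shows "continuous_map (Omega_space X x0 n) (Omega_space X x0 m) (Omega_act m n \<theta>)"
proof -
  have "continuous_map (Omega_space X x0 n) (compact_open_topology (simplex_space m) X) (Omega_act m n \<theta>)"
  proof (rule continuous_map_into_compact_open)
    fix \<sigma> assume "\<sigma> \<in> topspace (Omega_space X x0 n)"
    from Omega_act_in[OF \<theta> this]
    show "Omega_act m n \<theta> \<sigma> \<in> topspace (compact_open_topology (simplex_space m) X)"
      by (simp add: Omega_space_def)
  next
    fix K U assume K: "compactin (simplex_space m) K" and U: "openin X U"
    have K': "compactin (simplex_space n) (simplex_push m \<theta> ` K)"
      using image_compactin[OF K continuous_map_simplex_push[OF \<theta>]] .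
    have "K \<subseteq> standard_simplex m"
      using compactin_subset_topspace[OF K] by simp
    then have "{\<sigma> \<in> topspace (Omega_space X x0 n). Omega_act m n \<theta> \<sigma> ` K \<subseteq> U} =
      {\<sigma> \<in> topspace (compact_open_topology (simplex_space n) X). \<sigma> ` simplex_push m \<theta> ` K \<subseteq> U}
       \<inter> {\<sigma>. \<forall>i\<le>n. \<sigma> (simplex_vertex i) = x0}"
      by (auto simp: Omega_act_def Omega_space_def image_subset_iff subset_iff)
    then show "openin (Omega_space X x0 n) {\<sigma> \<in> topspace (Omega_space X x0 n). Omega_act m n \<theta> \<sigma> ` K \<subseteq> U}"
      unfolding Omega_space_def using openin_compact_open_subbasis[OF K' U]
      by (metis (no_types, lifting) openin_subtopology)
  qed
  moreover have "Omega_act m n \<theta> \<sigma> (simplex_vertex i) = x0"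
    if "\<sigma> \<in> topspace (Omega_space X x0 n)" "i \<le> m" for \<sigma> i
    using Omega_act_in[OF \<theta> that(1)] that(2) by (simp add: topspace_Omega_space)
  ultimately show ?thesis
    by (subst (2) Omega_space_def) (auto simp: continuous_map_in_subtopology)
qed

lemma reduced_semisimplicial_space_Omega:
  assumes x0: "x0 \<in> topspace X"
  shows "reduced_semisimplicial_space (Omega_space X x0) Omega_act"
proof unfold_locales
  fix \<theta> m n assume "\<theta> \<in> mon_delta m n"
  then show "continuous_map (Omega_space X x0 n) (Omega_space X x0 m) (Omega_act m n \<theta>)"
    by (rule Omega_act_continuous)
next
  fix \<sigma> n assume \<sigma>: "\<sigma> \<in> topspace (Omega_space X x0 n)"
  show "Omega_act n n (\<lambda>i\<in>{..n}. i) \<sigma> = \<sigma>"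
  proof (rule extensionalityI)
    show "Omega_act n n (\<lambda>i\<in>{..n}. i) \<sigma> \<in> extensional (standard_simplex n)"
      by (simp add: Omega_act_def)
    show "\<sigma> \<in> extensional (standard_simplex n)"
      using \<sigma> by (simp add: topspace_Omega_space singular_simplex_def)
    fix t assume "t \<in> standard_simplex n"
    then show "Omega_act n n (\<lambda>i\<in>{..n}. i) \<sigma> t = \<sigma> t"
      by (simp only: Omega_act_def restrict_apply' comp_apply simplex_push_id)
  qed
next
  fix \<theta> l m \<eta> n and \<sigma> :: "(nat \<Rightarrow> real) \<Rightarrow> 'a"
  assume \<theta>: "\<theta> \<in> mon_delta l m"
  show "Omega_act l n (compose {..l} \<eta> \<theta>) \<sigma> = Omega_act l m \<theta> (Omega_act m n \<eta> \<sigma>)"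
    using simplex_push_in[OF \<theta>] simplex_push_compose[OF \<theta>, of \<eta>]
    by (intro ext) (simp add: Omega_act_def restrict_def)
next
  have v: "standard_simplex 0 = {simplex_vertex 0}"
    by (simp add: standard_simplex_0 simplex_vertex_def)
  let ?c = "restrict (\<lambda>_. x0) (standard_simplex 0)"
  have "\<sigma> = ?c" if \<sigma>: "\<sigma> \<in> topspace (Omega_space X x0 0)" for \<sigma>
  proof (rule extensionalityI)
    show "\<sigma> \<in> extensional (standard_simplex 0)"
      using \<sigma> by (simp add: topspace_Omega_space singular_simplex_def)
    show "?c \<in> extensional (standard_simplex 0)" by simp
    fix t assume "t \<in> standard_simplex 0"
    then show "\<sigma> t = ?c t"
      using \<sigma> v by (simp add: topspace_Omega_space)
  qed
  moreover have "?c \<in> topspace (Omega_space X x0 0)"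
  proof -
    have "continuous_map (simplex_space 0) X ?c"
      by (rule continuous_map_eq[of _ _ "\<lambda>_. x0"]) (use x0 in auto)
    then show ?thesis by (simp add: topspace_Omega_space singular_simplex_def)
  qed
  ultimately show "\<exists>p. topspace (Omega_space X x0 0) = {p}" by blast
qed

lemma topspace_fat_coproduct:
  "(n, y, t) \<in> topspace (fat_coproduct Y) \<longleftrightarrow> y \<in> topspace (Y n) \<and> t \<in> standard_simplex n"
  by (auto simp: fat_coproduct_def)

lemma equiv_face_equivalence: "equiv (topspace (fat_coproduct Y)) (face_equivalence Y act)"
proof -
  let ?R = "(face_identifications Y act \<union> (face_identifications Y act)\<inverse>)\<^sup>*"
  have "sym ?R" by (rule sym_rtrancl) (auto simp: sym_def)
  moreover have "trans ?R" by (rule trans_rtrancl)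
  ultimately show ?thesis
    by (auto simp: equiv_def refl_on_def face_equivalence_def sym_def intro!: transI dest: transD)
qed

lemma face_equivalence_respects:
  assumes "\<And>m n \<theta> y t. \<theta> \<in> mon_delta m n \<Longrightarrow> y \<in> topspace (Y n) \<Longrightarrow> t \<in> standard_simplex m \<Longrightarrow>
             h (m, act m n \<theta> y, t) = h (n, y, simplex_push m \<theta> t)"
    and "(p, q) \<in> face_equivalence Y act"
  shows "h p = h q"
proof -
  have "(p, q) \<in> (face_identifications Y act \<union> (face_identifications Y act)\<inverse>)\<^sup>*"
    using assms(2) by (simp add: face_equivalence_def)
  then show ?thesis
  proof induction
    case (step y z)
    then show ?case using assms(1) by (auto simp: face_identifications_def)
  qed simp
qed

lemma Omega_counit_class:
  assumes "\<sigma> \<in> topspace (Omega_space X x0 n)" "t \<in> standard_simplex n"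
  shows "Omega_counit (face_equivalence (Omega_space X x0) Omega_act `` {(n, \<sigma>, t)}) = \<sigma> t"
proof -
  let ?E = "face_equivalence (Omega_space X x0) Omega_act"
  let ?h = "\<lambda>(n, \<sigma>, t). \<sigma> t"
  have "?h p = ?h q" if "(p, q) \<in> ?E" for p q
    by (rule face_equivalence_respects[OF _ that]) (auto simp: Omega_act_def)
  then have "?h q = \<sigma> t" if "q \<in> ?E `` {(n, \<sigma>, t)}" for q
    using that by fastforce
  moreover have "((n, \<sigma>, t), (n, \<sigma>, t)) \<in> ?E"
    using equiv_face_equivalence assms
    by (metis equiv_def refl_on_def topspace_fat_coproduct)
  ultimately have "?h ` (?E `` {(n, \<sigma>, t)}) = {\<sigma> t}"
    by (intro equalityI subsetI) (auto simp: image_iff intro!: bexI[of _ "(n, \<sigma>, t)"])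
  then show ?thesis by (simp add: Omega_counit_def)
qed

lemma continuous_map_from_fat_realization:
  "continuous_map (fat_realization Y act) X g \<longleftrightarrow>
   (\<forall>n. continuous_map (prod_topology (Y n) (simplex_space n)) X
          (\<lambda>(y, t). g (face_equivalence Y act `` {(n, y, t)})))"
proof -
  let ?q = "\<lambda>p. face_equivalence Y act `` {p}"
  have "continuous_map (fat_realization Y act) X g \<longleftrightarrow> continuous_map (fat_coproduct Y) X (g \<circ> ?q)"
    unfolding fat_realization_def
    using continuous_compose_quotient_map_eq[OF quotient_map_quotient_topology] by blast
  also have "\<dots> \<longleftrightarrow> (\<forall>n. continuous_map (prod_topology (Y n) (simplex_space n)) X (\<lambda>p. g (?q (n, p))))"
    (is "?L \<longleftrightarrow> ?R")
  proof
    assume L: ?L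
    have "continuous_map (prod_topology (Y n) (simplex_space n)) (fat_coproduct Y) (\<lambda>p. (n, p))" for n
      unfolding fat_coproduct_def by (rule continuous_map_component_injection) simp
    from continuous_map_compose[OF this L] show ?R by (simp add: o_def)
  next
    assume R: ?R
    show ?L
      unfolding continuous_map_def
    proof (intro conjI allI impI)
      show "g \<circ> ?q \<in> topspace (fat_coproduct Y) \<rightarrow> topspace X"
      proof
        fix p assume "p \<in> topspace (fat_coproduct Y)"
        then obtain n p' where "p = (n, p')" "p' \<in> topspace (prod_topology (Y n) (simplex_space n))"
          by (auto simp: fat_coproduct_def)
        then show "(g \<circ> ?q) p \<in> topspace X"
          using R unfolding continuous_map_def by fastforce
      qed
      fix U assume U: "openin X U"
      have "openin (prod_topology (Y n) (simplex_space n))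
              {p. (n, p) \<in> {p \<in> topspace (fat_coproduct Y). (g \<circ> ?q) p \<in> U}}" for n
      proof -
        have "{p. (n, p) \<in> {p \<in> topspace (fat_coproduct Y). (g \<circ> ?q) p \<in> U}} =
              {p \<in> topspace (prod_topology (Y n) (simplex_space n)). g (?q (n, p)) \<in> U}"
          by (auto simp: fat_coproduct_def)
        moreover have "openin (prod_topology (Y n) (simplex_space n)) \<dots>"
          using R U unfolding continuous_map_def by blast
        ultimately show ?thesis by simp
      qed
      then show "openin (fat_coproduct Y) {p \<in> topspace (fat_coproduct Y). (g \<circ> ?q) p \<in> U}"
        by (subst fat_coproduct_def, subst openin_sum_topology) (auto simp: fat_coproduct_def)
    qed
  qed
  finally show ?thesis by (simp add: case_prod_unfold)
qed

lemma continuous_map_Omega_counit: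
  "continuous_map (fat_realization (Omega_space X x0) Omega_act) X Omega_counit"
  unfolding continuous_map_from_fat_realization
proof
  fix n
  have "compact_space (simplex_space n)"
    by (simp add: compact_space_subtopology compactin_standard_simplex)
  moreover have "Hausdorff_space (simplex_space n)"
    by (intro Hausdorff_space_subtopology) (simp add: Hausdorff_space_product_topology)
  ultimately have "continuous_map (prod_topology (compact_open_topology (simplex_space n) X) (simplex_space n)) X
      (\<lambda>(\<sigma>, t). \<sigma> t)"
    by (rule continuous_map_evaluation)
  then have "continuous_map (prod_topology (Omega_space X x0 n) (simplex_space n)) X (\<lambda>(\<sigma>, t). \<sigma> t)"
    unfolding Omega_space_def prod_topology_subtopology(1)
    by (rule continuous_map_from_subtopology)
  then show "continuous_map (prod_topology (Omega_space X x0 n) (simplex_space n)) X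
      (\<lambda>(\<sigma>, t). Omega_counit (face_equivalence (Omega_space X x0) Omega_act `` {(n, \<sigma>, t)}))"
    by (rule continuous_map_eq) (auto simp: Omega_counit_class)
qed

text \<open>The universal property that makes \<open>Omega_counit\<close> the counit of the adjunction: every based
  map out of the realization of a reduced semisimplicial space factors through it by a unique
  semisimplicial map.\<close>

definition semisimplicial_map ::
  "(nat \<Rightarrow> 'a topology) \<Rightarrow> (nat \<Rightarrow> nat \<Rightarrow> (nat \<Rightarrow> nat) \<Rightarrow> 'a \<Rightarrow> 'a) \<Rightarrow>
   (nat \<Rightarrow> 'b topology) \<Rightarrow> (nat \<Rightarrow> nat \<Rightarrow> (nat \<Rightarrow> nat) \<Rightarrow> 'b \<Rightarrow> 'b) \<Rightarrow>
   (nat \<Rightarrow> 'a \<Rightarrow> 'b) \<Rightarrow> bool" where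
  "semisimplicial_map Y act Z act' \<phi> \<longleftrightarrow>
     (\<forall>n. continuous_map (Y n) (Z n) (\<phi> n)) \<and>
     (\<forall>m n. \<forall>\<theta>\<in>mon_delta m n. \<forall>y\<in>topspace (Y n). \<phi> m (act m n \<theta> y) = act' m n \<theta> (\<phi> n y))"

lemma Omega_counit_universal:
  fixes Y :: "nat \<Rightarrow> 'b topology" and X :: "'a topology"
  assumes Y: "reduced_semisimplicial_space Y act"
    and g: "continuous_map (fat_realization Y act) X g"
    and based: "\<And>y. y \<in> topspace (Y 0) \<Longrightarrow> g (face_equivalence Y act `` {(0, y, simplex_vertex 0)}) = x0"
  defines "lifts \<equiv> \<lambda>\<phi>. semisimplicial_map Y act (Omega_space X x0) Omega_act \<phi> \<and>
      (\<forall>n. \<forall>y \<in> topspace (Y n). \<forall>t \<in> standard_simplex n.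
         Omega_counit (face_equivalence (Omega_space X x0) Omega_act `` {(n, \<phi> n y, t)}) =
         g (face_equivalence Y act `` {(n, y, t)}))"
  shows "\<exists>\<phi>. lifts \<phi> \<and> (\<forall>\<psi>. lifts \<psi> \<longrightarrow> (\<forall>n. \<forall>y \<in> topspace (Y n). \<psi> n y = \<phi> n y))"
proof -
  interpret reduced_semisimplicial_space Y act by (rule Y)
  define G where "G n y t = g (face_equivalence Y act `` {(n, y, t)})" for n y t
  define \<phi> where "\<phi> n y = restrict (G n y) (standard_simplex n)" for n y
  have G_face: "G m (act m n \<theta> y) t = G n y (simplex_push m \<theta> t)"
    if \<theta>: "\<theta> \<in> mon_delta m n" and y: "y \<in> topspace (Y n)" and t: "t \<in> standard_simplex m" for m n \<theta> y t
  proof -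
    have "((m, act m n \<theta> y, t), (n, y, simplex_push m \<theta> t)) \<in> face_identifications Y act"
      using that unfolding face_identifications_def by blast
    moreover have "act m n \<theta> y \<in> topspace (Y m)"
      using act_continuous[OF \<theta>] y by (auto simp: continuous_map_def)
    ultimately have "((m, act m n \<theta> y, t), (n, y, simplex_push m \<theta> t)) \<in> face_equivalence Y act"
      using that simplex_push_in[OF \<theta> t]
      by (auto simp: face_equivalence_def topspace_fat_coproduct)
    then show ?thesis
      unfolding G_def using equiv_class_eq[OF equiv_face_equivalence] by metis
  qed
  have G_vertex: "G n y (simplex_vertex i) = x0" if y: "y \<in> topspace (Y n)" and i: "i \<le> n" for n y i
  proof -
    let ?\<theta> = "\<lambda>k\<in>{..0::nat}. i"
    have \<theta>: "?\<theta> \<in> mon_delta 0 n" using i by (auto simp: mon_delta_def strict_mono_on_def)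
    have "act 0 n ?\<theta> y \<in> topspace (Y 0)"
      using act_continuous[OF \<theta>] y by (auto simp: continuous_map_def)
    from based[OF this] have "G 0 (act 0 n ?\<theta> y) (simplex_vertex 0) = x0"
      by (simp add: G_def)
    then show ?thesis
      using G_face[OF \<theta> y, of "simplex_vertex 0"] by (simp add: simplex_push_vertex)
  qed
  have \<phi>_cont: "continuous_map (Y n) (Omega_space X x0 n) (\<phi> n)" for n
  proof -
    have "continuous_map (prod_topology (Y n) (simplex_space n)) X (\<lambda>(y, t). G n y t)"
      using g by (simp add: continuous_map_from_fat_realization G_def)
    from continuous_map_curry[OF this]
    have "continuous_map (Y n) (compact_open_topology (simplex_space n) X) (\<phi> n)"
      by (simp add: \<phi>_def[abs_def])
    then show ?thesis
      by (auto simp: Omega_space_def continuous_map_in_subtopology \<phi>_def G_vertex)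
  qed
  have \<phi>_act: "\<phi> m (act m n \<theta> y) = Omega_act m n \<theta> (\<phi> n y)"
    if "\<theta> \<in> mon_delta m n" "y \<in> topspace (Y n)" for m n \<theta> y
    using G_face[OF that] simplex_push_in[OF that(1)]
    by (intro ext) (simp add: \<phi>_def Omega_act_def restrict_def)
  have "lifts \<phi>"
    unfolding lifts_def semisimplicial_map_def
  proof (intro conjI allI ballI)
    fix n y t assume y: "y \<in> topspace (Y n)" and t: "t \<in> standard_simplex n"
    have "\<phi> n y \<in> topspace (Omega_space X x0 n)"
      using \<phi>_cont y by (auto simp: continuous_map_def)
    then show "Omega_counit (face_equivalence (Omega_space X x0) Omega_act `` {(n, \<phi> n y, t)}) =
         g (face_equivalence Y act `` {(n, y, t)})"
      using t by (simp add: Omega_counit_class) (simp add: \<phi>_def G_def)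
  qed (use \<phi>_cont \<phi>_act in auto)
  moreover have "\<psi> n y = \<phi> n y" if \<psi>: "lifts \<psi>" and y: "y \<in> topspace (Y n)" for \<psi> n y
  proof (rule extensionalityI)
    have mem: "\<psi> n y \<in> topspace (Omega_space X x0 n)"
      using \<psi> y by (auto simp: lifts_def semisimplicial_map_def continuous_map_def)
    then show "\<psi> n y \<in> extensional (standard_simplex n)"
      by (simp add: topspace_Omega_space singular_simplex_def)
    show "\<phi> n y \<in> extensional (standard_simplex n)"
      by (simp add: \<phi>_def)
    fix t assume t: "t \<in> standard_simplex n"
    have "Omega_counit (face_equivalence (Omega_space X x0) Omega_act `` {(n, \<psi> n y, t)}) = G n y t"
      using \<psi> y t by (simp add: lifts_def G_def)
    then show "\<psi> n y t = \<phi> n y t"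
      using Omega_counit_class[OF mem t] t by (simp add: \<phi>_def)
  qed
  ultimately show ?thesis by blast
qed

end

(*
  The realization of a reduced semisimplicial space is a Dold space.  A point of a simplex is
  determined by the partial sums of its barycentric coordinates, and inserting zeros does not change
  the set of these sums.  Where a level r in (0,1) is not a partial sum, the vertex at which the sums
  cross r is locally constant, and moving straight to it contracts this open subset of the
  realization to the base point.  A point has finitely many partial sums, so countably many levels
  suffice to cover.  Dold spaces are closed under homotopy domination, which gives one direction.

  Conversely let X be a path-connected Dold space, with contractions h of the members of a numerable
  cover to the base point.  If x lies in the members with indices i_0 < ... < i_m, its paths h(i_k)
  form a simplex with all vertices at the base point: it is constantly x on the middle of the simplex
  and runs along the k-th path where the k-th coordinate exceeds 1/2.  The partition of unity picks a
  point of this simplex, and this defines g : X -> ||Omega X||.  Shrinking the coordinates gives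
  v g ~ id.  For g v ~ id, let sigma be a simplex and x = sigma(t).  Both sigma and the simplex of x
  contract to x, so together they extend over the join of the two simplices; the segment in the
  join from t to the point picked by g is the required homotopy.  All constructions commute with face
  maps, so no general theory of realizations is needed.
*)

theory Submission
  imports Defs
begin

section \<open>Partitions of unity and homotopy domination\<close>

text \<open>Homotopies out of the realization are curried: each is a continuous map into the
  compact-open space of paths. Such a map descends along the face identifications like any other
  map, and it uncurries because [0,1] is compact Hausdorff; the product of the quotient map with
  [0,1] never has to be studied.

  The indices of a cover carry no order, whereas the vertices of a simplex do. A strict total order
  on all indices turns an inclusion of finite index sets into a morphism of
  \<open>mon_delta\<close>. Different finite lists of indices at the same point are then related by
  face maps: a listed member that vanishes at the point only adds a vertex of weight zero.

  The constant 1/2 keeps the contracting paths apart. At most one barycentric coordinate exceeds it,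
  so at most one path is run at a time, and in the join the retraction to the first factor has
  already become constant before a path along the second factor starts.\<close>

lemma continuous_map_real_Max:
  fixes f :: "'i \<Rightarrow> 'a \<Rightarrow> real"
  assumes "finite F" "F \<noteq> {}" and "\<And>i. i \<in> F \<Longrightarrow> continuous_map X euclideanreal (f i)"
  shows "continuous_map X euclideanreal (\<lambda>x. Max ((\<lambda>i. f i x) ` F))"
  using assms
proof (induction F rule: finite_ne_induct)
  case (insert i F)
  then show ?case by (simp add: continuous_map_real_max)
qed simp

text \<open>Infinitely many \<open>\<rho> i\<close> may be positive at one point, so they are not
  normalized directly. Their maximum \<open>M\<close> is well behaved: near \<open>x\<close> some
  \<open>\<rho> k\<close> exceeds \<open>\<epsilon>\<close> and only finitely many exceed
  \<open>\<epsilon> / 2\<close>, so \<open>M\<close> is locally a finite maximum. Cutting each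
  \<open>\<rho> i\<close> off at half of \<open>M\<close> leaves a locally finite family that can be
  divided by its sum.\<close>

lemma partition_of_unity_shrink:
  fixes \<rho> :: "'i \<Rightarrow> 'a \<Rightarrow> real"
  assumes cont: "\<And>i. i \<in> I \<Longrightarrow> continuous_map X euclideanreal (\<rho> i)"
    and loc: "\<And>x. x \<in> topspace X \<Longrightarrow> \<exists>V \<epsilon> k. openin X V \<and> x \<in> V \<and> 0 < \<epsilon> \<and> k \<in> I \<and>
        (\<forall>y\<in>V. \<epsilon> < \<rho> k y) \<and> finite {i \<in> I. \<exists>y\<in>V. \<epsilon> / 2 < \<rho> i y}"
  obtains p where "partition_of_unity_on X I p"
    and "\<And>i. i \<in> I \<Longrightarrow> closed_support X (p i) \<subseteq> {x \<in> topspace X. 0 < \<rho> i x}"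
proof -
  define Q where "Q x = (\<lambda>(V, \<epsilon>, k). openin X V \<and> x \<in> V \<and> 0 < \<epsilon> \<and> k \<in> I \<and>
      (\<forall>y\<in>V. \<epsilon> < \<rho> k y) \<and> finite {i \<in> I. \<exists>y\<in>V. \<epsilon> / 2 < \<rho> i y})" for x
  have "\<forall>x\<in>topspace X. \<exists>T. Q x T"
    using loc unfolding Q_def by fast
  then obtain T where T: "\<And>x. x \<in> topspace X \<Longrightarrow> Q x (T x)"
    by metis
  define V \<epsilon> k where "V = fst \<circ> T" "\<epsilon> = fst \<circ> snd \<circ> T" "k = snd \<circ> snd \<circ> T"
  note VT = this
  have V: "openin X (V x)" "x \<in> V x" and \<epsilon>: "0 < \<epsilon> x" and k: "k x \<in> I"
    and k_gt: "\<And>y. y \<in> V x \<Longrightarrow> \<epsilon> x < \<rho> (k x) y"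
    and fin: "finite {i \<in> I. \<exists>y\<in>V x. \<epsilon> x / 2 < \<rho> i y}" if "x \<in> topspace X" for x
    using T[OF that] by (auto simp: Q_def VT split: prod.splits)
  have Vsub: "V x \<subseteq> topspace X" if "x \<in> topspace X" for x
    using V that openin_subset by blast
  define F where "F x = {i \<in> I. \<exists>y\<in>V x. \<epsilon> x / 2 < \<rho> i y}" for x
  have F: "finite (F x)" "F x \<subseteq> I" "k x \<in> F x" if "x \<in> topspace X" for x
    using that fin k k_gt[OF that, of x] V \<epsilon>[OF that] by (force simp: F_def)+
  define M where "M y = Max ((\<lambda>i. \<rho> i y) ` F y)" for y
  \<comment> \<open>On \<open>V x\<close> an index outside \<open>F x\<close> has value at most
    \<open>\<epsilon> x / 2\<close>, hence below the value at \<open>k x\<close>, which belongs to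
    \<open>F x\<close>.\<close>
  have Max_F: "\<rho> i y \<le> Max ((\<lambda>i. \<rho> i y) ` F x)" if "x \<in> topspace X" "y \<in> V x" "i \<in> I" for x y i
  proof (cases "i \<in> F x")
    case False
    then have "\<rho> i y \<le> \<epsilon> x / 2" using that by (force simp: F_def)
    also have "\<dots> \<le> \<rho> (k x) y" using k_gt[OF that(1,2)] \<epsilon>[OF that(1)] by simp
    also have "\<dots> \<le> Max ((\<lambda>i. \<rho> i y) ` F x)" using F[OF that(1)] by (intro Max_ge) auto
    finally show ?thesis .
  qed (use F[OF that(1)] in \<open>auto intro: Max_ge\<close>)
  have Max_attained: "\<exists>i\<in>F x. \<rho> i y = Max ((\<lambda>i. \<rho> i y) ` F x)" if "x \<in> topspace X" for x y
    using Max_in[of "(\<lambda>i. \<rho> i y) ` F x"] F[OF that] by fastforce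
  \<comment> \<open>Both maxima are attained at indices in \<open>I\<close>, so each bounds the
    other through \<open>Max_F\<close>.\<close>
  have M_local: "M y = Max ((\<lambda>i. \<rho> i y) ` F x)" if "x \<in> topspace X" "y \<in> V x" for x y
  proof -
    have x: "x \<in> topspace X" and y: "y \<in> topspace X" "y \<in> V y" using that Vsub V by blast+
    obtain i j where "i \<in> F y" "\<rho> i y = M y" "j \<in> F x" "\<rho> j y = Max ((\<lambda>i. \<rho> i y) ` F x)"
      using Max_attained[OF x, of y] Max_attained[OF y(1), of y] unfolding M_def by blast
    then show ?thesis
      using Max_F[OF that, of i] Max_F[OF y, of j] F(2)[OF that(1)] F(2)[OF y(1)]
      unfolding M_def by force
  qed
  have M_gt: "\<epsilon> x < M y" if "x \<in> topspace X" "y \<in> V x" for x y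
    using Max_F[OF that k[OF that(1)]] k_gt[OF that] M_local[OF that] by simp
  have M_pos: "0 < M x" if "x \<in> topspace X" for x
    using M_gt[OF that] V[OF that] \<epsilon>[OF that] by force
  have M_cont: "continuous_map X euclideanreal M"
  proof (rule pasting_lemma[where I = "topspace X" and T = V and f = "\<lambda>x y. Max ((\<lambda>i. \<rho> i y) ` F x)"])
    show "continuous_map (subtopology X (V x)) euclideanreal (\<lambda>y. Max ((\<lambda>i. \<rho> i y) ` F x))"
      if "x \<in> topspace X" for x
      using F[OF that] cont by (intro continuous_map_from_subtopology continuous_map_real_Max) auto
  qed (use V in \<open>auto simp flip: M_local\<close>)
  define q where "q i y = max 0 (\<rho> i y - M y / 2)" for i y
  have q_cont: "continuous_map X euclideanreal (q i)" if "i \<in> I" for i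
    unfolding q_def using cont[OF that] M_cont
    by (intro continuous_map_real_max continuous_map_diff continuous_map_real_divide) auto
  \<comment> \<open>A nonzero \<open>q i y\<close> means that \<open>\<rho> i y\<close> exceeds
    \<open>M y / 2\<close>, and \<open>M y\<close> exceeds \<open>\<epsilon> x\<close>. This is why
    finiteness was asked at the bound \<open>\<epsilon> / 2\<close>.\<close>
  have q_F: "i \<in> F x" if "x \<in> topspace X" "y \<in> V x" "i \<in> I" "q i y \<noteq> 0" for x y i
  proof -
    have "M y / 2 < \<rho> i y" using that by (auto simp: q_def max_def split: if_splits)
    with M_gt[OF that(1,2)] have "\<epsilon> x / 2 < \<rho> i y" by simp
    with that show ?thesis by (auto simp: F_def)
  qed
  define N where "N y = (\<Sum>i\<in>F y. q i y)" for y
  have N_local: "N y = (\<Sum>i\<in>F x. q i y)" if "x \<in> topspace X" "y \<in> V x" for x y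
  proof -
    have y: "y \<in> topspace X" "y \<in> V y" using that Vsub V by blast+
    have "(\<Sum>i\<in>F z. q i y) = (\<Sum>i | i \<in> I \<and> q i y \<noteq> 0. q i y)" if "z \<in> topspace X" "y \<in> V z" for z
      using F[OF that(1)] q_F[OF that] by (intro sum.mono_neutral_right) auto
    then show ?thesis unfolding N_def using that y by simp
  qed
  have N_sum: "N y = (\<Sum>i | i \<in> I \<and> q i y \<noteq> 0. q i y)" if "y \<in> topspace X" for y
    unfolding N_def using F[OF that] q_F[OF that] V[OF that] by (intro sum.mono_neutral_right) auto
  have N_cont: "continuous_map X euclideanreal N"
  proof (rule pasting_lemma[where I = "topspace X" and T = V and f = "\<lambda>x y. \<Sum>i\<in>F x. q i y"])
    show "continuous_map (subtopology X (V x)) euclideanreal (\<lambda>y. \<Sum>i\<in>F x. q i y)"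
      if "x \<in> topspace X" for x
      using F[OF that] q_cont by (intro continuous_map_from_subtopology continuous_map_sum) auto
  qed (use V in \<open>auto simp flip: N_local\<close>)
  have q_ge0: "0 \<le> q i x" for i x by (simp add: q_def)
  have N_pos: "0 < N x" if x: "x \<in> topspace X" for x
  proof -
    obtain i where i: "i \<in> F x" "\<rho> i x = M x" using Max_attained[OF x] by (auto simp: M_def)
    have "0 < q i x" using i M_pos[OF x] by (simp add: q_def)
    also have "\<dots> \<le> N x" unfolding N_def using F[OF x] i q_ge0 by (intro member_le_sum) auto
    finally show ?thesis .
  qed
  define p where "p i x = q i x / N x" for i x
  have p_cont: "continuous_map X euclideanreal (p i)" if "i \<in> I" for i
    unfolding p_def using q_cont[OF that] N_cont N_pos
    by (intro continuous_map_real_divide) (auto simp: less_le)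
  have p_ge0: "0 \<le> p i x" if "x \<in> topspace X" for i x
    using q_ge0 N_pos[OF that] by (simp add: p_def less_imp_le)
  have p_le1: "p i x \<le> 1" if "x \<in> topspace X" "i \<in> I" for i x
  proof -
    have "q i x \<le> N x"
    proof (cases "q i x = 0")
      case False
      then have "i \<in> F x" using q_F that V by blast
      then show ?thesis unfolding N_def using F[OF that(1)] q_ge0 by (intro member_le_sum) auto
    qed (use N_pos[OF that(1)] in auto)
    then show ?thesis using N_pos[OF that(1)] by (simp add: p_def)
  qed
  have p_nz: "p i x \<noteq> 0 \<longleftrightarrow> q i x \<noteq> 0" if "x \<in> topspace X" for i x
    using N_pos[OF that] by (auto simp: p_def)
  show ?thesis
  proof
    show "partition_of_unity_on X I p"
      unfolding partition_of_unity_on_def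
    proof (intro conjI ballI)
      show "continuous_map X (top_of_set {0..1}) (p i)" if "i \<in> I" for i
        using p_cont[OF that] p_ge0 p_le1[OF _ that] by (auto simp: continuous_map_in_subtopology)
    next
      fix x assume x: "x \<in> topspace X"
      have "{i \<in> I. V x \<inter> closed_support X (p i) \<noteq> {}} \<subseteq> F x"
      proof
        fix i assume i: "i \<in> {i \<in> I. V x \<inter> closed_support X (p i) \<noteq> {}}"
        then obtain y where "y \<in> V x" "p i y \<noteq> 0"
          using V[OF x] openin_Int_closure_of_eq_empty unfolding closed_support_def by blast
        with i show "i \<in> F x" using q_F[OF x] p_nz Vsub[OF x] by blast
      qed
      then show "\<exists>V. openin X V \<and> x \<in> V \<and> finite {i \<in> I. V \<inter> closed_support X (p i) \<noteq> {}}"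
        using V[OF x] F(1)[OF x] finite_subset by blast
      have "(\<Sum>i | i \<in> I \<and> p i x \<noteq> 0. p i x) = (\<Sum>i | i \<in> I \<and> q i x \<noteq> 0. q i x) / N x"
        using p_nz[OF x] by (simp add: p_def sum_divide_distrib)
      then show "(\<Sum>i | i \<in> I \<and> p i x \<noteq> 0. p i x) = 1"
        using N_sum[OF x] N_pos[OF x] by simp
    qed
    show "closed_support X (p i) \<subseteq> {x \<in> topspace X. 0 < \<rho> i x}" if i: "i \<in> I" for i
    proof -
      \<comment> \<open>The condition \<open>\<rho> i x \<ge> M x / 2\<close> is closed and holds
        wherever \<open>p i\<close> is nonzero, so it passes to the closed support. Positivity of
        \<open>M\<close> then gives positivity of \<open>\<rho> i\<close>.\<close>
      have "continuous_map X euclideanreal (\<lambda>x. \<rho> i x - M x / 2)"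
        using cont[OF i] M_cont by (intro continuous_map_diff continuous_map_real_divide) auto
      then have "closedin X {x \<in> topspace X. \<rho> i x - M x / 2 \<in> {0..}}"
        by (rule closedin_continuous_map_preimage) simp
      moreover have "{x \<in> topspace X. p i x \<noteq> 0} \<subseteq> {x \<in> topspace X. \<rho> i x - M x / 2 \<in> {0..}}"
        using p_nz by (auto simp: q_def max_def split: if_splits)
      ultimately have "closed_support X (p i) \<subseteq> {x \<in> topspace X. \<rho> i x - M x / 2 \<in> {0..}}"
        unfolding closed_support_def by (rule closure_of_minimal[rotated])
      then show ?thesis using M_pos by force
    qed
  qed
qed

text \<open>Cover and partition are pulled back along \<open>s\<close>. The inclusion of the
  preimage of \<open>W\<close> is homotopic to \<open>r \<circ> s\<close>, which passes through the
  inclusion of \<open>W\<close> into \<open>Z\<close> and so contracts to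
  \<open>r c\<close>.\<close>

lemma dold_space_homotopy_dominated:
  assumes Z: "dold_space Z" and s: "continuous_map X Z s" and r: "continuous_map Z X r"
    and rs: "homotopic_with (\<lambda>_. True) X X (r \<circ> s) id"
  shows "dold_space X"
proof -
  obtain \<U> p where U: "\<Union>\<U> = topspace Z" and p: "partition_of_unity_on Z \<U> p"
    and supp: "\<And>W. W \<in> \<U> \<Longrightarrow> closed_support Z (p W) \<subseteq> W"
    and amb: "\<And>W. W \<in> \<U> \<Longrightarrow> ambiently_contractible Z W"
    using Z unfolding dold_space_def numerable_cover_def by auto
  have s_in: "s x \<in> topspace Z" if "x \<in> topspace X" for x
    using s that by (auto simp: continuous_map_def)
  \<comment> \<open>The preimage of a closed support is closed and hence contains the closed support
    of the pullback. Both local finiteness and the containment in the cover are transported by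
    this.\<close>
  have supp': "closed_support X (p W \<circ> s) \<subseteq> {x \<in> topspace X. s x \<in> closed_support Z (p W)}" for W
  proof -
    have "closedin X {x \<in> topspace X. s x \<in> closed_support Z (p W)}"
      using s by (rule closedin_continuous_map_preimage) (simp add: closed_support_def)
    moreover have "{x \<in> topspace X. (p W \<circ> s) x \<noteq> 0} \<subseteq> {x \<in> topspace X. s x \<in> closed_support Z (p W)}"
      using s_in closure_of_subset[of "{z \<in> topspace Z. p W z \<noteq> 0}" Z]
      unfolding closed_support_def by auto
    ultimately show ?thesis
      unfolding closed_support_def by (rule closure_of_minimal[rotated])
  qed
  show ?thesis
  proof (rule dold_spaceI[where I = \<U> and U = "\<lambda>W. {x \<in> topspace X. s x \<in> W}"])
    show "numerable_cover X \<U> (\<lambda>W. {x \<in> topspace X. s x \<in> W})"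
      unfolding numerable_cover_def partition_of_unity_on_def
    proof (intro conjI exI[of _ "\<lambda>W. p W \<circ> s"] ballI)
      show "(\<Union>W\<in>\<U>. {x \<in> topspace X. s x \<in> W}) = topspace X"
        using s_in unfolding U[symmetric] by auto
      show "continuous_map X (top_of_set {0..1}) (p W \<circ> s)" if "W \<in> \<U>" for W
        using continuous_map_compose[OF s] p that unfolding partition_of_unity_on_def by blast
      show "closed_support X (p W \<circ> s) \<subseteq> {x \<in> topspace X. s x \<in> W}" if "W \<in> \<U>" for W
        using supp'[of W] supp[OF that] by blast
    next
      fix x assume x: "x \<in> topspace X"
      obtain V where V: "openin Z V" "s x \<in> V" "finite {W \<in> \<U>. V \<inter> closed_support Z (p W) \<noteq> {}}"
        using p s_in[OF x] unfolding partition_of_unity_on_def by blast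
      let ?V = "{y \<in> topspace X. s y \<in> V}"
      have "{W \<in> \<U>. ?V \<inter> closed_support X (p W \<circ> s) \<noteq> {}} \<subseteq> {W \<in> \<U>. V \<inter> closed_support Z (p W) \<noteq> {}}"
        using supp' by blast
      moreover have "openin X ?V"
        using s V(1) by (rule openin_continuous_map_preimage)
      ultimately show "\<exists>V. openin X V \<and> x \<in> V \<and> finite {W \<in> \<U>. V \<inter> closed_support X (p W \<circ> s) \<noteq> {}}"
        using x V finite_subset by (intro exI[of _ ?V]) blast
      show "(\<Sum>W | W \<in> \<U> \<and> (p W \<circ> s) x \<noteq> 0. (p W \<circ> s) x) = 1"
        using p s_in[OF x] unfolding partition_of_unity_on_def by simp
    qed
  next
    fix W assume "W \<in> \<U>"
    then obtain c where c: "c \<in> topspace Z"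
      "homotopic_with (\<lambda>_. True) (subtopology Z W) Z id (\<lambda>_. c)"
      using amb unfolding ambiently_contractible_def by blast
    let ?W = "{x \<in> topspace X. s x \<in> W}"
    have "continuous_map (subtopology X ?W) (subtopology Z W) s"
      using s by (auto simp: continuous_map_in_subtopology continuous_map_from_subtopology)
    from homotopic_with_compose_continuous_map_right[OF c(2) this]
    have "homotopic_with (\<lambda>_. True) (subtopology X ?W) Z (id \<circ> s) ((\<lambda>_. c) \<circ> s)" by simp
    from homotopic_with_compose_continuous_map_left[OF this r]
    have "homotopic_with (\<lambda>_. True) (subtopology X ?W) X (r \<circ> s) (\<lambda>_. r c)" by (simp add: o_def)
    moreover have "homotopic_with (\<lambda>_. True) (subtopology X ?W) X (r \<circ> s \<circ> id) (id \<circ> id)"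
      by (rule homotopic_with_compose_continuous_map_right[OF rs])
        (auto simp: continuous_map_from_subtopology)
    ultimately have "homotopic_with (\<lambda>_. True) (subtopology X ?W) X id (\<lambda>_. r c)"
      using homotopic_with_trans[OF homotopic_with_symD] by fastforce
    moreover have "r c \<in> topspace X" using r c by (auto simp: continuous_map_def)
    ultimately show "ambiently_contractible X ?W"
      unfolding ambiently_contractible_def by auto
  qed
qed

section \<open>Maps out of fat realizations\<close>

abbreviation simplex_class where
  "simplex_class Y act n y t \<equiv> face_equivalence Y act `` {(n, y, t)}"

lemma topspace_fat_realization:
  "z \<in> topspace (fat_realization Y act) \<longleftrightarrow>
     (\<exists>n y t. y \<in> topspace (Y n) \<and> t \<in> standard_simplex n \<and> z = simplex_class Y act n y t)"
  unfolding fat_realization_def topspace_quotient_topology quotient_def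
  by (fastforce simp: topspace_fat_coproduct)

lemma simplex_class_in:
  assumes "y \<in> topspace (Y n)" "t \<in> standard_simplex n"
  shows "simplex_class Y act n y t \<in> topspace (fat_realization Y act)"
  using assms topspace_fat_realization by blast

lemma continuous_map_simplex_class:
  "continuous_map (prod_topology (Y n) (simplex_space n)) (fat_realization Y act)
     (\<lambda>(y, t). simplex_class Y act n y t)"
  using continuous_map_from_fat_realization[of Y act "fat_realization Y act" "\<lambda>z. z"] by simp

lemma (in semisimplicial_space) simplex_class_face:
  assumes \<theta>: "\<theta> \<in> mon_delta m n" and y: "y \<in> topspace (Y n)" and t: "t \<in> standard_simplex m"
  shows "simplex_class Y act m (act m n \<theta> y) t = simplex_class Y act n y (simplex_push m \<theta> t)"
proof -
  have "((m, act m n \<theta> y, t), (n, y, simplex_push m \<theta> t)) \<in> face_identifications Y act"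
    using assms unfolding face_identifications_def by blast
  moreover have "act m n \<theta> y \<in> topspace (Y m)"
    using act_continuous[OF \<theta>] y by (auto simp: continuous_map_def)
  ultimately have "((m, act m n \<theta> y, t), (n, y, simplex_push m \<theta> t)) \<in> face_equivalence Y act"
    using y t simplex_push_in[OF \<theta> t]
    by (auto simp: face_equivalence_def topspace_fat_coproduct)
  then show ?thesis
    using equiv_class_eq[OF equiv_face_equivalence] by metis
qed

text \<open>\<open>the_elem\<close> extracts the common value of \<open>h\<close> on a class.
  Compatibility with faces is asked on all triples, so a construction that makes sense only on part
  of the realization has to be given some value elsewhere.\<close>

definition realization_lift :: "(nat \<times> 'a \<times> (nat \<Rightarrow> real) \<Rightarrow> 'b) \<Rightarrow> (nat \<times> 'a \<times> (nat \<Rightarrow> real)) set \<Rightarrow> 'b" where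
  "realization_lift h c = the_elem (h ` c)"

lemma realization_lift_class:
  assumes "\<And>m n \<theta> y t. \<theta> \<in> mon_delta m n \<Longrightarrow> y \<in> topspace (Y n) \<Longrightarrow> t \<in> standard_simplex m \<Longrightarrow>
             h (m, act m n \<theta> y, t) = h (n, y, simplex_push m \<theta> t)"
    and y: "y \<in> topspace (Y n)" and t: "t \<in> standard_simplex n"
  shows "realization_lift h (simplex_class Y act n y t) = h (n, y, t)"
proof -
  have "((n, y, t), (n, y, t)) \<in> face_equivalence Y act"
    using equiv_class_self[OF equiv_face_equivalence] y t topspace_fat_coproduct by fastforce
  then have "(n, y, t) \<in> simplex_class Y act n y t" by simp
  moreover have "h q = h (n, y, t)" if "((n, y, t), q) \<in> face_equivalence Y act" for q
    by (rule face_equivalence_respects[where h = h, OF _ that, symmetric]) (rule assms(1))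
  ultimately have "h ` simplex_class Y act n y t = {h (n, y, t)}"
    by fast
  then show ?thesis by (simp add: realization_lift_def)
qed

lemma openin_fat_realization:
  "openin (fat_realization Y act) S \<longleftrightarrow>
     S \<subseteq> topspace (fat_realization Y act) \<and>
     (\<forall>n. openin (prod_topology (Y n) (simplex_space n))
        {p \<in> topspace (prod_topology (Y n) (simplex_space n)). face_equivalence Y act `` {(n, p)} \<in> S})"
proof -
  let ?P = "\<lambda>n. prod_topology (Y n) (simplex_space n)"
  have "{p. (n, p) \<in> {x \<in> topspace (fat_coproduct Y). face_equivalence Y act `` {x} \<in> S}} =
        {p \<in> topspace (?P n). face_equivalence Y act `` {(n, p)} \<in> S}" for n
    by (auto simp: fat_coproduct_def)
  then have "openin (fat_coproduct Y) {x \<in> topspace (fat_coproduct Y). face_equivalence Y act `` {x} \<in> S}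
      \<longleftrightarrow> (\<forall>n. openin (?P n) {p \<in> topspace (?P n). face_equivalence Y act `` {(n, p)} \<in> S})"
    by (subst fat_coproduct_def, subst openin_sum_topology) (auto simp: fat_coproduct_def)
  then show ?thesis
    by (simp add: fat_realization_def openin_quotient_topology)
qed

text \<open>A quotient map restricted to the preimage of an open set is again a quotient map:
  openness of \<open>W\<close> turns relatively open preimages into open ones.\<close>

lemma continuous_map_from_open_fat_realization:
  assumes W: "openin (fat_realization Y act) W"
    and g: "\<And>n. continuous_map
        (subtopology (prod_topology (Y n) (simplex_space n)) {p. face_equivalence Y act `` {(n, p)} \<in> W}) Z
        (\<lambda>p. g (face_equivalence Y act `` {(n, p)}))"
  shows "continuous_map (subtopology (fat_realization Y act) W) Z g"
  unfolding continuous_map_def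
proof (intro conjI allI impI)
  let ?P = "\<lambda>n. prod_topology (Y n) (simplex_space n)"
  let ?q = "\<lambda>n p. face_equivalence Y act `` {(n, p)}"
  show "g \<in> topspace (subtopology (fat_realization Y act) W) \<rightarrow> topspace Z"
  proof
    fix z assume z: "z \<in> topspace (subtopology (fat_realization Y act) W)"
    then obtain n y t where "y \<in> topspace (Y n)" "t \<in> standard_simplex n" "z = ?q n (y, t)" "z \<in> W"
      using topspace_fat_realization[of z Y act] by auto
    then show "g z \<in> topspace Z"
      using g[of n] by (auto simp: continuous_map_def)
  qed
  fix O' assume O': "openin Z O'"
  let ?S = "{z \<in> topspace (subtopology (fat_realization Y act) W). g z \<in> O'}"
  have "openin (fat_realization Y act) ?S"
    unfolding openin_fat_realization
  proof (intro conjI allI)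
    show "?S \<subseteq> topspace (fat_realization Y act)" by auto
    fix n
    let ?W = "{p \<in> topspace (?P n). ?q n p \<in> W}"
    have "openin (?P n) ?W"
      using W openin_fat_realization by blast
    moreover have "openin (subtopology (?P n) ?W) {p \<in> topspace (?P n). ?q n p \<in> ?S}"
    proof -
      have "subtopology (?P n) ?W = subtopology (?P n) {p. ?q n p \<in> W}"
        using subtopology_restrict[of "?P n" "{p. ?q n p \<in> W}"] by (simp only: Int_def mem_Collect_eq)
      moreover have "{p \<in> topspace (?P n). ?q n p \<in> ?S} =
          {p \<in> topspace (subtopology (?P n) {p. ?q n p \<in> W}). g (?q n p) \<in> O'}"
        by (auto simp: simplex_class_in)
      ultimately show ?thesis
        using openin_continuous_map_preimage[OF g[of n] O'] by simp
    qed
    ultimately show "openin (?P n) {p \<in> topspace (?P n). ?q n p \<in> ?S}"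
      using openin_trans_full by blast
  qed
  then show "openin (subtopology (fat_realization Y act) W) ?S"
    using W by (auto simp: openin_open_subtopology)
qed

lemma continuous_map_into_simplex_space:
  assumes "\<And>j. continuous_map T euclideanreal (\<lambda>x. f x j)"
    and "\<And>x. x \<in> topspace T \<Longrightarrow> f x \<in> standard_simplex n"
  shows "continuous_map T (simplex_space n) f"
  using assms by (auto simp: continuous_map_in_subtopology continuous_map_componentwise_UNIV)

lemma continuous_map_simplex_coordinate:
  "continuous_map (simplex_space n) euclideanreal (\<lambda>t. t j)"
  by (intro continuous_map_from_subtopology continuous_map_product_projection) auto

text \<open>Uncurrying by evaluation, which is continuous because [0,1] is compact and Hausdorff.
  Path-valued maps on a realization become homotopies in this way.\<close>

lemma homotopic_with_path_map:
  assumes K: "continuous_map Z (compact_open_topology (top_of_set {0..1}) X) K"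
  shows "homotopic_with (\<lambda>_. True) Z X (\<lambda>z. K z 0) (\<lambda>z. K z (1::real))"
proof -
  let ?I = "top_of_set {0..1::real}"
  have "continuous_map (prod_topology ?I Z) (prod_topology (compact_open_topology ?I X) ?I) (\<lambda>p. (K (snd p), fst p))"
    by (intro continuous_map_paired[THEN iffD2] conjI continuous_map_fst
      continuous_map_compose[OF continuous_map_snd K, unfolded o_def])
  moreover have "continuous_map (prod_topology (compact_open_topology ?I X) ?I) X (\<lambda>(f, t). f t)"
    by (intro continuous_map_evaluation Hausdorff_space_subtopology)
      (auto simp: compact_space_subtopology)
  ultimately have "continuous_map (prod_topology ?I Z) X (\<lambda>p. K (snd p) (fst p))"
    by (auto dest: continuous_map_compose simp: o_def)
  then show ?thesis
    unfolding homotopic_with_def by (intro exI[of _ "\<lambda>p. K (snd p) (fst p)"]) auto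
qed

section \<open>Realizations of reduced semisimplicial spaces are Dold spaces\<close>

text \<open>Positive exactly where \<open>r\<close> lies strictly between two consecutive partial sums; a vanishing
  coordinate contributes nothing, whence the compatibility with faces.\<close>

definition level_weight :: "real \<Rightarrow> nat \<Rightarrow> (nat \<Rightarrow> real) \<Rightarrow> real" where
  "level_weight r n t = (\<Sum>i\<le>n. max 0 (min (r - (\<Sum>j<i. t j)) ((\<Sum>j<Suc i. t j) - r)))"

definition crosses_level :: "real \<Rightarrow> nat \<Rightarrow> (nat \<Rightarrow> real) \<Rightarrow> nat \<Rightarrow> bool" where
  "crosses_level r n t i \<longleftrightarrow> i \<le> n \<and> (\<Sum>j<i. t j) < r \<and> r < (\<Sum>j<Suc i. t j)"

lemma standard_simplexD:
  assumes "t \<in> standard_simplex n"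
  shows "0 \<le> t i" "t i \<le> 1" "n < i \<Longrightarrow> t i = 0" "(\<Sum>i\<le>n. t i) = 1"
  using assms by (auto simp: standard_simplex_def)

text \<open>Partial sums are nondecreasing, so the open intervals between consecutive ones are
  disjoint.\<close>

lemma crosses_level_unique:
  assumes t: "t \<in> standard_simplex n" and "crosses_level r n t i" "crosses_level r n t i'"
  shows "i = i'"
proof -
  have mono: "(\<Sum>j<Suc i. t j) \<le> (\<Sum>j<i'. t j)" if "i < i'" for i i'
    using that standard_simplexD(1)[OF t] by (intro sum_mono2) auto
  show ?thesis
    using mono[of i i'] mono[of i' i] assms(2,3) unfolding crosses_level_def
    by (cases i i' rule: linorder_cases) auto
qed

lemma crosses_levelE:
  assumes t: "t \<in> standard_simplex n" and r: "0 < r" "r < 1" and "r \<notin> (\<lambda>i. \<Sum>j<i. t j) ` {..n}"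
  obtains i where "crosses_level r n t i"
proof -
  have "(\<Sum>j<Suc n. t j) = 1" using standard_simplexD(4)[OF t] by (simp add: lessThan_Suc_atMost)
  then have ex: "\<exists>i. r < (\<Sum>j<Suc i. t j)" using r by metis
  \<comment> \<open>The interval sought ends at the first partial sum beyond \<open>r\<close>. The
    preceding sum is at most \<open>r\<close>, and strictly less because \<open>r\<close> is not
    itself a partial sum.\<close>
  define i where "i = (LEAST i. r < (\<Sum>j<Suc i. t j))"
  have i: "r < (\<Sum>j<Suc i. t j)" unfolding i_def using ex by (rule LeastI_ex)
  have "i \<le> n" unfolding i_def using \<open>(\<Sum>j<Suc n. t j) = 1\<close> r by (intro Least_le) simp
  moreover have "(\<Sum>j<i. t j) \<le> r"
  proof (cases i)
    case (Suc k)
    then show ?thesis using not_less_Least[of k "\<lambda>i. r < (\<Sum>j<Suc i. t j)"] by (simp add: i_def)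
  qed (use r in simp)
  ultimately have "crosses_level r n t i"
    using i assms(4) by (force simp: crosses_level_def)
  then show ?thesis by (rule that)
qed

lemma level_weight_pos_iff: "0 < level_weight r n t \<longleftrightarrow> (\<exists>i. crosses_level r n t i)"
proof -
  have "0 < level_weight r n t \<longleftrightarrow> level_weight r n t \<noteq> 0"
    unfolding level_weight_def by (subst less_le) (auto intro: sum_nonneg)
  also have "\<dots> \<longleftrightarrow> (\<exists>i\<le>n. max 0 (min (r - (\<Sum>j<i. t j)) ((\<Sum>j<Suc i. t j) - r)) \<noteq> 0)"
    unfolding level_weight_def by (subst sum_nonneg_eq_0_iff) auto
  also have "\<dots> \<longleftrightarrow> (\<exists>i. crosses_level r n t i)"
    unfolding crosses_level_def by (intro ex_cong1) (auto simp: max_def min_def)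
  finally show ?thesis .
qed

lemma level_weight_le_1:
  assumes t: "t \<in> standard_simplex n"
  shows "level_weight r n t \<le> 1"
proof -
  have "level_weight r n t \<le> (\<Sum>i\<le>n. t i)"
    unfolding level_weight_def using standard_simplexD(1)[OF t] by (intro sum_mono) (auto simp: max_def min_def)
  then show ?thesis using standard_simplexD(4)[OF t] by simp
qed

lemma simplex_push_image:
  assumes "\<theta> \<in> mon_delta m n" "i \<le> m"
  shows "simplex_push m \<theta> t (\<theta> i) = t i"
proof -
  have "{k. k \<le> m \<and> \<theta> k = \<theta> i} = {i}"
    using mon_deltaD(2)[OF assms(1)] assms(2) by (auto simp: inj_on_def)
  then show ?thesis by (simp add: simplex_push_def)
qed

lemma simplex_push_outside:
  assumes "j \<notin> \<theta> ` {..m}"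
  shows "simplex_push m \<theta> t j = 0"
proof -
  have "{k. k \<le> m \<and> \<theta> k = j} = {}" using assms by auto
  then show ?thesis unfolding simplex_push_def by (simp only: sum.empty)
qed

text \<open>Since \<open>\<theta>\<close> is strictly increasing, the coordinates below
  \<open>\<theta> i\<close> collect their mass exactly from the indices below
  \<open>i\<close>.\<close>

lemma sum_simplex_push_lessThan:
  assumes \<theta>: "\<theta> \<in> mon_delta m n" and i: "i \<le> m"
  shows "(\<Sum>j<\<theta> i. simplex_push m \<theta> t j) = (\<Sum>j<i. t j)"
proof -
  have less: "\<theta> k < \<theta> i \<longleftrightarrow> k < i" if "k \<le> m" for k
    using \<theta> i that unfolding mon_delta_def strict_mono_on_def
    by (metis (mono_tags, lifting) atMost_iff linorder_neqE_nat mem_Collect_eq order_less_asym)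
  have "(\<Sum>j<i. t j) = (\<Sum>j<\<theta> i. \<Sum>k | k \<in> {..<i} \<and> \<theta> k = j. t k)"
    by (rule sum.group[symmetric]) (use less i in auto)
  also have "\<dots> = (\<Sum>j<\<theta> i. simplex_push m \<theta> t j)"
    unfolding simplex_push_def using less i by (intro sum.cong refl) force
  finally show ?thesis by simp
qed

lemma sum_simplex_push_lessThan_Suc:
  assumes \<theta>: "\<theta> \<in> mon_delta m n" and i: "i \<le> m"
  shows "(\<Sum>j<Suc (\<theta> i). simplex_push m \<theta> t j) = (\<Sum>j<Suc i. t j)"
  using sum_simplex_push_lessThan[OF assms] simplex_push_image[OF assms] by simp

lemma level_weight_push:
  assumes \<theta>: "\<theta> \<in> mon_delta m n"
  shows "level_weight r n (simplex_push m \<theta> t) = level_weight r m t"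
proof -
  let ?f = "\<lambda>t i. max 0 (min (r - (\<Sum>j<i. t j)) ((\<Sum>j<Suc i. t j) - r))"
  have "level_weight r n (simplex_push m \<theta> t) = (\<Sum>i\<in>\<theta> ` {..m}. ?f (simplex_push m \<theta> t) i)"
    unfolding level_weight_def
  proof (rule sum.mono_neutral_right)
    show "\<forall>i\<in>{..n} - \<theta> ` {..m}. ?f (simplex_push m \<theta> t) i = 0"
      by (auto simp: simplex_push_outside max_def min_def)
  qed (use mon_deltaD[OF \<theta>] in auto)
  also have "\<dots> = (\<Sum>i\<le>m. ?f (simplex_push m \<theta> t) (\<theta> i))"
    using mon_deltaD(2)[OF \<theta>] by (simp add: sum.reindex)
  also have "\<dots> = level_weight r m t"
    unfolding level_weight_def
    by (intro sum.cong refl) (simp only: sum_simplex_push_lessThan[OF \<theta>] sum_simplex_push_lessThan_Suc[OF \<theta>] atMost_iff)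
  finally show ?thesis .
qed

lemma crosses_level_push:
  assumes "\<theta> \<in> mon_delta m n" "crosses_level r m t i"
  shows "crosses_level r n (simplex_push m \<theta> t) (\<theta> i)"
  using assms mon_deltaD(1)[OF assms(1), of i] unfolding crosses_level_def
  by (simp only: sum_simplex_push_lessThan sum_simplex_push_lessThan_Suc)

lemma continuous_map_level_weight:
  "continuous_map (simplex_space n) euclideanreal (level_weight r n)"
  unfolding level_weight_def
  by (intro continuous_map_sum continuous_map_real_max continuous_map_real_min continuous_map_diff
      continuous_map_simplex_coordinate) auto

lemma openin_crosses_level:
  "openin (simplex_space n) {t \<in> standard_simplex n. crosses_level r n t i}"
proof (cases "i \<le> n")
  case True
  have "continuous_map (simplex_space n) euclideanreal (\<lambda>t. min (r - (\<Sum>j<i. t j)) ((\<Sum>j<Suc i. t j) - r))"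
    by (intro continuous_map_sum continuous_map_real_min continuous_map_diff
      continuous_map_simplex_coordinate) auto
  then have "openin (simplex_space n) {t \<in> topspace (simplex_space n). min (r - (\<Sum>j<i. t j)) ((\<Sum>j<Suc i. t j) - r) \<in> {0<..}}"
    by (rule openin_continuous_map_preimage) simp
  moreover have "{t \<in> standard_simplex n. crosses_level r n t i} =
      {t \<in> topspace (simplex_space n). min (r - (\<Sum>j<i. t j)) ((\<Sum>j<Suc i. t j) - r) \<in> {0<..}}"
    using True by (auto simp: crosses_level_def)
  ultimately show ?thesis by simp
qed (simp add: crosses_level_def)

section \<open>Straight segments to the crossed vertex\<close>

lemma standard_simplex_convex:
  assumes a: "a \<in> standard_simplex n" and b: "b \<in> standard_simplex n" and s: "0 \<le> s" "s \<le> 1"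
  shows "(\<lambda>j. (1 - s) * a j + s * b j) \<in> standard_simplex n"
proof -
  have "(1 - s) * a j + s * b j \<le> (1 - s) * 1 + s * 1" for j
    using standard_simplexD(2)[OF a] standard_simplexD(2)[OF b] s by (intro add_mono mult_left_mono) auto
  then have "(1 - s) * a j + s * b j \<le> 1" for j by simp
  moreover have "(\<Sum>j\<le>n. (1 - s) * a j + s * b j) = 1"
    using standard_simplexD(4)[OF a] standard_simplexD(4)[OF b]
    by (simp add: sum.distrib flip: sum_distrib_left)
  ultimately show ?thesis
    using standard_simplexD(1,3)[OF a] standard_simplexD(1,3)[OF b] s
    by (simp add: standard_simplex_def)
qed

lemma simplex_push_convex:
  "simplex_push m \<theta> (\<lambda>j. a * t j + b * u j) = (\<lambda>j. a * simplex_push m \<theta> t j + b * simplex_push m \<theta> u j)"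
  by (simp add: simplex_push_def sum.distrib sum_distrib_left)

text \<open>Paths are restricted to [0,1] so as to be elements of the path space. Where no vertex
  crosses the level the value is \<open>undefined\<close>, one fixed value that keeps compatibility
  with faces valid on the whole coproduct.\<close>

definition level_path ::
  "(nat \<Rightarrow> 'a topology) \<Rightarrow> (nat \<Rightarrow> nat \<Rightarrow> (nat \<Rightarrow> nat) \<Rightarrow> 'a \<Rightarrow> 'a) \<Rightarrow> real \<Rightarrow>
    nat \<times> 'a \<times> (nat \<Rightarrow> real) \<Rightarrow> real \<Rightarrow> (nat \<times> 'a \<times> (nat \<Rightarrow> real)) set" where
  "level_path Y act r = (\<lambda>(n, y, t).
     if \<exists>i. crosses_level r n t i
     then (\<lambda>s\<in>{0..1}. simplex_class Y act n y
             (\<lambda>j. (1 - s) * t j + s * simplex_vertex (THE i. crosses_level r n t i) j))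
     else undefined)"

lemma level_path_eq:
  assumes t: "t \<in> standard_simplex n" and i: "crosses_level r n t i"
  shows "level_path Y act r (n, y, t) =
    (\<lambda>s\<in>{0..1}. simplex_class Y act n y (\<lambda>j. (1 - s) * t j + s * simplex_vertex i j))"
proof -
  have "(THE i. crosses_level r n t i) = i"
    using crosses_level_unique[OF t] i by (intro the_equality) auto
  then show ?thesis using i by (auto simp: level_path_def)
qed

context semisimplicial_space
begin

text \<open>\<open>simplex_push\<close> is affine and takes vertex \<open>i\<close> to vertex
  \<open>\<theta> i\<close>, and the crossed indices correspond under \<open>\<theta>\<close>; hence
  it carries one segment onto the other.\<close>

lemma level_path_face:
  assumes \<theta>: "\<theta> \<in> mon_delta m n" and y: "y \<in> topspace (Y n)" and t: "t \<in> standard_simplex m"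
  shows "level_path Y act r (m, act m n \<theta> y, t) = level_path Y act r (n, y, simplex_push m \<theta> t)"
proof (cases "\<exists>i. crosses_level r m t i")
  case True
  then obtain i where i: "crosses_level r m t i" by blast
  then have "i \<le> m" by (simp add: crosses_level_def)
  have "simplex_class Y act m (act m n \<theta> y) (\<lambda>j. (1 - s) * t j + s * simplex_vertex i j) =
        simplex_class Y act n y (\<lambda>j. (1 - s) * simplex_push m \<theta> t j + s * simplex_vertex (\<theta> i) j)"
    if "s \<in> {0..1}" for s
    using that \<open>i \<le> m\<close> simplex_class_face[OF \<theta> y standard_simplex_convex[OF t vertex_in[OF \<open>i \<le> m\<close>], of s]]
    by (simp add: simplex_push_convex simplex_push_vertex)
  then show ?thesis
    unfolding level_path_eq[OF t i] level_path_eq[OF simplex_push_in[OF \<theta> t] crosses_level_push[OF \<theta> i]]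
    by (rule restrict_ext)
next
  case False
  \<comment> \<open>Crossing is detected by positivity of \<open>level_weight\<close>, which is
    invariant under \<open>\<theta>\<close>; so both sides take the default value.\<close>
  then have "\<nexists>i. crosses_level r n (simplex_push m \<theta> t) i"
    using level_weight_pos_iff level_weight_push[OF \<theta>] by metis
  with False show ?thesis by (simp only: level_path_def prod.case if_False)
qed

lemma level_path_class:
  assumes "y \<in> topspace (Y n)" "t \<in> standard_simplex n"
  shows "realization_lift (level_path Y act r) (simplex_class Y act n y t) = level_path Y act r (n, y, t)"
  by (rule realization_lift_class[where h = "level_path Y act r" and Y = Y and act = act, OF _ assms]) (rule level_path_face)

definition level_function :: "real \<Rightarrow> (nat \<times> 'a \<times> (nat \<Rightarrow> real)) set \<Rightarrow> real" where
  "level_function r = realization_lift (\<lambda>(n, y, t). level_weight r n t)"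

lemma level_function_class:
  assumes "y \<in> topspace (Y n)" "t \<in> standard_simplex n"
  shows "level_function r (simplex_class Y act n y t) = level_weight r n t"
  using realization_lift_class[of Y "\<lambda>(n, y, t). level_weight r n t" act, OF _ assms]
  by (simp add: level_function_def level_weight_push)

lemma continuous_map_level_function:
  "continuous_map (fat_realization Y act) euclideanreal (level_function r)"
  unfolding continuous_map_from_fat_realization
proof
  fix n
  have "continuous_map (prod_topology (Y n) (simplex_space n)) euclideanreal (level_weight r n \<circ> snd)"
    using continuous_map_level_weight by (intro continuous_map_compose[OF continuous_map_snd])
  then show "continuous_map (prod_topology (Y n) (simplex_space n)) euclideanreal
      (\<lambda>(y, t). level_function r (simplex_class Y act n y t))"
    by (rule continuous_map_eq) (auto simp: level_function_class)
qed

definition level_set :: "real \<Rightarrow> (nat \<times> 'a \<times> (nat \<Rightarrow> real)) set set" where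
  "level_set r = {z \<in> topspace (fat_realization Y act). 0 < level_function r z}"

lemma simplex_class_in_level_set:
  assumes "y \<in> topspace (Y n)" "t \<in> standard_simplex n"
  shows "simplex_class Y act n y t \<in> level_set r \<longleftrightarrow> (\<exists>i. crosses_level r n t i)"
  using assms simplex_class_in[of y Y n t act]
  by (simp add: level_set_def level_function_class level_weight_pos_iff)

lemma openin_level_set: "openin (fat_realization Y act) (level_set r)"
proof -
  have "openin (fat_realization Y act) {z \<in> topspace (fat_realization Y act). level_function r z \<in> {0<..}}"
    by (rule openin_continuous_map_preimage[OF continuous_map_level_function]) simp
  then show ?thesis by (simp add: level_set_def)
qed

text \<open>On the \<open>n\<close>-simplices the target vertex is constant on each of the disjoint
  open sets given by the crossed index. The curried straight-line homotopies can therefore be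
  pasted.\<close>

lemma continuous_map_level_path:
  "continuous_map (subtopology (fat_realization Y act) (level_set r))
     (compact_open_topology (top_of_set {0..1}) (fat_realization Y act))
     (realization_lift (level_path Y act r))"
proof (rule continuous_map_from_open_fat_realization[OF openin_level_set])
  fix n
  let ?P = "prod_topology (Y n) (simplex_space n)" and ?I = "top_of_set {0..1::real}"
  let ?S = "subtopology ?P {p. face_equivalence Y act `` {(n, p)} \<in> level_set r}"
  let ?T = "\<lambda>i. {p \<in> topspace ?S. crosses_level r n (snd p) i}"
  let ?f = "\<lambda>i (y, t). restrict (\<lambda>s. simplex_class Y act n y (\<lambda>j. (1 - s) * t j + s * simplex_vertex i j)) {0..1}"
  show "continuous_map ?S (compact_open_topology ?I (fat_realization Y act))
          (\<lambda>p. realization_lift (level_path Y act r) (face_equivalence Y act `` {(n, p)}))"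
  proof (rule pasting_lemma[where I = "{..n}" and T = ?T and f = ?f])
    fix i assume i: "i \<in> {..n}"
    have "continuous_map ?S (simplex_space n) snd"
      by (intro continuous_map_from_subtopology continuous_map_snd)
    from openin_continuous_map_preimage[OF this openin_crosses_level]
    have "openin ?S {p \<in> topspace ?S. snd p \<in> {t \<in> standard_simplex n. crosses_level r n t i}}" .
    moreover have "{p \<in> topspace ?S. snd p \<in> {t \<in> standard_simplex n. crosses_level r n t i}} = ?T i"
      by auto
    ultimately show "openin ?S (?T i)" by metis
    let ?Q = "subtopology ?S (?T i)"
    let ?m = "\<lambda>q j. (1 - snd q) * snd (fst q) j + snd q * simplex_vertex i j"
    have fst: "continuous_map (prod_topology ?Q ?I) ?P fst"
      using continuous_map_compose[OF continuous_map_fst continuous_map_from_subtopology[OF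
            continuous_map_from_subtopology[OF continuous_map_id]]] by simp
    have snd: "continuous_map (prod_topology ?Q ?I) euclideanreal snd"
      by (rule continuous_map_into_fulltopology[OF continuous_map_snd])
    have "continuous_map (prod_topology ?Q ?I) (simplex_space n) ?m"
    proof (rule continuous_map_into_simplex_space)
      show "continuous_map (prod_topology ?Q ?I) euclideanreal (\<lambda>q. ?m q j)" for j
        using continuous_map_compose[OF continuous_map_compose[OF fst continuous_map_snd] continuous_map_simplex_coordinate[of n j]] snd
        by (intro continuous_map_add continuous_map_real_mult continuous_map_diff) (auto simp: o_def)
      show "?m q \<in> standard_simplex n" if "q \<in> topspace (prod_topology ?Q ?I)" for q
        using that i by (intro standard_simplex_convex vertex_in) auto
    qed
    then have "continuous_map (prod_topology ?Q ?I) ?P (\<lambda>q. (fst (fst q), ?m q))"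
      using continuous_map_compose[OF fst continuous_map_fst] by (simp add: continuous_map_pairedI o_def)
    from continuous_map_compose[OF this continuous_map_simplex_class[of Y n act]]
    have "continuous_map (prod_topology ?Q ?I) (fat_realization Y act)
        (\<lambda>(p, s). simplex_class Y act n (fst p) (\<lambda>j. (1 - s) * snd p j + s * simplex_vertex i j))"
      by (simp add: o_def case_prod_unfold)
    from continuous_map_curry[OF this]
    show "continuous_map ?Q (compact_open_topology ?I (fat_realization Y act)) (?f i)"
      by (simp add: case_prod_unfold)
  next
    fix i j p assume "p \<in> topspace ?S \<inter> ?T i \<inter> ?T j"
    then have "i = j" by (auto dest: crosses_level_unique)
    then show "?f i p = ?f j p" by simp
  next
    fix p assume p: "p \<in> topspace ?S"
    obtain y t where yt: "p = (y, t)" by fastforce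
    with p have in': "y \<in> topspace (Y n)" "t \<in> standard_simplex n" by auto
    from p yt obtain i where i: "crosses_level r n t i"
      using simplex_class_in_level_set[OF in'] by auto
    then have "i \<le> n" by (simp add: crosses_level_def)
    then show "\<exists>i. i \<in> {..n} \<and> p \<in> ?T i \<and>
        realization_lift (level_path Y act r) (face_equivalence Y act `` {(n, p)}) = ?f i p"
      using p i in' by (intro exI[of _ i]) (simp add: yt level_path_class level_path_eq)
  qed
qed

end

section \<open>Level sets as a numerable cover of the realization\<close>

context reduced_semisimplicial_space
begin

text \<open>Every vertex of a simplex is a face lying in \<open>Y 0\<close>, and \<open>Y 0\<close>
  has a single point.\<close>

lemma simplex_class_vertex:
  assumes "y \<in> topspace (Y n)" "i \<le> n" and p: "p \<in> topspace (Y 0)"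
  shows "simplex_class Y act n y (simplex_vertex i) = simplex_class Y act 0 p (simplex_vertex 0)"
proof -
  let ?\<theta> = "\<lambda>k\<in>{..0::nat}. i"
  have \<theta>: "?\<theta> \<in> mon_delta 0 n" using assms(2) by (auto simp: mon_delta_def strict_mono_on_def)
  have "act 0 n ?\<theta> y \<in> topspace (Y 0)"
    using act_continuous[OF \<theta>] assms(1) by (auto simp: continuous_map_def)
  then have "act 0 n ?\<theta> y = p" using reduced p by auto
  then show ?thesis
    using simplex_class_face[OF \<theta> assms(1), of "simplex_vertex 0"] by (simp add: simplex_push_vertex)
qed

lemma ambiently_contractible_level_set:
  "ambiently_contractible (fat_realization Y act) (level_set r)"
proof -
  let ?E = "fat_realization Y act" and ?K = "realization_lift (level_path Y act r)"
  obtain p where p: "p \<in> topspace (Y 0)" using reduced by auto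
  let ?c = "simplex_class Y act 0 p (simplex_vertex 0)"
  have ends: "?K z 0 = z" "?K z 1 = ?c" if "z \<in> level_set r" for z
  proof -
    obtain n y t where z: "y \<in> topspace (Y n)" "t \<in> standard_simplex n" "z = simplex_class Y act n y t"
      using \<open>z \<in> level_set r\<close> topspace_fat_realization[of z Y act] by (auto simp: level_set_def)
    then obtain i where i: "crosses_level r n t i"
      using \<open>z \<in> level_set r\<close> simplex_class_in_level_set by blast
    then have "i \<le> n" by (simp add: crosses_level_def)
    then show "?K z 0 = z" "?K z 1 = ?c"
      using z i simplex_class_vertex[OF z(1) _ p] by (simp_all add: level_path_class level_path_eq)
  qed
  have "homotopic_with (\<lambda>_. True) (subtopology ?E (level_set r)) ?E id (\<lambda>_. ?c)"
    by (rule homotopic_with_eq[OF homotopic_with_path_map[OF continuous_map_level_path]]) (auto simp: ends)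
  moreover have "?c \<in> topspace ?E" using p by (intro simplex_class_in) auto
  ultimately show ?thesis
    unfolding ambiently_contractible_def by (auto simp: level_set_def)
qed

theorem dold_space_fat_realization: "dold_space (fat_realization Y act)"
proof -
  let ?E = "fat_realization Y act"
  \<comment> \<open>Injectivity and the bounds \<open>0 < r k\<close> and \<open>r k < 1\<close> are
    what matter: an injective sequence cannot stay inside the finite set of partial sums of a
    point.\<close>
  define r :: "nat \<Rightarrow> real" where "r k = 1 / (real k + 2)" for k
  have r: "0 < r k" "r k < 1" for k by (auto simp: r_def)
  have "inj r" by (auto simp: r_def inj_def)
  \<comment> \<open>A point may lie in infinitely many level sets. As level functions are bounded by
    1, the factor \<open>1 / 2 ^ k\<close> lets only finitely many \<open>\<rho> k\<close> exceed a
    given positive bound, uniformly on the realization, as \<open>partition_of_unity_shrink\<close>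
    requires.\<close>
  define \<rho> where "\<rho> k z = level_function (r k) z / 2 ^ k" for k z
  have \<rho>_cont: "continuous_map ?E euclideanreal (\<rho> k)" for k
    unfolding \<rho>_def by (intro continuous_map_real_divide continuous_map_level_function) auto
  have \<rho>_le: "\<rho> k z \<le> (1/2) ^ k" if "z \<in> topspace ?E" for k z
  proof -
    have "level_function (r k) z \<le> 1"
      using that topspace_fat_realization[of z Y act] by (auto simp: level_function_class level_weight_le_1)
    then show ?thesis by (simp add: \<rho>_def power_divide divide_right_mono)
  qed
  have \<rho>_pos: "\<exists>k. 0 < \<rho> k z" if z: "z \<in> topspace ?E" for z
  proof -
    obtain n y t where nyt: "y \<in> topspace (Y n)" "t \<in> standard_simplex n" "z = simplex_class Y act n y t"
      using z topspace_fat_realization[of z Y act] by auto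
    have "\<not> range r \<subseteq> (\<lambda>i. \<Sum>j<i. t j) ` {..n}"
      using finite_subset[of "range r" "(\<lambda>i. \<Sum>j<i. t j) ` {..n}"] finite_imageD[of r UNIV] \<open>inj r\<close>
      by auto
    then obtain k where "r k \<notin> (\<lambda>i. \<Sum>j<i. t j) ` {..n}" by blast
    with crosses_levelE[OF nyt(2) r] obtain i where "crosses_level (r k) n t i" by blast
    then have "0 < level_function (r k) z"
      using level_weight_pos_iff nyt by (auto simp: level_function_class)
    then have "0 < \<rho> k z" by (simp add: \<rho>_def)
    then show ?thesis by blast
  qed
  obtain p where p: "partition_of_unity_on ?E UNIV p"
    and supp: "\<And>k. k \<in> UNIV \<Longrightarrow> closed_support ?E (p k) \<subseteq> {z \<in> topspace ?E. 0 < \<rho> k z}"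
  proof (rule partition_of_unity_shrink[of "UNIV :: nat set" ?E \<rho>])
    fix z assume z: "z \<in> topspace ?E"
    then obtain k where k: "0 < \<rho> k z" using \<rho>_pos by blast
    define \<epsilon> where "\<epsilon> = \<rho> k z / 2"
    have "0 < \<epsilon>" using k by (simp add: \<epsilon>_def)
    let ?V = "{y \<in> topspace ?E. \<rho> k y \<in> {\<epsilon><..}}"
    obtain N where N: "(1/2) ^ N < \<epsilon> / 2"
      using real_arch_pow_inv[of "\<epsilon> / 2" "1/2"] \<open>0 < \<epsilon>\<close> by auto
    have "i \<le> N" if "y \<in> ?V" "\<epsilon> / 2 < \<rho> i y" for i y
    proof (rule ccontr)
      assume "\<not> i \<le> N"
      then have "(1/2 :: real) ^ i \<le> (1/2) ^ N" by (intro power_decreasing) auto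
      moreover have "\<rho> i y \<le> (1/2) ^ i" using that by (intro \<rho>_le) auto
      ultimately show False using that(2) N by linarith
    qed
    then have "{i \<in> UNIV. \<exists>y\<in>?V. \<epsilon> / 2 < \<rho> i y} \<subseteq> {..N}" by blast
    then have "finite {i \<in> UNIV. \<exists>y\<in>?V. \<epsilon> / 2 < \<rho> i y}" using finite_subset by blast
    moreover have "openin ?E ?V"
      by (rule openin_continuous_map_preimage[OF \<rho>_cont]) simp
    ultimately show "\<exists>V \<epsilon> k. openin ?E V \<and> z \<in> V \<and> 0 < \<epsilon> \<and> k \<in> UNIV \<and> (\<forall>y\<in>V. \<epsilon> < \<rho> k y) \<and>
        finite {i \<in> UNIV. \<exists>y\<in>V. \<epsilon> / 2 < \<rho> i y}"
      using z k \<open>0 < \<epsilon>\<close>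
      by (intro exI[of _ ?V] exI[of _ \<epsilon>] exI[of _ k]) (auto simp: \<epsilon>_def)
  qed (use \<rho>_cont in auto)
  have U: "{z \<in> topspace ?E. 0 < \<rho> k z} = level_set (r k)" for k
    by (auto simp: \<rho>_def level_set_def zero_less_divide_iff)
  show ?thesis
  proof (rule dold_spaceI)
    show "numerable_cover ?E UNIV (\<lambda>k. level_set (r k))"
      unfolding numerable_cover_def
    proof (intro conjI exI[of _ p])
      show "(\<Union>k. level_set (r k)) = topspace ?E"
        using \<rho>_pos unfolding U[symmetric] by auto
    qed (use p supp U in auto)
  qed (rule ambiently_contractible_level_set)
qed

end

section \<open>Further facts on simplices and strictly increasing maps\<close>

lemma standard_simplexI:
  assumes "\<And>i. 0 \<le> t i" "\<And>i. n < i \<Longrightarrow> t i = 0" "(\<Sum>i\<le>n. t i) = 1"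
  shows "t \<in> standard_simplex n"
proof -
  have "t i \<le> 1" for i
  proof (cases "i \<le> n")
    case True
    then have "t i \<le> (\<Sum>i\<le>n. t i)" using assms(1) by (intro member_le_sum) auto
    then show ?thesis using assms(3) by simp
  qed (use assms(2)[of i] in simp)
  then show ?thesis using assms by (simp add: standard_simplex_def)
qed

lemma mon_delta_strict_mono:
  "\<theta> \<in> mon_delta m n \<Longrightarrow> i < j \<Longrightarrow> j \<le> m \<Longrightarrow> \<theta> i < \<theta> j"
  by (auto simp: mon_delta_def strict_mono_on_def)

lemma sum_simplex_push:
  assumes \<theta>: "\<theta> \<in> mon_delta m n"
  shows "(\<Sum>j\<le>n. simplex_push m \<theta> t j) = (\<Sum>i\<le>m. t i)"
proof -
  have "(\<Sum>j\<le>n. simplex_push m \<theta> t j) = (\<Sum>j\<le>n. \<Sum>i | i \<in> {..m} \<and> \<theta> i = j. t i)"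
    by (simp add: simplex_push_def)
  also have "\<dots> = (\<Sum>i\<le>m. t i)"
    by (rule sum.group) (use mon_deltaD[OF \<theta>] in auto)
  finally show ?thesis .
qed

section \<open>Joins of simplices\<close>

text \<open>In the simplex of dimension \<open>n + m + 1\<close>, as the join of those of dimensions \<open>n\<close> and \<open>m\<close>, the
  first \<open>n + 1\<close> vertices span the first factor.\<close>

definition join_maps :: "nat \<Rightarrow> (nat \<Rightarrow> nat) \<Rightarrow> nat \<Rightarrow> nat \<Rightarrow> (nat \<Rightarrow> nat) \<Rightarrow> nat \<Rightarrow> nat" where
  "join_maps l \<theta> n k \<eta> = (\<lambda>i\<in>{..l + k + 1}. if i \<le> l then \<theta> i else n + 1 + \<eta> (i - l - 1))"

text \<open>The shift is by \<open>n + 1\<close>, the number of vertices of the first factor. The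
  result is not normalized, so it remains continuous at points of the first factor, where it
  vanishes.\<close>

definition join_snd :: "nat \<Rightarrow> (nat \<Rightarrow> real) \<Rightarrow> nat \<Rightarrow> real" where
  "join_snd n u = (\<lambda>i. u (n + 1 + i))"

text \<open>The point of the join on the segment from \<open>t\<close> to \<open>b\<close> that has
  mass \<open>s\<close> in the second factor.\<close>

definition join_point :: "nat \<Rightarrow> (nat \<Rightarrow> real) \<Rightarrow> (nat \<Rightarrow> real) \<Rightarrow> real \<Rightarrow> nat \<Rightarrow> real" where
  "join_point n t b s = (\<lambda>j. if j \<le> n then (1 - s) * t j else s * b (j - n - 1))"

text \<open>A point carrying at most half of its mass in the first factor goes to \<open>t\<close>.  The coefficient
  of \<open>t\<close> makes the total mass \<open>1\<close> without a division by \<open>a\<close>, which may vanish.\<close>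

definition join_retract :: "nat \<Rightarrow> (nat \<Rightarrow> real) \<Rightarrow> (nat \<Rightarrow> real) \<Rightarrow> nat \<Rightarrow> real" where
  "join_retract n t u =
     (let a = (\<Sum>j\<le>n. u j); c = max 0 (2 * a - 1)
      in (\<lambda>j. if j \<le> n then c * u j + (1 - c * a) * t j else 0))"

text \<open>The same function as the identity of \<open>[n]\<close>, regarded as a morphism with a
  larger target; pushing forward along it does not move a point.\<close>

definition join_fst_incl :: "nat \<Rightarrow> nat \<Rightarrow> nat" where
  "join_fst_incl n = (\<lambda>i\<in>{..n}. i)"

definition join_snd_incl :: "nat \<Rightarrow> nat \<Rightarrow> nat \<Rightarrow> nat" where
  "join_snd_incl n m = (\<lambda>i\<in>{..m}. n + 1 + i)"

lemma join_maps_in: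
  assumes \<theta>: "\<theta> \<in> mon_delta l n" and \<eta>: "\<eta> \<in> mon_delta k m"
  shows "join_maps l \<theta> n k \<eta> \<in> mon_delta (l + k + 1) (n + m + 1)"
  unfolding mon_delta_def
proof (intro CollectI conjI strict_mono_onI)
  show "join_maps l \<theta> n k \<eta> \<in> {..l + k + 1} \<rightarrow>\<^sub>E {..n + m + 1}"
  proof
    fix i assume "i \<in> {..l + k + 1}"
    then show "join_maps l \<theta> n k \<eta> i \<in> {..n + m + 1}"
      using mon_deltaD(1)[OF \<theta>, of i] mon_deltaD(1)[OF \<eta>, of "i - l - 1"]
      by (auto simp: join_maps_def)
  qed (simp add: join_maps_def)
  fix i j assume ij: "i \<in> {..l + k + 1}" "j \<in> {..l + k + 1}" "i < j"
  then consider "j \<le> l" | "i \<le> l" "l < j" | "l < i" by linarith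
  then show "join_maps l \<theta> n k \<eta> i < join_maps l \<theta> n k \<eta> j"
  proof cases
    case 1
    then show ?thesis using ij mon_delta_strict_mono[OF \<theta>, of i j] by (simp add: join_maps_def)
  next
    case 2
    then show ?thesis using ij mon_deltaD(1)[OF \<theta>, of i] by (simp add: join_maps_def)
  next
    case 3
    then show ?thesis
      using ij mon_delta_strict_mono[OF \<eta>, of "i - l - 1" "j - l - 1"] by (simp add: join_maps_def)
  qed
qed

lemma join_fst_incl_in: "join_fst_incl n \<in> mon_delta n (n + m + 1)"
  by (auto simp: mon_delta_def join_fst_incl_def strict_mono_on_def)

lemma join_snd_incl_in: "join_snd_incl n m \<in> mon_delta m (n + m + 1)"
  by (auto simp: mon_delta_def join_snd_incl_def strict_mono_on_def)

lemma simplex_push_join_fst: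
  assumes "j \<le> n"
  shows "simplex_push (l + k + 1) (join_maps l \<theta> n k \<eta>) u j = simplex_push l \<theta> u j"
  unfolding simplex_push_def
  by (intro sum.cong refl) (use assms in \<open>auto simp: join_maps_def split: if_splits\<close>)

lemma simplex_push_join_snd:
  assumes \<theta>: "\<theta> \<in> mon_delta l n"
  shows "simplex_push (l + k + 1) (join_maps l \<theta> n k \<eta>) u (n + 1 + i) = simplex_push k \<eta> (join_snd l u) i"
proof -
  let ?B = "{j. j \<le> k \<and> \<eta> j = i}"
  \<comment> \<open>Vertices of the first factor have images at most \<open>n\<close>. The fibre
    over \<open>n + 1 + i\<close> thus lies in the second block and is a shifted fibre of
    \<open>\<eta>\<close>.\<close>
  have "{j. j \<le> l + k + 1 \<and> join_maps l \<theta> n k \<eta> j = n + 1 + i} = (\<lambda>j. l + 1 + j) ` ?B"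
  proof (intro equalityI subsetI)
    fix j assume j: "j \<in> {j. j \<le> l + k + 1 \<and> join_maps l \<theta> n k \<eta> j = n + 1 + i}"
    then have "l < j"
      using mon_deltaD(1)[OF \<theta>, of j] by (auto simp: join_maps_def split: if_splits)
    with j show "j \<in> (\<lambda>j. l + 1 + j) ` ?B"
      by (intro image_eqI[of _ _ "j - l - 1"]) (auto simp: join_maps_def)
  qed (auto simp: join_maps_def)
  then show ?thesis
    by (simp add: simplex_push_def join_snd_def sum.reindex inj_on_def)
qed

lemma join_snd_push:
  assumes "\<theta> \<in> mon_delta l n"
  shows "join_snd n (simplex_push (l + k + 1) (join_maps l \<theta> n k \<eta>) u) = simplex_push k \<eta> (join_snd l u)"
  using simplex_push_join_snd[OF assms] by (simp add: join_snd_def)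

lemma join_point_push:
  assumes "\<theta> \<in> mon_delta l n"
  shows "simplex_push (l + k + 1) (join_maps l \<theta> n k \<eta>) (join_point l t b s) =
         join_point n (simplex_push l \<theta> t) (simplex_push k \<eta> b) s"
proof
  fix j
  show "simplex_push (l + k + 1) (join_maps l \<theta> n k \<eta>) (join_point l t b s) j =
         join_point n (simplex_push l \<theta> t) (simplex_push k \<eta> b) s j"
  proof (cases "j \<le> n")
    case True
    then show ?thesis
      unfolding simplex_push_join_fst[OF True]
      by (simp add: simplex_push_def join_point_def sum_distrib_left)
  next
    case False
    then obtain i where "j = n + 1 + i" using less_imp_add_positive by (metis Suc_eq_plus1 add.commute add_Suc_right less_iff_Suc_add not_le)
    then show ?thesis
      unfolding \<open>j = n + 1 + i\<close> simplex_push_join_snd[OF assms]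
      by (simp add: simplex_push_def join_point_def join_snd_def sum_distrib_left)
  qed
qed

text \<open>Push-forward preserves the mass \<open>a\<close> of the first factor and hence
  \<open>c\<close>, so both sides are the same combination of the push-forwards of \<open>u\<close>
  and \<open>t\<close>.\<close>

lemma join_retract_push:
  assumes \<theta>: "\<theta> \<in> mon_delta l n"
  shows "join_retract n (simplex_push l \<theta> t) (simplex_push (l + k + 1) (join_maps l \<theta> n k \<eta>) u) =
         simplex_push l \<theta> (join_retract l t u)"
proof
  fix j
  define a where "a = (\<Sum>j\<le>l. u j)"
  define c where "c = max 0 (2 * a - 1)"
  have a: "(\<Sum>j\<le>n. simplex_push (l + k + 1) (join_maps l \<theta> n k \<eta>) u j) = a"
    unfolding a_def sum_simplex_push[OF \<theta>, symmetric] by (intro sum.cong refl simplex_push_join_fst) simp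
  have "simplex_push l \<theta> (join_retract l t u) j = simplex_push l \<theta> (\<lambda>j. c * u j + (1 - c * a) * t j) j"
    unfolding simplex_push_def
    by (intro sum.cong refl) (auto simp: join_retract_def Let_def a_def c_def)
  also have "\<dots> = c * simplex_push l \<theta> u j + (1 - c * a) * simplex_push l \<theta> t j"
    by (simp add: simplex_push_convex)
  finally have *: "simplex_push l \<theta> (join_retract l t u) j =
      c * simplex_push l \<theta> u j + (1 - c * a) * simplex_push l \<theta> t j" .
  show "join_retract n (simplex_push l \<theta> t) (simplex_push (l + k + 1) (join_maps l \<theta> n k \<eta>) u) j =
         simplex_push l \<theta> (join_retract l t u) j"
  proof (cases "j \<le> n")
    case True
    then show ?thesis
      unfolding * by (simp only: join_retract_def Let_def a simplex_push_join_fst[OF True] if_True c_def)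
  next
    case False
    then have "j \<notin> \<theta> ` {..l}" using mon_deltaD(1)[OF \<theta>] by auto
    then show ?thesis
      using False unfolding * by (simp add: join_retract_def Let_def simplex_push_outside)
  qed
qed

lemma sum_join: "(\<Sum>j\<le>n + m + 1. u j) = (\<Sum>j\<le>n. u j) + (\<Sum>i\<le>m. join_snd n u i :: real)"
  by (induction m) (auto simp: join_snd_def)

lemma join_snd_simplex:
  assumes u: "u \<in> standard_simplex (n + m + 1)"
  shows "0 \<le> join_snd n u i" "(\<Sum>j\<le>n. u j) + (\<Sum>i\<le>m. join_snd n u i) = 1"
  using standard_simplexD(1,4)[OF u] sum_join[of u n m] by (auto simp: join_snd_def)

text \<open>Since \<open>a\<close> lies in [0,1], so do \<open>c\<close> and \<open>c * a\<close>.
  The part coming from \<open>u\<close> has mass \<open>c * a\<close>, and \<open>1 - c * a\<close>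
  completes it to 1.\<close>

lemma join_retract_in:
  assumes t: "t \<in> standard_simplex n" and u: "u \<in> standard_simplex (n + m + 1)"
  shows "join_retract n t u \<in> standard_simplex n"
proof -
  define a where "a = (\<Sum>j\<le>n. u j)"
  define c where "c = max 0 (2 * a - 1)"
  have a: "0 \<le> a" "a \<le> 1"
    using standard_simplexD(1)[OF u] sum_nonneg[of "{..m}" "join_snd n u"] join_snd_simplex[OF u]
    by (auto simp: a_def intro!: sum_nonneg)
  have c: "0 \<le> c" "c \<le> 1" using a by (auto simp: c_def)
  have ca: "c * a \<le> 1" using a c by (simp add: mult_le_one)
  have *: "join_retract n t u = (\<lambda>j. if j \<le> n then c * u j + (1 - c * a) * t j else 0)"
    unfolding join_retract_def Let_def a_def c_def ..
  show ?thesis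
  proof (rule standard_simplexI)
    show "0 \<le> join_retract n t u i" for i
      using standard_simplexD(1)[OF t, of i] standard_simplexD(1)[OF u, of i] c ca by (simp add: *)
    show "(\<Sum>i\<le>n. join_retract n t u i) = 1"
      using standard_simplexD(4)[OF t]
      by (simp add: * sum.distrib flip: sum_distrib_left) (simp add: a_def)
  qed (simp add: *)
qed

text \<open>Here \<open>max 0 (2 * a - 1)\<close> pays off: \<open>a\<close> is at most 1/2, so
  \<open>c = 0\<close>. A path along the second factor starts once a coordinate there exceeds 1/2,
  and by then the retraction is constant at \<open>t\<close>.\<close>

lemma join_retract_snd:
  assumes t: "t \<in> standard_simplex n" and u: "u \<in> standard_simplex (n + m + 1)"
    and half: "1/2 \<le> (\<Sum>i\<le>m. join_snd n u i)"
  shows "join_retract n t u = t"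
proof -
  have "(\<Sum>j\<le>n. u j) \<le> 1/2" using join_snd_simplex(2)[OF u] half by linarith
  then have "max 0 (2 * (\<Sum>j\<le>n. u j) - 1) = 0" by simp
  then show ?thesis
    using standard_simplexD(3)[OF t] by (auto simp: join_retract_def Let_def)
qed

text \<open>All the mass is in the first factor, so \<open>a = 1\<close> and
  \<open>c = 1\<close>.\<close>

lemma join_retract_fst:
  assumes u: "u \<in> standard_simplex n"
  shows "join_retract n t u = u"
  using standard_simplexD(3,4)[OF u] by (auto simp: join_retract_def Let_def)

lemma join_snd_fst:
  assumes u: "u \<in> standard_simplex n"
  shows "join_snd n u = (\<lambda>_. 0)"
  using standard_simplexD(3)[OF u] by (auto simp: join_snd_def)

lemma join_point_in:
  assumes t: "t \<in> standard_simplex n" and b: "b \<in> standard_simplex m" and s: "0 \<le> s" "s \<le> 1"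
  shows "join_point n t b s \<in> standard_simplex (n + m + 1)"
proof (rule standard_simplexI)
  show "0 \<le> join_point n t b s i" for i
    using standard_simplexD(1)[OF t] standard_simplexD(1)[OF b] s by (simp add: join_point_def)
  show "join_point n t b s i = 0" if "n + m + 1 < i" for i
    using standard_simplexD(3)[OF b, of "i - n - 1"] that by (simp add: join_point_def)
  show "(\<Sum>i\<le>n + m + 1. join_point n t b s i) = 1"
    using standard_simplexD(4)[OF t] standard_simplexD(4)[OF b] unfolding sum_join
    by (simp add: join_point_def join_snd_def flip: sum_distrib_left)
qed

lemma simplex_push_fst_incl:
  assumes t: "t \<in> standard_simplex n"
  shows "simplex_push n (join_fst_incl n) t = t"
  using simplex_push_id[OF t] by (simp add: join_fst_incl_def)

lemma join_point_0:
  assumes t: "t \<in> standard_simplex n"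
  shows "join_point n t b 0 = t"
  using standard_simplexD(3)[OF t] by (auto simp: join_point_def)

lemma simplex_push_snd_incl:
  assumes b: "b \<in> standard_simplex m"
  shows "simplex_push m (join_snd_incl n m) b = join_point n t b 1"
proof
  fix j
  show "simplex_push m (join_snd_incl n m) b j = join_point n t b 1 j"
  proof (cases "n < j \<and> j - n - 1 \<le> m")
    case True
    then have "j = join_snd_incl n m (j - n - 1)" by (simp add: join_snd_incl_def)
    then show ?thesis
      using True simplex_push_image[OF join_snd_incl_in, of "j - n - 1" m n b] by (simp add: join_point_def)
  next
    case False
    then have "j \<notin> join_snd_incl n m ` {..m}" by (auto simp: join_snd_incl_def)
    moreover have "join_point n t b 1 j = 0"
      using False standard_simplexD(3)[OF b, of "j - n - 1"] by (auto simp: join_point_def)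
    ultimately show ?thesis by (simp add: simplex_push_outside)
  qed
qed

lemma join_snd_point: "join_snd n (join_point n t b s) = (\<lambda>i. s * b i)"
  by (simp add: join_snd_def join_point_def)

section \<open>Charts of a numerable cover\<close>

text \<open>The rank of an element, the number of elements of \<open>F\<close> below it, maps
  \<open>F\<close> bijectively onto the numbers below \<open>card F\<close>; \<open>e\<close> is the
  inverse.\<close>

lemma enumerate_finite_order:
  assumes F: "finite F" "F \<noteq> {}"
    and irrefl: "\<And>a. \<not> lt a a"
    and trans: "\<And>a b c. lt a b \<Longrightarrow> lt b c \<Longrightarrow> lt a c"
    and total: "\<And>a b. a \<noteq> b \<Longrightarrow> lt a b \<or> lt b a"
  shows "\<exists>m (e :: nat \<Rightarrow> 'i). e ` {..m} = F \<and> (\<forall>i j. i < j \<longrightarrow> j \<le> m \<longrightarrow> lt (e i) (e j))"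
proof -
  define rank where "rank a = card {b \<in> F. lt b a}" for a
  have mono: "rank a < rank b" if "a \<in> F" "lt a b" for a b
  proof -
    have "{c \<in> F. lt c a} \<subseteq> {c \<in> F. lt c b}" using trans[OF _ that(2)] by blast
    moreover have "a \<in> {c \<in> F. lt c b} - {c \<in> F. lt c a}" using that irrefl by blast
    ultimately show ?thesis
      unfolding rank_def using F(1) by (intro psubset_card_mono) auto
  qed
  have "inj_on rank F"
    using mono total by (metis inj_onI less_irrefl)
  moreover have "rank ` F \<subseteq> {..<card F}"
  proof
    fix r assume "r \<in> rank ` F"
    then obtain a where "a \<in> F" "r = card {b \<in> F. lt b a}" by (auto simp: rank_def)
    moreover from \<open>a \<in> F\<close> have "{b \<in> F. lt b a} \<subset> F" using irrefl by blast
    ultimately show "r \<in> {..<card F}" using F(1) by (simp add: psubset_card_mono)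
  qed
  ultimately have bij: "bij_betw rank F {..<card F}"
    by (simp add: bij_betw_def card_image card_subset_eq)
  define e where "e = inv_into F rank"
  have "{..<card F} = {..card F - 1}"
    using F by (metis card_gt_0_iff lessThan_Suc_atMost Suc_pred')
  with bij have bij: "bij_betw rank F {..card F - 1}" by simp
  then have e: "bij_betw e {..card F - 1} F" and rank_e: "\<And>i. i \<le> card F - 1 \<Longrightarrow> rank (e i) = i"
    unfolding e_def by (auto simp: bij_betw_inv_into bij_betw_inv_into_right)
  have "lt (e i) (e j)" if "i < j" "j \<le> card F - 1" for i j
  proof -
    have "e j \<in> F" using e that by (auto simp: bij_betw_def)
    then have "\<not> lt (e j) (e i)" using mono[of "e j" "e i"] rank_e[of i] rank_e[of j] that by auto
    moreover have "e i \<noteq> e j" using rank_e[of i] rank_e[of j] that by auto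
    ultimately show ?thesis using total by blast
  qed
  then show ?thesis using e by (intro exI[of _ "card F - 1"] exI[of _ e]) (simp add: bij_betw_def)
qed

text \<open>Barycentric coordinates on the vertices listed by \<open>e\<close>, turned into a
  function on all indices. Passing between a list and a sublist leaves this function unchanged, so
  constructions expressed through it are compatible with faces.\<close>

definition chart_push :: "nat \<Rightarrow> (nat \<Rightarrow> 'i) \<Rightarrow> (nat \<Rightarrow> real) \<Rightarrow> 'i \<Rightarrow> real" where
  "chart_push m e t = (\<lambda>\<alpha>. \<Sum>i | i \<le> m \<and> e i = \<alpha>. t i)"

lemma chart_push_image:
  assumes "inj_on e {..m}" "i \<le> m"
  shows "chart_push m e t (e i) = t i"
proof -
  have "{k. k \<le> m \<and> e k = e i} = {i}" using assms by (auto simp: inj_on_def)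
  then show ?thesis by (simp add: chart_push_def)
qed

lemma chart_push_outside:
  assumes "\<alpha> \<notin> e ` {..m}"
  shows "chart_push m e t \<alpha> = 0"
proof -
  have "{k. k \<le> m \<and> e k = \<alpha>} = {}" using assms by auto
  then show ?thesis unfolding chart_push_def by (simp only: sum.empty)
qed

lemma chart_push_compose:
  assumes \<theta>: "\<theta> \<in> mon_delta l m" and e': "\<And>i. i \<le> l \<Longrightarrow> e (\<theta> i) = e' i"
  shows "chart_push m e (simplex_push l \<theta> t) = chart_push l e' t"
proof
  fix \<alpha>
  let ?S = "{i. i \<le> l \<and> e' i = \<alpha>}"
  have "chart_push l e' t \<alpha> = (\<Sum>j | j \<le> m \<and> e j = \<alpha>. \<Sum>i | i \<in> ?S \<and> \<theta> i = j. t i)"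
    unfolding chart_push_def
    by (rule sum.group[symmetric]) (use mon_deltaD(1)[OF \<theta>] e' in auto)
  also have "\<dots> = (\<Sum>j | j \<le> m \<and> e j = \<alpha>. \<Sum>i | i \<le> l \<and> \<theta> i = j. t i)"
    by (intro sum.cong) (auto simp: e')
  finally show "chart_push m e (simplex_push l \<theta> t) \<alpha> = chart_push l e' t \<alpha>"
    by (simp add: chart_push_def simplex_push_def)
qed

lemma chart_push_scale: "chart_push m e (\<lambda>i. s * t i) = (\<lambda>\<alpha>. s * chart_push m e t \<alpha>)"
  by (simp add: chart_push_def sum_distrib_left)

text \<open>The order \<open>lt\<close> serves to list finitely many indices as the vertices of a simplex.\<close>

locale contracting_partition =
  fixes X :: "'a topology" and x0 :: 'a and I :: "'i set" and f :: "'i \<Rightarrow> 'a \<Rightarrow> real"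
    and U :: "'i \<Rightarrow> 'a set" and h :: "'i \<Rightarrow> real \<times> 'a \<Rightarrow> 'a" and lt :: "'i \<Rightarrow> 'i \<Rightarrow> bool"
  assumes x0: "x0 \<in> topspace X"
    and f_cont: "i \<in> I \<Longrightarrow> continuous_map X euclideanreal (f i)"
    and f_ge0: "i \<in> I \<Longrightarrow> x \<in> topspace X \<Longrightarrow> 0 \<le> f i x"
    and f_local: "x \<in> topspace X \<Longrightarrow> \<exists>F V. finite F \<and> F \<noteq> {} \<and> F \<subseteq> I \<and> openin X V \<and> x \<in> V \<and>
          (\<forall>y\<in>V. (\<forall>i\<in>F. y \<in> U i) \<and> (\<forall>i\<in>I - F. f i y = 0) \<and> (\<Sum>i\<in>F. f i y) = 1)"
    and h_cont: "i \<in> I \<Longrightarrow> continuous_map (prod_topology (top_of_set {0..1}) (subtopology X (U i))) X (h i)"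
    and h_0: "i \<in> I \<Longrightarrow> x \<in> topspace X \<Longrightarrow> x \<in> U i \<Longrightarrow> h i (0, x) = x"
    and h_1: "i \<in> I \<Longrightarrow> x \<in> topspace X \<Longrightarrow> x \<in> U i \<Longrightarrow> h i (1, x) = x0"
    and lt_irrefl: "\<not> lt i i"
    and lt_trans: "lt i j \<Longrightarrow> lt j k \<Longrightarrow> lt i k"
    and lt_total: "i \<noteq> j \<Longrightarrow> lt i j \<or> lt j i"
begin

sublocale reduced_semisimplicial_space "Omega_space X x0" Omega_act
  by (rule reduced_semisimplicial_space_Omega[OF x0])

definition chart :: "nat \<Rightarrow> (nat \<Rightarrow> 'i) \<Rightarrow> bool" where
  "chart m e \<longleftrightarrow> e ` {..m} \<subseteq> I \<and> (\<forall>i j. i < j \<longrightarrow> j \<le> m \<longrightarrow> lt (e i) (e j))"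

text \<open>A listed member may vanish at \<open>y\<close>, but its set \<open>U\<close> must
  contain \<open>y\<close>, as the simplex built at \<open>y\<close> runs along every listed path.
  Such a set need not be open, so open subsets \<open>V\<close> of it are carried along.\<close>

definition chart_dom :: "nat \<Rightarrow> (nat \<Rightarrow> 'i) \<Rightarrow> 'a set" where
  "chart_dom m e = {y \<in> topspace X. (\<forall>i\<le>m. y \<in> U (e i)) \<and> (\<forall>\<alpha>\<in>I - e ` {..m}. f \<alpha> y = 0) \<and>
     (\<Sum>i\<le>m. f (e i) y) = 1}"

definition coords :: "nat \<Rightarrow> (nat \<Rightarrow> 'i) \<Rightarrow> 'a \<Rightarrow> nat \<Rightarrow> real" where
  "coords m e y = (\<lambda>i. if i \<le> m then f (e i) y else 0)"

text \<open>At most one coordinate of a point of a simplex exceeds \<open>1/2\<close>, so \<open>SOME\<close> is unambiguous.\<close>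

definition spike :: "'a \<Rightarrow> ('i \<Rightarrow> real) \<Rightarrow> 'a \<Rightarrow> 'a" where
  "spike x \<beta> z = (if \<exists>\<alpha>. 1/2 < \<beta> \<alpha> then let \<alpha> = (SOME \<alpha>. 1/2 < \<beta> \<alpha>) in h \<alpha> (2 * \<beta> \<alpha> - 1, x) else z)"

lemma chart_lt_iff:
  assumes "chart m e" "i \<le> m" "j \<le> m"
  shows "lt (e i) (e j) \<longleftrightarrow> i < j"
  using assms lt_irrefl lt_trans unfolding chart_def by (metis linorder_neqE_nat)

lemma chart_inj: "chart m e \<Longrightarrow> inj_on e {..m}"
  using lt_irrefl unfolding chart_def inj_on_def by (metis atMost_iff linorder_neqE_nat)

lemma chart_in: "chart m e \<Longrightarrow> i \<le> m \<Longrightarrow> e i \<in> I"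
  by (auto simp: chart_def)

lemma enumerate_indices:
  assumes "finite F" "F \<noteq> {}"
  obtains m and e :: "nat \<Rightarrow> 'i" where "e ` {..m} = F" "\<forall>i j. i < j \<longrightarrow> j \<le> m \<longrightarrow> lt (e i) (e j)"
proof -
  have "\<exists>m (e :: nat \<Rightarrow> 'i). e ` {..m} = F \<and> (\<forall>i j. i < j \<longrightarrow> j \<le> m \<longrightarrow> lt (e i) (e j))"
  proof (rule enumerate_finite_order)
    show "\<And>a b c. lt a b \<Longrightarrow> lt b c \<Longrightarrow> lt a c" by (rule lt_trans)
  qed (use assms lt_irrefl lt_total in auto)
  then show ?thesis using that by blast
qed

lemma chart_neighbourhood:
  assumes x: "x \<in> topspace X"
  obtains m e V where "chart m e" "openin X V" "x \<in> V" "V \<subseteq> chart_dom m e"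
proof -
  from f_local[OF x] obtain F V where FV: "finite F" "F \<noteq> {}" "F \<subseteq> I" "openin X V" "x \<in> V"
    and V: "\<forall>y\<in>V. (\<forall>i\<in>F. y \<in> U i) \<and> (\<forall>i\<in>I - F. f i y = 0) \<and> (\<Sum>i\<in>F. f i y) = 1"
    by (elim exE conjE)
  obtain m :: nat and e where e: "e ` {..m} = F" "\<forall>i j. i < j \<longrightarrow> j \<le> m \<longrightarrow> lt (e i) (e j)"
    using enumerate_indices[OF FV(1,2)] by blast
  have "chart m e" using e FV(3) by (simp add: chart_def)
  moreover have "V \<subseteq> chart_dom m e"
  proof
    fix y assume y: "y \<in> V"
    have "(\<Sum>i\<le>m. f (e i) y) = (\<Sum>i\<in>F. f i y)"
      unfolding e(1)[symmetric] using chart_inj[OF \<open>chart m e\<close>] by (simp add: sum.reindex)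
    then show "y \<in> chart_dom m e"
      using bspec[OF V y] y openin_subset[OF FV(4)] e(1) by (auto simp: chart_dom_def)
  qed
  ultimately show ?thesis using that FV by blast
qed

text \<open>Both lists increase with respect to \<open>lt\<close>, which forces the index map
  between them to be strictly increasing.\<close>

lemma chart_dom_refine:
  assumes e: "chart m e" and a: "chart k a" and sub: "a ` {..k} \<subseteq> e ` {..m}"
  obtains \<theta> where "\<theta> \<in> mon_delta k m" "\<And>i. i \<le> k \<Longrightarrow> e (\<theta> i) = a i"
proof -
  have "\<exists>j\<le>m. e j = a i" if "i \<le> k" for i using sub that by (metis atMost_iff imageE image_subset_iff)
  then obtain \<theta> where \<theta>: "\<And>i. i \<le> k \<Longrightarrow> \<theta> i \<le> m \<and> e (\<theta> i) = a i" by metis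
  have "\<theta> i < \<theta> j" if "i < j" "j \<le> k" for i j
    using chart_lt_iff[OF e, of "\<theta> i" "\<theta> j"] \<theta>[of i] \<theta>[of j] a that by (auto simp: chart_def)
  then have "restrict \<theta> {..k} \<in> mon_delta k m"
    using \<theta> by (auto simp: mon_delta_def strict_mono_on_def)
  then show ?thesis using that \<theta> by auto
qed

text \<open>Vertices outside the image of \<open>\<theta>\<close> belong to members not listed by
  \<open>a\<close>, and these vanish at \<open>y\<close>.\<close>

lemma coords_refine:
  assumes e: "chart m e" and a: "chart k a" and \<theta>: "\<theta> \<in> mon_delta k m"
    and \<theta>_eq: "\<And>i. i \<le> k \<Longrightarrow> e (\<theta> i) = a i" and y: "y \<in> chart_dom k a"
  shows "simplex_push k \<theta> (coords k a y) = coords m e y"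
proof
  fix j
  show "simplex_push k \<theta> (coords k a y) j = coords m e y j"
  proof (cases "j \<in> \<theta> ` {..k}")
    case True
    then obtain i where "i \<le> k" "j = \<theta> i" by auto
    then show ?thesis
      using simplex_push_image[OF \<theta>] mon_deltaD(1)[OF \<theta>] \<theta>_eq by (simp add: coords_def)
  next
    case False
    have "f (e j) y = 0" if "j \<le> m"
    proof -
      have "e j \<notin> a ` {..k}"
      proof
        assume "e j \<in> a ` {..k}"
        then obtain i where "i \<le> k" "e j = e (\<theta> i)" using \<theta>_eq by auto
        then have "j = \<theta> i"
          using chart_inj[OF e] mon_deltaD(1)[OF \<theta>] that by (auto simp: inj_on_def)
        then show False using False \<open>i \<le> k\<close> by simp
      qed
      then show ?thesis using y chart_in[OF e that] by (auto simp: chart_dom_def)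
    qed
    then show ?thesis using simplex_push_outside[OF False] by (simp add: coords_def)
  qed
qed

text \<open>Two charts at a point are compared with the one given by the members of the partition that
  do not vanish there.\<close>

lemma chart_independence:
  assumes e: "chart m e" "y \<in> chart_dom m e" and e': "chart m' e'" "y \<in> chart_dom m' e'"
    and refine: "\<And>k a m e \<theta>. chart m e \<Longrightarrow> y \<in> chart_dom m e \<Longrightarrow> chart k a \<Longrightarrow> y \<in> chart_dom k a \<Longrightarrow>
        \<theta> \<in> mon_delta k m \<Longrightarrow> (\<And>i. i \<le> k \<Longrightarrow> e (\<theta> i) = a i) \<Longrightarrow> G k a = G m e"
  shows "G m e = G m' e'"
proof -
  let ?F = "{\<alpha> \<in> I. f \<alpha> y \<noteq> 0}"
  have y: "y \<in> topspace X" using e(2) by (simp add: chart_dom_def)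
  have sub: "?F \<subseteq> e ` {..m}" if "y \<in> chart_dom m e" for m e
    using that by (auto simp: chart_dom_def)
  have finF: "finite ?F" using finite_subset[OF sub[OF e(2)]] by simp
  have sumF: "(\<Sum>\<alpha>\<in>?F. f \<alpha> y) = 1"
  proof -
    have "(\<Sum>\<alpha>\<in>?F. f \<alpha> y) = (\<Sum>\<alpha>\<in>e ` {..m}. f \<alpha> y)"
      using sub[OF e(2)] chart_in[OF e(1)] by (intro sum.mono_neutral_left) auto
    also have "\<dots> = 1"
      using chart_inj[OF e(1)] e(2) by (simp add: sum.reindex chart_dom_def)
    finally show ?thesis .
  qed
  have "?F \<noteq> {}"
  proof
    assume "?F = {}"
    then have "(\<Sum>\<alpha>\<in>?F. f \<alpha> y) = 0" by (simp only: sum.empty)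
    with sumF show False by simp
  qed
  then obtain k :: nat and a where a: "a ` {..k} = ?F" "\<forall>i j. i < j \<longrightarrow> j \<le> k \<longrightarrow> lt (a i) (a j)"
    by (rule enumerate_indices[OF finF])
  have ch: "chart k a" using a by (auto simp: chart_def)
  have "(\<Sum>i\<le>k. f (a i) y) = 1"
    using sumF chart_inj[OF ch] unfolding a(1)[symmetric] by (simp add: sum.reindex)
  moreover have "y \<in> U (a i)" if "i \<le> k" for i
  proof -
    have "a i \<in> e ` {..m}" using a(1) sub[OF e(2)] that by blast
    then show ?thesis using e(2) by (auto simp: chart_dom_def)
  qed
  ultimately have dom: "y \<in> chart_dom k a" using y a(1) by (auto simp: chart_dom_def)
  have "G k a = G m e" if em: "chart m e" "y \<in> chart_dom m e" for m e
  proof -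
    obtain \<theta> where "\<theta> \<in> mon_delta k m" "\<And>i. i \<le> k \<Longrightarrow> e (\<theta> i) = a i"
      using chart_dom_refine[OF em(1) ch] sub[OF em(2)] a(1) by metis
    then show ?thesis using refine em ch dom by blast
  qed
  then show ?thesis using e e' by metis
qed

lemma coords_in:
  assumes "chart m e" "y \<in> chart_dom m e"
  shows "coords m e y \<in> standard_simplex m"
proof (rule standard_simplexI)
  show "0 \<le> coords m e y i" for i
    using assms f_ge0 chart_in by (auto simp: coords_def chart_dom_def)
  show "(\<Sum>i\<le>m. coords m e y i) = 1"
    using assms(2) by (simp add: coords_def chart_dom_def)
qed (simp add: coords_def)

lemma chart_push_coords:
  assumes "chart m e" "y \<in> chart_dom m e"
  shows "chart_push m e (coords m e y) = (\<lambda>\<alpha>. if \<alpha> \<in> I then f \<alpha> y else 0)"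
proof
  fix \<alpha>
  show "chart_push m e (coords m e y) \<alpha> = (if \<alpha> \<in> I then f \<alpha> y else 0)"
  proof (cases "\<alpha> \<in> e ` {..m}")
    case True
    then show ?thesis
      using chart_push_image[OF chart_inj[OF assms(1)]] chart_in[OF assms(1)] by (auto simp: coords_def)
  next
    case False
    then show ?thesis
      using assms(2) by (auto simp: chart_push_outside chart_dom_def)
  qed
qed

section \<open>Spikes: running along a single contracting path\<close>

lemma spike_eq:
  assumes "1/2 < \<beta> \<alpha>" "\<And>\<gamma>. \<gamma> \<noteq> \<alpha> \<Longrightarrow> \<beta> \<gamma> \<le> 1/2"
  shows "spike x \<beta> z = h \<alpha> (2 * \<beta> \<alpha> - 1, x)"
proof -
  have "(SOME \<alpha>. 1/2 < \<beta> \<alpha>) = \<alpha>" using assms by (intro some_equality) force+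
  then show ?thesis using assms(1) by (auto simp: spike_def)
qed

lemma spike_none: "(\<And>\<alpha>. \<beta> \<alpha> \<le> 1/2) \<Longrightarrow> spike x \<beta> z = z"
  by (auto simp: spike_def not_less[symmetric])

text \<open>Closed pasting over the set where all coordinates are at most 1/2 and the sets where the
  \<open>i\<close>-th is at least 1/2. On overlaps a coordinate equals 1/2, and the path is then at
  its starting point \<open>k' p\<close>, which \<open>agree\<close> identifies with
  \<open>k p\<close>. Two coordinates of at least 1/2 both equal 1/2, since the sum is at most
  1.\<close>

lemma continuous_map_spike:
  assumes e: "chart m e"
    and k: "continuous_map P X k" and k': "continuous_map P X k'"
    and b: "\<And>i. i \<le> m \<Longrightarrow> continuous_map P euclideanreal (\<lambda>p. b p i)"
    and b_ge0: "\<And>p i. p \<in> topspace P \<Longrightarrow> i \<le> m \<Longrightarrow> 0 \<le> b p i"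
    and b_sum: "\<And>p. p \<in> topspace P \<Longrightarrow> (\<Sum>i\<le>m. b p i) \<le> 1"
    and k'_in: "\<And>p i. p \<in> topspace P \<Longrightarrow> i \<le> m \<Longrightarrow> k' p \<in> U (e i)"
    and agree: "\<And>p i. p \<in> topspace P \<Longrightarrow> i \<le> m \<Longrightarrow> 1/2 \<le> b p i \<Longrightarrow> k p = k' p"
  shows "continuous_map P X (\<lambda>p. spike (k' p) (chart_push m e (b p)) (k p))"
proof -
  have le1: "b p i \<le> 1" if "p \<in> topspace P" "i \<le> m" for p i
    using member_le_sum[of i "{..m}" "b p"] b_ge0 b_sum[OF that(1)] that by fastforce
  have pair: "b p i + b p j \<le> 1" if "p \<in> topspace P" "i \<le> m" "j \<le> m" "i \<noteq> j" for p i j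
  proof -
    have "b p i + b p j = (\<Sum>k\<in>{i, j}. b p k)" using that by simp
    also have "\<dots> \<le> (\<Sum>k\<le>m. b p k)" using that b_ge0 by (intro sum_mono2) auto
    finally show ?thesis using b_sum[OF that(1)] by simp
  qed
  have push: "chart_push m e (b p) (e i) = b p i" if "i \<le> m" for p i
    using chart_push_image[OF chart_inj[OF e] that] .
  have eq: "spike (k' p) (chart_push m e (b p)) (k p) = h (e i) (2 * b p i - 1, k' p)"
    if "p \<in> topspace P" "i \<le> m" "1/2 < b p i" for p i
  proof -
    have "chart_push m e (b p) \<gamma> \<le> 1/2" if "\<gamma> \<noteq> e i" for \<gamma>
    proof (cases "\<gamma> \<in> e ` {..m}")
      case True
      then obtain j where "j \<le> m" "\<gamma> = e j" by auto
      moreover from this have "j \<noteq> i" using \<open>\<gamma> \<noteq> e i\<close> by auto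
      ultimately show ?thesis using pair[of p i j] \<open>p \<in> topspace P\<close> \<open>i \<le> m\<close> \<open>1/2 < b p i\<close> by (simp add: push)
    qed (simp add: chart_push_outside)
    then show ?thesis
      using spike_eq[of "chart_push m e (b p)" "e i"] that by (simp add: push)
  qed
  \<comment> \<open>\<open>None\<close> stands for the piece on which no path is run,
    \<open>Some i\<close> for the piece on the \<open>i\<close>-th path.\<close>
  define T where "T = (\<lambda>None \<Rightarrow> {p \<in> topspace P. \<forall>i\<le>m. b p i \<le> 1/2} | Some i \<Rightarrow> {p \<in> topspace P. 1/2 \<le> b p i})"
  define F where "F = (\<lambda>None \<Rightarrow> k | Some i \<Rightarrow> (\<lambda>p. h (e i) (2 * b p i - 1, k' p)))"
  show ?thesis
  proof (rule pasting_lemma_closed[where I = "insert None (Some ` {..m})" and T = T and f = F])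
    fix o' assume o': "o' \<in> insert None (Some ` {..m})"
    show "closedin P (T o')"
    proof (cases o')
      case None
      have "closedin P {p \<in> topspace P. b p i \<in> {..1/2}}" if "i \<le> m" for i
        by (rule closedin_continuous_map_preimage[OF b[OF that]]) simp
      then have "closedin P (\<Inter>i\<le>m. {p \<in> topspace P. b p i \<in> {..1/2}})"
        by (intro closedin_Inter) auto
      moreover have "(\<Inter>i\<le>m. {p \<in> topspace P. b p i \<in> {..1/2}}) = T None"
        by (auto simp: T_def)
      ultimately show ?thesis using None by simp
    next
      case (Some i)
      have "closedin P {p \<in> topspace P. b p i \<in> {1/2..}}"
        by (rule closedin_continuous_map_preimage[OF b]) (use Some o' in auto)
      then show ?thesis using Some by (simp add: T_def)
    qed
    show "continuous_map (subtopology P (T o')) X (F o')"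
    proof (cases o')
      case None
      then show ?thesis using k by (simp add: F_def continuous_map_from_subtopology)
    next
      case (Some i)
      then have i: "i \<le> m" using o' by auto
      let ?S = "subtopology P (T o')"
      have "continuous_map ?S euclideanreal (\<lambda>p. 2 * b p i - 1)"
        using b[OF i] by (intro continuous_map_diff continuous_map_real_mult continuous_map_from_subtopology) auto
      then have "continuous_map ?S (top_of_set {0..1}) (\<lambda>p. 2 * b p i - 1)"
        using Some i le1 by (auto simp: continuous_map_in_subtopology T_def)
      moreover have "continuous_map ?S (subtopology X (U (e i))) k'"
        using k' k'_in[OF _ i] by (auto simp: continuous_map_in_subtopology continuous_map_from_subtopology)
      ultimately have "continuous_map ?S (prod_topology (top_of_set {0..1}) (subtopology X (U (e i))))
          (\<lambda>p. (2 * b p i - 1, k' p))"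
        by (simp add: continuous_map_pairedI)
      from continuous_map_compose[OF this h_cont[OF chart_in[OF e i]]]
      show ?thesis using Some by (simp add: F_def o_def)
    qed
  next
    have k'_top: "k' p \<in> topspace X" if "p \<in> topspace P" for p
      using k' that by (auto simp: continuous_map_def)
    have half: "F (Some i) p = k' p" if "p \<in> topspace P" "i \<le> m" "b p i = 1/2" for p i
    proof -
      have "2 * b p i - 1 = 0" using that by simp
      then show ?thesis
        using h_0[OF chart_in[OF e that(2)] k'_top[OF that(1)] k'_in[OF that(1,2)]] by (simp add: F_def)
    qed
    have *: "F None p = F (Some i) p" if "p \<in> T None \<inter> T (Some i)" "i \<le> m" for p i
    proof -
      have p: "p \<in> topspace P" "b p i = 1/2" using that by (auto simp: T_def intro!: antisym)
      then show ?thesis using half[of p i] agree[of p i] that by (simp add: F_def)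
    qed
    have **: "F (Some i) p = F (Some j) p" if "p \<in> T (Some i) \<inter> T (Some j)" "i \<le> m" "j \<le> m" for p i j
    proof (cases "i = j")
      case False
      then have "p \<in> topspace P" "b p i = 1/2" "b p j = 1/2"
        using that pair[of p i j] by (auto simp: T_def)
      then show ?thesis using half that by simp
    qed simp
    show "F o1 p = F o2 p"
      if "o1 \<in> insert None (Some ` {..m})" "o2 \<in> insert None (Some ` {..m})" "p \<in> topspace P \<inter> T o1 \<inter> T o2" for o1 o2 p
    proof (cases o1)
      case None
      then show ?thesis using that * by (cases o2) auto
    next
      case (Some i)
      with that show ?thesis
        using *[of p i] **[of p i "the o2"] by (cases o2) auto
    qed
  next
    fix p assume p: "p \<in> topspace P"
    show "\<exists>o'. o' \<in> insert None (Some ` {..m}) \<and> p \<in> T o' \<and> spike (k' p) (chart_push m e (b p)) (k p) = F o' p"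
    proof (cases "\<exists>i\<le>m. 1/2 < b p i")
      case True
      then obtain i where "i \<le> m" "1/2 < b p i" by blast
      then show ?thesis using p eq by (intro exI[of _ "Some i"]) (auto simp: T_def F_def)
    next
      case False
      have "chart_push m e (b p) \<gamma> \<le> 1/2" for \<gamma>
        using False by (cases "\<gamma> \<in> e ` {..m}") (auto simp: push chart_push_outside not_less)
      then have "spike (k' p) (chart_push m e (b p)) (k p) = k p" by (rule spike_none)
      then show ?thesis using p False by (intro exI[of _ None]) (auto simp: T_def F_def not_less)
    qed
  qed simp
qed

end

section \<open>A homotopy section of the counit\<close>

text \<open>On the \<open>n\<close>-simplices the counit is evaluation, so this is read off from the
  continuity of the counit.\<close>

lemma continuous_map_Omega_evaluation:
  "continuous_map (prod_topology (Omega_space X x0 n) (simplex_space n)) X (\<lambda>(\<sigma>, t). \<sigma> t)"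
proof -
  have "continuous_map (prod_topology (Omega_space X x0 n) (simplex_space n)) X
      (\<lambda>(\<sigma>, t). Omega_counit (simplex_class (Omega_space X x0) Omega_act n \<sigma> t))"
    using continuous_map_Omega_counit[of X x0] unfolding continuous_map_from_fat_realization by blast
  then show ?thesis by (rule continuous_map_eq) (auto simp: Omega_counit_class)
qed

lemma continuous_map_into_Omega_space:
  assumes g: "continuous_map (prod_topology Z (simplex_space n)) X (\<lambda>(z, t). g z t)"
    and vertex: "\<And>z i. z \<in> topspace Z \<Longrightarrow> i \<le> n \<Longrightarrow> g z (simplex_vertex i) = x0"
  shows "continuous_map Z (Omega_space X x0 n) (\<lambda>z. restrict (g z) (standard_simplex n))"
proof -
  have "continuous_map Z (compact_open_topology (simplex_space n) X) (\<lambda>z. restrict (g z) (standard_simplex n))"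
    using continuous_map_curry[OF g] by simp
  then show ?thesis
    using vertex by (auto simp: Omega_space_def continuous_map_in_subtopology)
qed

lemma continuous_map_simplex_coord:
  assumes "continuous_map P (simplex_space n) t"
  shows "continuous_map P euclideanreal (\<lambda>p. t p j)"
  using continuous_map_compose[OF assms continuous_map_simplex_coordinate[of n j]] by (simp add: o_def)

lemma continuous_map_join_retract:
  assumes t: "continuous_map P (simplex_space n) t"
    and u: "continuous_map P (simplex_space (n + m + 1)) u"
  shows "continuous_map P (simplex_space n) (\<lambda>p. join_retract n (t p) (u p))"
proof (rule continuous_map_into_simplex_space)
  show "join_retract n (t p) (u p) \<in> standard_simplex n" if "p \<in> topspace P" for p
    using that t u by (intro join_retract_in) (auto simp: continuous_map_def Pi_iff)
  show "continuous_map P euclideanreal (\<lambda>p. join_retract n (t p) (u p) j)" for j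
  proof (cases "j \<le> n")
    case True
    then have "(\<lambda>p. join_retract n (t p) (u p) j) =
        (\<lambda>p. max 0 (2 * (\<Sum>j\<le>n. u p j) - 1) * u p j +
             (1 - max 0 (2 * (\<Sum>j\<le>n. u p j) - 1) * (\<Sum>j\<le>n. u p j)) * t p j)"
      by (simp add: join_retract_def Let_def)
    then show ?thesis
      by (auto intro!: continuous_map_add continuous_map_real_mult continuous_map_diff continuous_map_sum
          continuous_map_real_max continuous_map_simplex_coord[OF t] continuous_map_simplex_coord[OF u])
  qed (simp add: join_retract_def Let_def)
qed

context contracting_partition
begin

abbreviation "Omega \<equiv> Omega_space X x0"
abbreviation "realization \<equiv> fat_realization Omega Omega_act"

definition cone :: "nat \<Rightarrow> (nat \<Rightarrow> 'i) \<Rightarrow> 'a \<Rightarrow> (nat \<Rightarrow> real) \<Rightarrow> 'a" where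
  "cone m e y = (\<lambda>u\<in>standard_simplex m. spike y (chart_push m e u) y)"

text \<open>At a vertex the coordinate is 1, so the path parameter \<open>2 * 1 - 1\<close> is 1 and
  the contraction has reached \<open>x0\<close>.\<close>

lemma spike_vertex:
  assumes e: "chart m e" and i: "i \<le> m" and x: "x \<in> topspace X" "x \<in> U (e i)"
  shows "spike x (chart_push m e (simplex_vertex i)) z = x0"
proof -
  have "chart_push m e (simplex_vertex i) \<gamma> \<le> 1/2" if "\<gamma> \<noteq> e i" for \<gamma>
  proof (cases "\<gamma> \<in> e ` {..m}")
    case True
    then obtain j where "j \<le> m" "\<gamma> = e j" by auto
    then show ?thesis
      using that chart_push_image[OF chart_inj[OF e]] by (auto simp: simplex_vertex_def)
  qed (simp add: chart_push_outside)
  moreover have "chart_push m e (simplex_vertex i) (e i) = 1"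
    using chart_push_image[OF chart_inj[OF e] i] by (simp add: simplex_vertex_def)
  ultimately show ?thesis
    using spike_eq[of "chart_push m e (simplex_vertex i)" "e i"] h_1[OF chart_in[OF e i] x] by simp
qed

lemma continuous_map_cone:
  assumes e: "chart m e"
  shows "continuous_map (subtopology X (chart_dom m e)) (Omega m) (cone m e)"
  unfolding cone_def
proof (rule continuous_map_into_Omega_space)
  let ?P = "prod_topology (subtopology X (chart_dom m e)) (simplex_space m)"
  have fst: "continuous_map ?P X fst"
    by (rule continuous_map_into_fulltopology[OF continuous_map_fst])
  have "continuous_map ?P X (\<lambda>p. spike (fst p) (chart_push m e (snd p)) (fst p))"
  proof (rule continuous_map_spike[OF e fst fst])
    show "continuous_map ?P euclideanreal (\<lambda>p. snd p i)" for i
      by (rule continuous_map_simplex_coord[OF continuous_map_snd])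
    show "(\<Sum>i\<le>m. snd p i) \<le> 1" if "p \<in> topspace ?P" for p
      using that standard_simplexD(4)[of "snd p" m] by auto
  qed (auto simp: chart_dom_def intro: standard_simplexD(1))
  then show "continuous_map ?P X (\<lambda>(y, u). spike y (chart_push m e u) y)"
    by (simp add: case_prod_unfold)
  show "spike y (chart_push m e (simplex_vertex i)) y = x0"
    if "y \<in> topspace (subtopology X (chart_dom m e))" "i \<le> m" for y i
    using that by (intro spike_vertex[OF e]) (auto simp: chart_dom_def)
qed

lemma cone_in:
  assumes "chart m e" "y \<in> chart_dom m e"
  shows "cone m e y \<in> topspace (Omega m)"
proof -
  have "y \<in> topspace (subtopology X (chart_dom m e))" using assms by (auto simp: chart_dom_def)
  then show ?thesis using continuous_map_cone[OF assms(1)] unfolding continuous_map_def by blast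
qed

section \<open>The section, glued from charts\<close>

definition section_at :: "nat \<Rightarrow> (nat \<Rightarrow> 'i) \<Rightarrow> 'a \<Rightarrow> (nat \<times> ((nat \<Rightarrow> real) \<Rightarrow> 'a) \<times> (nat \<Rightarrow> real)) set" where
  "section_at m e y = simplex_class Omega Omega_act m (cone m e y) (coords m e y)"

text \<open>The simplex of the sublist is the face along \<open>\<theta>\<close> of the larger one,
  and the chosen points correspond under \<open>\<theta>\<close>; the face identification equates
  the two classes.\<close>

lemma section_at_refine:
  assumes e: "chart m e" "y \<in> chart_dom m e" and a: "chart k a" "y \<in> chart_dom k a"
    and \<theta>: "\<theta> \<in> mon_delta k m" and \<theta>_eq: "\<And>i. i \<le> k \<Longrightarrow> e (\<theta> i) = a i"
  shows "section_at k a y = section_at m e y"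
proof -
  have "cone k a y = Omega_act k m \<theta> (cone m e y)"
    unfolding cone_def Omega_act_def
    by (rule restrict_ext) (simp add: simplex_push_in[OF \<theta>] chart_push_compose[where e = e and e' = a, OF \<theta> \<theta>_eq])
  then show ?thesis
    unfolding section_at_def
    using simplex_class_face[OF \<theta> cone_in[OF e] coords_in[OF a]]
      coords_refine[where e = e and a = a and \<theta> = \<theta>, OF e(1) a(1) \<theta> \<theta>_eq a(2)] by simp
qed

text \<open>An arbitrary choice of a chart at \<open>y\<close>, harmless for everything to which
  \<open>chart_independence\<close> applies.\<close>

definition chart_at :: "'a \<Rightarrow> nat \<times> (nat \<Rightarrow> 'i)" where
  "chart_at y = (SOME c. chart (fst c) (snd c) \<and> y \<in> chart_dom (fst c) (snd c))"

lemma chart_at: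
  assumes "y \<in> topspace X"
  shows "chart (fst (chart_at y)) (snd (chart_at y))" "y \<in> chart_dom (fst (chart_at y)) (snd (chart_at y))"
proof -
  obtain m e V where "chart m e" "openin X V" "y \<in> V" "V \<subseteq> chart_dom m e"
    by (rule chart_neighbourhood[OF assms])
  then have "chart (fst (m, e)) (snd (m, e)) \<and> y \<in> chart_dom (fst (m, e)) (snd (m, e))" by auto
  from someI[of "\<lambda>c. chart (fst c) (snd c) \<and> y \<in> chart_dom (fst c) (snd c)", OF this]
  show "chart (fst (chart_at y)) (snd (chart_at y))" "y \<in> chart_dom (fst (chart_at y)) (snd (chart_at y))"
    unfolding chart_at_def by auto
qed

definition sect :: "'a \<Rightarrow> (nat \<times> ((nat \<Rightarrow> real) \<Rightarrow> 'a) \<times> (nat \<Rightarrow> real)) set" where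
  "sect y = section_at (fst (chart_at y)) (snd (chart_at y)) y"

lemma sect_eq:
  assumes e: "chart m e" "y \<in> chart_dom m e"
  shows "sect y = section_at m e y"
proof -
  have y: "y \<in> topspace X" using e by (simp add: chart_dom_def)
  show ?thesis
    unfolding sect_def
    by (rule chart_independence[where G = "\<lambda>m e. section_at m e y", OF chart_at[OF y] e])
      (rule section_at_refine)
qed

definition chart_nbhds :: "(nat \<times> (nat \<Rightarrow> 'i) \<times> 'a set) set" where
  "chart_nbhds = {(m, e, V). chart m e \<and> openin X V \<and> V \<subseteq> chart_dom m e}"

lemma chart_nbhds_cover:
  assumes "x \<in> topspace X"
  shows "\<exists>m e V. (m, e, V) \<in> chart_nbhds \<and> x \<in> V"
proof -
  obtain m e V where "chart m e" "openin X V" "x \<in> V" "V \<subseteq> chart_dom m e"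
    by (rule chart_neighbourhood[OF assms])
  then show ?thesis by (auto simp: chart_nbhds_def)
qed

lemma continuous_map_sect: "continuous_map X realization sect"
proof (rule pasting_lemma[where I = chart_nbhds and T = "\<lambda>(m, e, V). V" and f = "\<lambda>(m, e, V). section_at m e"])
  fix c assume "c \<in> chart_nbhds"
  then obtain m e V where c: "c = (m, e, V)" and e: "chart m e" and V: "openin X V" "V \<subseteq> chart_dom m e"
    by (auto simp: chart_nbhds_def)
  show "openin X (case c of (m, e, V) \<Rightarrow> V)" using c V by simp
  have coords: "continuous_map (subtopology X V) (simplex_space m) (coords m e)"
  proof (rule continuous_map_into_simplex_space)
    show "continuous_map (subtopology X V) euclideanreal (\<lambda>y. coords m e y j)" for j
      using f_cont chart_in[OF e] by (auto simp: coords_def intro!: continuous_map_from_subtopology)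
  qed (use coords_in[OF e] V in auto)
  have "continuous_map (subtopology X V) (Omega m) (cone m e)"
    by (rule continuous_map_from_subtopology_mono[OF continuous_map_cone[OF e] V(2)])
  with coords have "continuous_map (subtopology X V) (prod_topology (Omega m) (simplex_space m)) (\<lambda>y. (cone m e y, coords m e y))"
    by (simp add: continuous_map_pairedI)
  from continuous_map_compose[OF this continuous_map_simplex_class[of Omega m Omega_act]]
  have "continuous_map (subtopology X V) realization (section_at m e)"
    by (simp add: o_def section_at_def[abs_def])
  then show "continuous_map (subtopology X (case c of (m, e, V) \<Rightarrow> V)) realization (case c of (m, e, V) \<Rightarrow> section_at m e)"
    using c by simp
next
  fix c c' x
  assume "c \<in> chart_nbhds" "c' \<in> chart_nbhds"
    and "x \<in> topspace X \<inter> (case c of (m, e, V) \<Rightarrow> V) \<inter> (case c' of (m, e, V) \<Rightarrow> V)"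
  moreover have "(case c of (m, e, V) \<Rightarrow> section_at m e) x = sect x"
    if "c \<in> chart_nbhds" "x \<in> (case c of (m, e, V) \<Rightarrow> V)" for c
    using that by (cases c) (simp add: chart_nbhds_def subset_iff flip: sect_eq)
  ultimately show "(case c of (m, e, V) \<Rightarrow> section_at m e) x = (case c' of (m, e, V) \<Rightarrow> section_at m e) x"
    by (metis IntD1 IntD2)
next
  fix x assume "x \<in> topspace X"
  then obtain m e V where "(m, e, V) \<in> chart_nbhds" "x \<in> V" using chart_nbhds_cover by blast
  then show "\<exists>c. c \<in> chart_nbhds \<and> x \<in> (case c of (m, e, V) \<Rightarrow> V) \<and> sect x = (case c of (m, e, V) \<Rightarrow> section_at m e) x"
    by (intro exI[of _ "(m, e, V)"]) (auto simp: chart_nbhds_def sect_eq)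
qed

text \<open>No chart occurs in the resulting formula, which allows the homotopy to the identity to
  be written globally.\<close>

lemma counit_sect:
  assumes "y \<in> topspace X"
  shows "Omega_counit (sect y) = spike y (\<lambda>\<alpha>. if \<alpha> \<in> I then f \<alpha> y else 0) y"
proof -
  obtain m e where e: "chart m e" "y \<in> chart_dom m e" using chart_at[OF assms] by blast
  then have "Omega_counit (sect y) = cone m e y (coords m e y)"
    by (simp add: sect_eq section_at_def Omega_counit_class cone_in coords_in)
  then show ?thesis
    using e by (simp add: chart_push_coords cone_def coords_in)
qed

lemma homotopic_counit_sect: "homotopic_with (\<lambda>_. True) X X (Omega_counit \<circ> sect) id"
proof -
  let ?I = "top_of_set {0..1::real}"
  \<comment> \<open>At parameter 0 all coordinates vanish and the point stays; at 1 the formula is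
    that of \<open>counit_sect\<close>. The same formula is used on every patch below, and charts
    only serve to prove its continuity.\<close>
  let ?h = "\<lambda>p. spike (snd p) (\<lambda>\<alpha>. fst p * (if \<alpha> \<in> I then f \<alpha> (snd p) else 0)) (snd p)"
  have h: "continuous_map (prod_topology ?I X) X ?h"
  proof (rule pasting_lemma[where I = chart_nbhds and T = "\<lambda>(m, e, V). {0..1} \<times> V" and f = "\<lambda>_. ?h"])
    fix c assume "c \<in> chart_nbhds"
    then obtain m e V where c: "c = (m, e, V)" and e: "chart m e" and V: "openin X V" "V \<subseteq> chart_dom m e"
      by (auto simp: chart_nbhds_def)
    show "openin (prod_topology ?I X) (case c of (m, e, V) \<Rightarrow> {0..1} \<times> V)"
      using c V(1) by (simp add: openin_prod_Times_iff)
    let ?P = "subtopology (prod_topology ?I X) ({0..1} \<times> V)"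
    have fst: "continuous_map ?P euclideanreal fst"
      by (intro continuous_map_from_subtopology continuous_map_into_fulltopology[OF continuous_map_fst])
    have snd: "continuous_map ?P X snd"
      by (intro continuous_map_from_subtopology continuous_map_snd)
    have "continuous_map ?P X (\<lambda>p. spike (snd p) (chart_push m e (\<lambda>i. fst p * coords m e (snd p) i)) (snd p))"
    proof (rule continuous_map_spike[OF e snd snd])
      show "continuous_map ?P euclideanreal (\<lambda>p. fst p * coords m e (snd p) i)" if "i \<le> m" for i
        using that fst continuous_map_compose[OF snd f_cont[OF chart_in[OF e that]]]
        by (intro continuous_map_real_mult) (auto simp: coords_def o_def)
      fix p assume p: "p \<in> topspace ?P"
      then have c: "coords m e (snd p) \<in> standard_simplex m" using V coords_in[OF e] by auto
      show "0 \<le> fst p * coords m e (snd p) i" for i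
        using p standard_simplexD(1)[OF c] by auto
      show "(\<Sum>i\<le>m. fst p * coords m e (snd p) i) \<le> 1"
        using p standard_simplexD(4)[OF c] by (auto simp flip: sum_distrib_left)
      show "snd p \<in> U (e i)" if "i \<le> m" for i
        using p V(2) that by (auto simp: chart_dom_def)
    qed auto
    then have "continuous_map ?P X ?h"
    proof (rule continuous_map_eq)
      fix p assume "p \<in> topspace ?P"
      then have "snd p \<in> chart_dom m e" using V(2) by auto
      then show "spike (snd p) (chart_push m e (\<lambda>i. fst p * coords m e (snd p) i)) (snd p) = ?h p"
        by (simp add: chart_push_scale chart_push_coords[OF e])
    qed
    then show "continuous_map (subtopology (prod_topology ?I X) (case c of (m, e, V) \<Rightarrow> {0..1} \<times> V)) X ?h"
      using c by simp
  next
    fix p assume "p \<in> topspace (prod_topology ?I X)"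
    then obtain m e V where "(m, e, V) \<in> chart_nbhds" "snd p \<in> V" "fst p \<in> {0..1}"
      using chart_nbhds_cover[of "snd p"] by auto
    then show "\<exists>c. c \<in> chart_nbhds \<and> p \<in> (case c of (m, e, V) \<Rightarrow> {0..1} \<times> V) \<and> ?h p = ?h p"
      by (intro exI[of _ "(m, e, V)"]) (auto simp: mem_Times_iff)
  qed simp
  have "homotopic_with (\<lambda>_. True) X X id (Omega_counit \<circ> sect)"
    by (subst homotopic_with) (use h counit_sect in \<open>auto intro!: exI[of _ ?h] simp: spike_none cong: if_cong\<close>)
  then show ?thesis by (rule homotopic_with_symD)
qed

end

section \<open>The section is a homotopy inverse\<close>

context contracting_partition
begin

text \<open>Restricts to \<open>\<sigma>\<close> on the first factor of the join and to \<open>cone m e (\<sigma> t)\<close> on the second.\<close>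

definition join_simplex ::
  "nat \<Rightarrow> (nat \<Rightarrow> 'i) \<Rightarrow> nat \<Rightarrow> ((nat \<Rightarrow> real) \<Rightarrow> 'a) \<Rightarrow> (nat \<Rightarrow> real) \<Rightarrow> (nat \<Rightarrow> real) \<Rightarrow> 'a" where
  "join_simplex m e n \<sigma> t = (\<lambda>u\<in>standard_simplex (n + m + 1).
     spike (\<sigma> t) (chart_push m e (join_snd n u)) (\<sigma> (join_retract n t u)))"

abbreviation chart_pairs :: "nat \<Rightarrow> (nat \<Rightarrow> 'i) \<Rightarrow> nat \<Rightarrow> (((nat \<Rightarrow> real) \<Rightarrow> 'a) \<times> (nat \<Rightarrow> real)) topology" where
  "chart_pairs m e n \<equiv>
     subtopology (prod_topology (Omega n) (simplex_space n)) {q. fst q (snd q) \<in> chart_dom m e}"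

lemma Omega_eval_in:
  assumes "\<sigma> \<in> topspace (Omega n)" "t \<in> standard_simplex n"
  shows "\<sigma> t \<in> topspace X"
  using assms by (auto simp: topspace_Omega_space singular_simplex_def continuous_map_def)

text \<open>Continuity is joint in the simplex and the point. The pieces of the spike fit because a
  coordinate of at least 1/2 in the second factor gives that factor at least half of the mass, where
  \<open>join_retract\<close> returns \<open>t\<close>.\<close>

lemma continuous_map_join_simplex:
  assumes e: "chart m e"
  shows "continuous_map (chart_pairs m e n) (Omega (n + m + 1)) (\<lambda>q. join_simplex m e n (fst q) (snd q))"
  unfolding join_simplex_def
proof (rule continuous_map_into_Omega_space)
  let ?Q = "chart_pairs m e n"
  let ?P = "prod_topology ?Q (simplex_space (n + m + 1))"
  let ?k = "\<lambda>p. fst (fst p) (join_retract n (snd (fst p)) (snd p))"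
  let ?k' = "\<lambda>p. fst (fst p) (snd (fst p))"
  have fst: "continuous_map ?P (prod_topology (Omega n) (simplex_space n)) fst"
    by (rule continuous_map_into_fulltopology[OF continuous_map_fst])
  have \<sigma>: "continuous_map ?P (Omega n) (\<lambda>p. fst (fst p))"
    using continuous_map_compose[OF fst continuous_map_fst] by (simp add: o_def)
  have t: "continuous_map ?P (simplex_space n) (\<lambda>p. snd (fst p))"
    using continuous_map_compose[OF fst continuous_map_snd] by (simp add: o_def)
  have eval: "continuous_map ?P X (\<lambda>p. fst (fst p) (w p))" if "continuous_map ?P (simplex_space n) w" for w
  proof -
    have "continuous_map ?P (prod_topology (Omega n) (simplex_space n)) (\<lambda>p. (fst (fst p), w p))"
      using \<sigma> that by (simp add: continuous_map_pairedI)
    from continuous_map_compose[OF this continuous_map_Omega_evaluation] show ?thesis by (simp add: o_def)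
  qed
  have "continuous_map ?P X (\<lambda>p. spike (?k' p) (chart_push m e (join_snd n (snd p))) (?k p))"
  proof (rule continuous_map_spike[OF e])
    show "continuous_map ?P X ?k"
      by (intro eval continuous_map_join_retract[OF t continuous_map_snd])
    show "continuous_map ?P X ?k'" by (rule eval[OF t])
    show "continuous_map ?P euclideanreal (\<lambda>p. join_snd n (snd p) i)" for i
      unfolding join_snd_def by (rule continuous_map_simplex_coord[OF continuous_map_snd])
    fix p assume p: "p \<in> topspace ?P"
    then have u: "snd p \<in> standard_simplex (n + m + 1)" and tp: "snd (fst p) \<in> standard_simplex n"
      and dom: "?k' p \<in> chart_dom m e" by auto
    show ge0: "0 \<le> join_snd n (snd p) i" for i by (rule join_snd_simplex(1)[OF u])
    show "(\<Sum>i\<le>m. join_snd n (snd p) i) \<le> 1"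
      using join_snd_simplex(2)[OF u] sum_nonneg[of "{..n}" "snd p"] standard_simplexD(1)[OF u] by simp
    show "?k' p \<in> U (e i)" if "i \<le> m" for i using dom that by (auto simp: chart_dom_def)
    show "?k p = ?k' p" if "i \<le> m" "1/2 \<le> join_snd n (snd p) i" for i
    proof -
      have "join_snd n (snd p) i \<le> (\<Sum>i\<le>m. join_snd n (snd p) i)"
        using that ge0 by (intro member_le_sum) auto
      then show ?thesis using join_retract_snd[OF tp u] that by simp
    qed
  qed
  then show "continuous_map ?P X
      (\<lambda>(q, u). spike (fst q (snd q)) (chart_push m e (join_snd n u)) (fst q (join_retract n (snd q) u)))"
    by (simp add: case_prod_unfold)
  fix q i assume q: "q \<in> topspace ?Q" and i: "i \<le> n + m + 1"
  then have \<sigma>: "fst q \<in> topspace (Omega n)" and dom: "fst q (snd q) \<in> chart_dom m e" by auto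
  show "spike (fst q (snd q)) (chart_push m e (join_snd n (simplex_vertex i)))
          (fst q (join_retract n (snd q) (simplex_vertex i))) = x0"
  \<comment> \<open>A vertex of the first factor has no path coordinate and is fixed by the
    retraction, and \<open>\<sigma>\<close> sends it to \<open>x0\<close>. At a vertex of the second
    factor the path has ended at \<open>x0\<close>.\<close>
  proof (cases "i \<le> n")
    case True
    then have v: "simplex_vertex i \<in> standard_simplex n" by simp
    have "chart_push m e (\<lambda>_. 0) = (\<lambda>_. 0)" by (simp add: chart_push_def)
    then show ?thesis
      using \<sigma> True by (simp add: join_snd_fst[OF v] join_retract_fst[OF v] spike_none topspace_Omega_space)
  next
    case False
    have "join_snd n (simplex_vertex i) = simplex_vertex (i - n - 1)"
      unfolding fun_eq_iff using False by (auto simp: join_snd_def simplex_vertex_def)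
    then show ?thesis
      using spike_vertex[OF e, of "i - n - 1" "fst q (snd q)"] dom False i by (auto simp: chart_dom_def)
  qed
qed

lemma join_simplex_in:
  assumes "chart m e" "\<sigma> \<in> topspace (Omega n)" "t \<in> standard_simplex n" "\<sigma> t \<in> chart_dom m e"
  shows "join_simplex m e n \<sigma> t \<in> topspace (Omega (n + m + 1))"
proof -
  have "(\<sigma>, t) \<in> topspace (chart_pairs m e n)" using assms by simp
  from funcset_mem[OF continuous_map_funspace[OF continuous_map_join_simplex[OF assms(1)]] this]
  show ?thesis by simp
qed

definition slide ::
  "nat \<Rightarrow> (nat \<Rightarrow> 'i) \<Rightarrow> nat \<Rightarrow> ((nat \<Rightarrow> real) \<Rightarrow> 'a) \<Rightarrow> (nat \<Rightarrow> real) \<Rightarrow>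
    real \<Rightarrow> (nat \<times> ((nat \<Rightarrow> real) \<Rightarrow> 'a) \<times> (nat \<Rightarrow> real)) set" where
  "slide m e n \<sigma> t = (\<lambda>s\<in>{0..1}. simplex_class Omega Omega_act (n + m + 1)
     (join_simplex m e n \<sigma> t) (join_point n t (coords m e (\<sigma> t)) s))"

lemma continuous_map_slide:
  assumes e: "chart m e"
  shows "continuous_map (chart_pairs m e n) (compact_open_topology (top_of_set {0..1}) realization)
           (\<lambda>q. slide m e n (fst q) (snd q))"
proof -
  let ?Q = "chart_pairs m e n" and ?I = "top_of_set {0..1::real}"
  let ?P = "prod_topology ?Q ?I"
  let ?j = "\<lambda>p. join_point n (snd (fst p)) (coords m e (fst (fst p) (snd (fst p)))) (snd p)"
  have fst: "continuous_map ?P (prod_topology (Omega n) (simplex_space n)) fst"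
    by (rule continuous_map_into_fulltopology[OF continuous_map_fst])
  have t: "continuous_map ?P (simplex_space n) (\<lambda>p. snd (fst p))"
    using continuous_map_compose[OF fst continuous_map_snd] by (simp add: o_def)
  have s: "continuous_map ?P euclideanreal snd"
    by (rule continuous_map_into_fulltopology[OF continuous_map_snd])
  have x: "continuous_map ?P X (\<lambda>p. fst (fst p) (snd (fst p)))"
    using continuous_map_compose[OF fst continuous_map_Omega_evaluation] by (simp add: o_def case_prod_unfold)
  have "continuous_map ?P (simplex_space (n + m + 1)) ?j"
  proof (rule continuous_map_into_simplex_space)
    show "?j p \<in> standard_simplex (n + m + 1)" if "p \<in> topspace ?P" for p
      using that by (intro join_point_in coords_in[OF e]) auto
    show "continuous_map ?P euclideanreal (\<lambda>p. ?j p i)" for i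
    proof (cases "i \<le> n")
      case True
      then show ?thesis
        using s continuous_map_simplex_coord[OF t]
        by (simp add: join_point_def continuous_map_real_mult continuous_map_diff)
    next
      case False
      have "continuous_map ?P euclideanreal (\<lambda>p. coords m e (fst (fst p) (snd (fst p))) k)" for k
        using continuous_map_compose[OF x f_cont[OF chart_in[OF e]], of k] by (simp add: coords_def o_def)
      then show ?thesis
        using False s by (simp add: join_point_def continuous_map_real_mult)
    qed
  qed
  moreover have "continuous_map ?P (Omega (n + m + 1)) (\<lambda>p. join_simplex m e n (fst (fst p)) (snd (fst p)))"
    using continuous_map_compose[OF continuous_map_fst continuous_map_join_simplex[OF e, of n]] by (simp add: o_def)
  ultimately have "continuous_map ?P (prod_topology (Omega (n + m + 1)) (simplex_space (n + m + 1)))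
      (\<lambda>p. (join_simplex m e n (fst (fst p)) (snd (fst p)), ?j p))"
    by (simp add: continuous_map_pairedI)
  from continuous_map_compose[OF this continuous_map_simplex_class[of Omega "n + m + 1" Omega_act]]
  have "continuous_map ?P realization (\<lambda>(q, s). simplex_class Omega Omega_act (n + m + 1)
      (join_simplex m e n (fst q) (snd q)) (join_point n (snd q) (coords m e (fst q (snd q))) s))"
    by (simp add: o_def case_prod_unfold)
  from continuous_map_curry[OF this]
  show ?thesis by (simp add: slide_def)
qed

text \<open>Change of chart along \<open>\<theta>\<close> and passage to a face along
  \<open>\<eta>\<close> are handled together, by the single face
  \<open>join_maps l \<eta> n k \<theta>\<close> of the join. Taking \<open>\<eta>\<close> to be the
  identity gives independence of the chart; taking \<open>\<theta>\<close> to be the identity gives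
  compatibility with faces.\<close>

lemma slide_refine:
  assumes e: "chart m e" "\<sigma> (simplex_push l \<eta> t) \<in> chart_dom m e"
    and a: "chart k a" "\<sigma> (simplex_push l \<eta> t) \<in> chart_dom k a"
    and \<theta>: "\<theta> \<in> mon_delta k m" and \<theta>_eq: "\<And>i. i \<le> k \<Longrightarrow> e (\<theta> i) = a i"
    and \<eta>: "\<eta> \<in> mon_delta l n" and \<sigma>: "\<sigma> \<in> topspace (Omega n)" and t: "t \<in> standard_simplex l"
  shows "slide k a l (Omega_act l n \<eta> \<sigma>) t = slide m e n \<sigma> (simplex_push l \<eta> t)"
proof -
  let ?j = "join_maps l \<eta> n k \<theta>" and ?t = "simplex_push l \<eta> t"
  have j: "?j \<in> mon_delta (l + k + 1) (n + m + 1)" by (rule join_maps_in[OF \<eta> \<theta>])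
  have act_t: "Omega_act l n \<eta> \<sigma> t = \<sigma> ?t" using t by (simp add: Omega_act_def)
  have "join_simplex k a l (Omega_act l n \<eta> \<sigma>) t =
      Omega_act (l + k + 1) (n + m + 1) ?j (join_simplex m e n \<sigma> ?t)"
    unfolding join_simplex_def Omega_act_def[of "l + k + 1"]
  proof (rule restrict_ext)
    fix u assume u: "u \<in> standard_simplex (l + k + 1)"
    let ?u = "simplex_push (l + k + 1) ?j u"
    have "chart_push m e (join_snd n ?u) = chart_push k a (join_snd l u)"
      unfolding join_snd_push[OF \<eta>] by (rule chart_push_compose[OF \<theta>]) (rule \<theta>_eq)
    moreover have "\<sigma> (join_retract n ?t ?u) = Omega_act l n \<eta> \<sigma> (join_retract l t u)"
      unfolding join_retract_push[OF \<eta>] using join_retract_in[OF t u] by (simp add: Omega_act_def)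
    ultimately show "spike (Omega_act l n \<eta> \<sigma> t) (chart_push k a (join_snd l u)) (Omega_act l n \<eta> \<sigma> (join_retract l t u)) =
      ((\<lambda>u\<in>standard_simplex (n + m + 1). spike (\<sigma> ?t) (chart_push m e (join_snd n u)) (\<sigma> (join_retract n ?t u)))
        \<circ> simplex_push (l + k + 1) ?j) u"
      using simplex_push_in[OF j u] act_t by simp
  qed
  moreover have "simplex_push (l + k + 1) ?j (join_point l t (coords k a (\<sigma> ?t)) s) =
      join_point n ?t (coords m e (\<sigma> ?t)) s" for s
    by (simp only: join_point_push[OF \<eta>]
        coords_refine[where e = e and a = a and \<theta> = \<theta>, OF e(1) a(1) \<theta> \<theta>_eq a(2)])
  moreover have "join_simplex m e n \<sigma> ?t \<in> topspace (Omega (n + m + 1))"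
    using e \<sigma> simplex_push_in[OF \<eta> t] by (intro join_simplex_in)
  ultimately have "simplex_class Omega Omega_act (l + k + 1) (join_simplex k a l (Omega_act l n \<eta> \<sigma>) t)
        (join_point l t (coords k a (\<sigma> ?t)) s) =
      simplex_class Omega Omega_act (n + m + 1) (join_simplex m e n \<sigma> ?t) (join_point n ?t (coords m e (\<sigma> ?t)) s)"
    if "s \<in> {0..1}" for s
    using simplex_class_face[OF j _ join_point_in[OF t coords_in[OF a]], of "join_simplex m e n \<sigma> ?t" s] that by simp
  then show ?thesis
    unfolding slide_def act_t by (rule restrict_ext)
qed

section \<open>The slide as a path-valued map on the realization\<close>

definition slide_path ::
  "nat \<times> ((nat \<Rightarrow> real) \<Rightarrow> 'a) \<times> (nat \<Rightarrow> real) \<Rightarrow> real \<Rightarrow> (nat \<times> ((nat \<Rightarrow> real) \<Rightarrow> 'a) \<times> (nat \<Rightarrow> real)) set" where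
  "slide_path = (\<lambda>(n, \<sigma>, t). slide (fst (chart_at (\<sigma> t))) (snd (chart_at (\<sigma> t))) n \<sigma> t)"

lemma slide_path_eq:
  assumes e: "chart m e" "\<sigma> t \<in> chart_dom m e" and \<sigma>: "\<sigma> \<in> topspace (Omega n)" and t: "t \<in> standard_simplex n"
  shows "slide_path (n, \<sigma>, t) = slide m e n \<sigma> t"
proof -
  have x: "\<sigma> t \<in> topspace X" using Omega_eval_in[OF \<sigma> t] .
  have "slide (fst (chart_at (\<sigma> t))) (snd (chart_at (\<sigma> t))) n \<sigma> t = slide m e n \<sigma> t"
  proof (rule chart_independence[where G = "\<lambda>m e. slide m e n \<sigma> t", OF chart_at[OF x] e])
    fix k a m e \<theta>
    assume *: "chart m e" "\<sigma> t \<in> chart_dom m e" "chart k a" "\<sigma> t \<in> chart_dom k a"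
      "\<theta> \<in> mon_delta k m" "\<And>i. i \<le> k \<Longrightarrow> e (\<theta> i) = a i"
    show "slide k a n \<sigma> t = slide m e n \<sigma> t"
      using slide_refine[where e = e and a = a and \<theta> = \<theta> and \<sigma> = \<sigma> and t = t, OF _ _ _ _ _ _ id_in_mon_delta \<sigma> t] *
      by (simp add: simplex_push_id[OF t] act_id[OF \<sigma>])
  qed
  then show ?thesis by (simp add: slide_path_def)
qed

lemma slide_path_face:
  assumes \<eta>: "\<eta> \<in> mon_delta l n" and \<sigma>: "\<sigma> \<in> topspace (Omega n)" and t: "t \<in> standard_simplex l"
  shows "slide_path (l, Omega_act l n \<eta> \<sigma>, t) = slide_path (n, \<sigma>, simplex_push l \<eta> t)"
proof -
  let ?t = "simplex_push l \<eta> t"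
  have t': "?t \<in> standard_simplex n" by (rule simplex_push_in[OF \<eta> t])
  have act_t: "Omega_act l n \<eta> \<sigma> t = \<sigma> ?t" using t by (simp add: Omega_act_def)
  \<comment> \<open>The face at \<open>t\<close> and the simplex at \<open>?t\<close> have the same
    value in \<open>X\<close>, so one chart serves both sides.\<close>
  obtain m e where e: "chart m e" "\<sigma> ?t \<in> chart_dom m e"
    using chart_at[OF Omega_eval_in[OF \<sigma> t']] by blast
  have "slide_path (l, Omega_act l n \<eta> \<sigma>, t) = slide m e l (Omega_act l n \<eta> \<sigma>) t"
    using slide_path_eq[OF e(1) _ Omega_act_in[OF \<eta> \<sigma>] t] e(2) by (simp add: act_t)
  also have "\<dots> = slide m e n \<sigma> ?t"
    by (rule slide_refine[OF e e id_in_mon_delta _ \<eta> \<sigma> t]) simp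
  also have "\<dots> = slide_path (n, \<sigma>, ?t)"
    using slide_path_eq[OF e \<sigma> t'] by simp
  finally show ?thesis .
qed

lemma slide_path_class:
  assumes "\<sigma> \<in> topspace (Omega n)" "t \<in> standard_simplex n"
  shows "realization_lift slide_path (simplex_class Omega Omega_act n \<sigma> t) = slide_path (n, \<sigma>, t)"
  by (rule realization_lift_class[where h = slide_path and Y = Omega and act = Omega_act, OF _ assms])
    (rule slide_path_face)

text \<open>The patches on the \<open>n\<close>-simplices are preimages, under evaluation, of open
  sets inside chart domains; on each of them a fixed chart describes the slide.\<close>

lemma continuous_map_slide_path:
  "continuous_map realization (compact_open_topology (top_of_set {0..1}) realization) (realization_lift slide_path)"
  unfolding continuous_map_from_fat_realization
proof
  fix n
  let ?P = "prod_topology (Omega n) (simplex_space n)"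
  let ?C = "compact_open_topology (top_of_set {0..1}) realization"
  let ?T = "\<lambda>(m, e, V). {q \<in> topspace ?P. fst q (snd q) \<in> V}"
  let ?f = "\<lambda>(m, e, V) q. slide m e n (fst q) (snd q)"
  have "continuous_map ?P ?C (\<lambda>q. slide_path (n, q))"
  proof (rule pasting_lemma[where I = chart_nbhds and T = ?T and f = ?f])
    fix c assume "c \<in> chart_nbhds"
    then obtain m e V where c: "c = (m, e, V)" and e: "chart m e" and V: "openin X V" "V \<subseteq> chart_dom m e"
      by (auto simp: chart_nbhds_def)
    show "openin ?P (?T c)"
      using openin_continuous_map_preimage[OF continuous_map_Omega_evaluation[of X x0 n] V(1)]
      by (simp add: c case_prod_unfold)
    have "continuous_map (subtopology ?P (?T (m, e, V))) ?C (\<lambda>q. slide m e n (fst q) (snd q))"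
      by (rule continuous_map_from_subtopology_mono[OF continuous_map_slide[OF e]]) (use V(2) in auto)
    then show "continuous_map (subtopology ?P (?T c)) ?C (?f c)" by (simp add: c)
  next
    have eq: "?f c q = slide_path (n, q)" if "c \<in> chart_nbhds" "q \<in> ?T c" for c q
      using that by (cases c; cases q) (auto simp: chart_nbhds_def intro!: slide_path_eq[symmetric])
    show "?f c q = ?f c' q" if "c \<in> chart_nbhds" "c' \<in> chart_nbhds" "q \<in> topspace ?P \<inter> ?T c \<inter> ?T c'" for c c' q
      using eq[of c q] eq[of c' q] that by simp
    fix q assume q: "q \<in> topspace ?P"
    then have "fst q (snd q) \<in> topspace X" by (intro Omega_eval_in) auto
    then obtain m e V where c: "(m, e, V) \<in> chart_nbhds" "fst q (snd q) \<in> V" using chart_nbhds_cover by blast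
    then have T: "q \<in> ?T (m, e, V)" using q by simp
    from c(1) T eq[OF c(1) T] show "\<exists>c. c \<in> chart_nbhds \<and> q \<in> ?T c \<and> slide_path (n, q) = ?f c q"
      by (intro exI[of _ "(m, e, V)"] conjI) (simp_all only:)
  qed
  then show "continuous_map ?P ?C (\<lambda>(\<sigma>, t). realization_lift slide_path (simplex_class Omega Omega_act n \<sigma> t))"
    by (rule continuous_map_eq) (auto simp: slide_path_class)
qed

lemma slide_path_ends:
  assumes "z \<in> topspace realization"
  shows "realization_lift slide_path z 0 = z" "realization_lift slide_path z 1 = sect (Omega_counit z)"
proof -
  obtain n \<sigma> t where \<sigma>: "\<sigma> \<in> topspace (Omega n)" and t: "t \<in> standard_simplex n"
    and z: "z = simplex_class Omega Omega_act n \<sigma> t"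
    using assms topspace_fat_realization[of z Omega Omega_act] by blast
  obtain m e where e: "chart m e" "\<sigma> t \<in> chart_dom m e"
    using chart_at[OF Omega_eval_in[OF \<sigma> t]] by blast
  let ?\<tau> = "join_simplex m e n \<sigma> t" and ?b = "coords m e (\<sigma> t)"
  have \<tau>: "?\<tau> \<in> topspace (Omega (n + m + 1))" by (rule join_simplex_in[OF e(1) \<sigma> t e(2)])
  have b: "?b \<in> standard_simplex m" by (rule coords_in[OF e])
  have path: "realization_lift slide_path z s = simplex_class Omega Omega_act (n + m + 1) ?\<tau> (join_point n t ?b s)"
    if "s \<in> {0..1}" for s
    using that by (simp add: z slide_path_class[OF \<sigma> t] slide_path_eq[OF e \<sigma> t] slide_def)
  \<comment> \<open>On the first factor the chart coordinates vanish and \<open>join_retract\<close>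
    returns \<open>u\<close>: no path is run and the value is \<open>\<sigma> u\<close>.\<close>
  have "Omega_act n (n + m + 1) (join_fst_incl n) ?\<tau> = \<sigma>"
  proof (rule extensionalityI)
    show "Omega_act n (n + m + 1) (join_fst_incl n) ?\<tau> \<in> extensional (standard_simplex n)"
      by (simp add: Omega_act_def)
    show "\<sigma> \<in> extensional (standard_simplex n)"
      using \<sigma> by (simp add: topspace_Omega_space singular_simplex_def)
    fix u assume u: "u \<in> standard_simplex n"
    have "chart_push m e (\<lambda>_. 0) = (\<lambda>_. 0)" by (simp add: chart_push_def)
    moreover have "u \<in> standard_simplex (n + m + 1)"
      using simplex_push_in[OF join_fst_incl_in u, of m] by (simp add: simplex_push_fst_incl[OF u])
    ultimately show "Omega_act n (n + m + 1) (join_fst_incl n) ?\<tau> u = \<sigma> u"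
      using u by (simp add: Omega_act_def join_simplex_def simplex_push_fst_incl join_snd_fst join_retract_fst spike_none)
  qed
  with simplex_class_face[OF join_fst_incl_in \<tau> t]
  have "simplex_class Omega Omega_act (n + m + 1) ?\<tau> t = z"
    by (simp only: simplex_push_fst_incl[OF t] z)
  then show "realization_lift slide_path z 0 = z"
    using path[of 0] by (simp add: join_point_0[OF t])
  \<comment> \<open>On the second factor the retraction returns \<open>t\<close>, so the value from
    which paths depart is \<open>\<sigma> t\<close>, as in the cone.\<close>
  have "Omega_act m (n + m + 1) (join_snd_incl n m) ?\<tau> = cone m e (\<sigma> t)"
    unfolding Omega_act_def cone_def
  proof (rule restrict_ext)
    fix u assume u: "u \<in> standard_simplex m"
    have u': "join_point n t u 1 \<in> standard_simplex (n + m + 1)" by (rule join_point_in[OF t u]) auto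
    have snd: "join_snd n (join_point n t u 1) = u" by (simp add: join_snd_point)
    have "join_retract n t (join_point n t u 1) = t"
      using standard_simplexD(4)[OF u] by (intro join_retract_snd[OF t u']) (simp add: snd)
    then show "(?\<tau> \<circ> simplex_push m (join_snd_incl n m)) u = spike (\<sigma> t) (chart_push m e u) (\<sigma> t)"
      using u' snd by (simp add: simplex_push_snd_incl[OF u, of n t] join_simplex_def)
  qed
  with simplex_class_face[OF join_snd_incl_in \<tau> b]
  have "simplex_class Omega Omega_act (n + m + 1) ?\<tau> (join_point n t ?b 1) = section_at m e (\<sigma> t)"
    by (simp only: simplex_push_snd_incl[OF b, of n t] section_at_def)
  then show "realization_lift slide_path z 1 = sect (Omega_counit z)"
    using path[of 1] unfolding z Omega_counit_class[OF \<sigma> t] sect_eq[OF e] by simp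
qed

lemma homotopic_sect_counit: "homotopic_with (\<lambda>_. True) realization realization (sect \<circ> Omega_counit) id"
proof (rule homotopic_with_symD, rule homotopic_with_eq[OF homotopic_with_path_map[OF continuous_map_slide_path]])
  fix z assume z: "z \<in> topspace realization"
  show "id z = realization_lift slide_path z 0" using slide_path_ends(1)[OF z] by simp
  show "(sect \<circ> Omega_counit) z = realization_lift slide_path z 1" using slide_path_ends(2)[OF z] by simp
qed simp

theorem homotopy_equivalence_counit: "homotopy_equivalence_map realization X Omega_counit"
  unfolding homotopy_equivalence_map_def
proof (intro conjI exI[of _ sect])
  show "continuous_map realization X Omega_counit" by (rule continuous_map_Omega_counit)
  show "continuous_map X realization sect" by (rule continuous_map_sect)
  show "homotopic_with (\<lambda>_. True) realization realization (sect \<circ> Omega_counit) id" by (rule homotopic_sect_counit)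
  show "homotopic_with (\<lambda>_. True) X X (Omega_counit \<circ> sect) id" by (rule homotopic_counit_sect)
qed

end

section \<open>From a numerable cover to a contracting partition\<close>

lemma ambiently_contractible_to_point:
  assumes X: "path_connected_space X" and x0: "x0 \<in> topspace X" and U: "ambiently_contractible X U"
  shows "homotopic_with (\<lambda>_. True) (subtopology X U) X id (\<lambda>_. x0)"
proof -
  obtain c where c: "c \<in> topspace X" "homotopic_with (\<lambda>_. True) (subtopology X U) X id (\<lambda>_. c)"
    using U unfolding ambiently_contractible_def by blast
  have "path_component_of X c x0"
    using X c(1) x0 by (simp add: path_connected_space_imp_path_component_of)
  then have "homotopic_with (\<lambda>_. True) (subtopology X U) X (\<lambda>_. c) (\<lambda>_. x0)"
    by (simp add: homotopic_constant_maps)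
  with c(2) show ?thesis by (rule homotopic_with_trans)
qed

text \<open>The strict part of a well-order of the whole type.\<close>

lemma exists_strict_total_order:
  "\<exists>lt :: 'i \<Rightarrow> 'i \<Rightarrow> bool. (\<forall>i. \<not> lt i i) \<and> (\<forall>i j k. lt i j \<longrightarrow> lt j k \<longrightarrow> lt i k) \<and>
     (\<forall>i j. i \<noteq> j \<longrightarrow> lt i j \<or> lt j i)"
proof -
  obtain r :: "'i rel" where "well_order_on UNIV r" using well_order_on by blast
  then have r: "trans r" "antisym r" "total r"
    unfolding well_order_on_def linear_order_on_def partial_order_on_def preorder_on_def by auto
  have "(i, k) \<in> r \<and> i \<noteq> k" if "(i, j) \<in> r \<and> i \<noteq> j" "(j, k) \<in> r \<and> j \<noteq> k" for i j k
    using that r(1,2) by (meson antisymD transD)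
  moreover have "(i, j) \<in> r \<and> i \<noteq> j \<or> (j, i) \<in> r \<and> j \<noteq> i" if "i \<noteq> j" for i j
    using that r(3) by (auto simp: total_on_def)
  ultimately show ?thesis
    by (intro exI[of _ "\<lambda>i j. (i, j) \<in> r \<and> i \<noteq> j"]) blast
qed

text \<open>Members of the given cover need not be open, so a neighbourhood of a point of a support
  may leave them. The sets \<open>U W\<close>, where \<open>p W\<close> is positive, are open and
  inherit the contractions by restriction; a second partition \<open>f\<close> has its closed
  supports inside them.\<close>

lemma dold_space_imp_homotopy_equivalence_counit:
  fixes X :: "'a topology"
  assumes X: "path_connected_space X" and x0: "x0 \<in> topspace X" and dold: "dold_space X"
  shows "homotopy_equivalence_map (fat_realization (Omega_space X x0) Omega_act) X Omega_counit"
proof -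
  obtain \<U> p where p: "partition_of_unity_on X \<U> p"
    and supp_p: "\<And>W. W \<in> \<U> \<Longrightarrow> closed_support X (p W) \<subseteq> W"
    and amb: "\<And>W. W \<in> \<U> \<Longrightarrow> ambiently_contractible X W"
    using dold unfolding dold_space_def numerable_cover_def by auto
  have p_cont: "continuous_map X euclideanreal (p W)" if "W \<in> \<U>" for W
    using p that by (auto simp: partition_of_unity_on_def continuous_map_in_subtopology)
  have nonzero: "\<exists>W\<in>\<U>. q W x \<noteq> 0"
    if "partition_of_unity_on X \<U> q" "x \<in> topspace X" for q :: "'a set \<Rightarrow> 'a \<Rightarrow> real" and x
  proof (rule ccontr)
    assume "\<not> ?thesis"
    then have "{W. W \<in> \<U> \<and> q W x \<noteq> 0} = {}" by blast
    then have "(\<Sum>W | W \<in> \<U> \<and> q W x \<noteq> 0. q W x) = 0" by (simp only: sum.empty)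
    then show False using that by (simp add: partition_of_unity_on_def)
  qed
  have in_supp: "x \<in> closed_support X g" if "x \<in> topspace X" "g x \<noteq> 0" for g :: "'a \<Rightarrow> real" and x
    unfolding closed_support_def by (rule subsetD[OF closure_of_subset]) (use that in auto)
  obtain f where f: "partition_of_unity_on X \<U> f"
    and supp_f: "\<And>W. W \<in> \<U> \<Longrightarrow> closed_support X (f W) \<subseteq> {x \<in> topspace X. 0 < p W x}"
  proof (rule partition_of_unity_shrink[of \<U> X p])
    fix x assume x: "x \<in> topspace X"
    obtain V where V: "openin X V" "x \<in> V" "finite {W \<in> \<U>. V \<inter> closed_support X (p W) \<noteq> {}}"
      using p x unfolding partition_of_unity_on_def by blast
    obtain W where W: "W \<in> \<U>" "p W x \<noteq> 0" using nonzero[OF p x] by blast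
    then have "0 < p W x"
      using p x by (force simp: partition_of_unity_on_def continuous_map_in_subtopology less_le)
    define \<epsilon> where "\<epsilon> = p W x / 2"
    have \<epsilon>: "0 < \<epsilon>" "\<epsilon> < p W x" using \<open>0 < p W x\<close> by (auto simp: \<epsilon>_def)
    let ?V = "V \<inter> {y \<in> topspace X. p W y \<in> {\<epsilon><..}}"
    have "openin X ?V"
      by (intro openin_Int V openin_continuous_map_preimage[OF p_cont[OF W(1)]]) simp
    \<comment> \<open>A positive value of \<open>p i\<close> at \<open>y\<close> puts
      \<open>y\<close> into the closed support, so local finiteness of \<open>p\<close> supplies the
      finiteness.\<close>
    moreover have "{i \<in> \<U>. \<exists>y\<in>?V. \<epsilon> / 2 < p i y} \<subseteq> {W \<in> \<U>. V \<inter> closed_support X (p W) \<noteq> {}}"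
    proof
      fix i assume "i \<in> {i \<in> \<U>. \<exists>y\<in>?V. \<epsilon> / 2 < p i y}"
      then obtain y where "i \<in> \<U>" "y \<in> V" "y \<in> topspace X" "\<epsilon> / 2 < p i y" by blast
      then show "i \<in> {W \<in> \<U>. V \<inter> closed_support X (p W) \<noteq> {}}"
        using in_supp[of y "p i"] \<epsilon>(1) by force
    qed
    ultimately show "\<exists>V \<epsilon> k. openin X V \<and> x \<in> V \<and> 0 < \<epsilon> \<and> k \<in> \<U> \<and> (\<forall>y\<in>V. \<epsilon> < p k y) \<and>
        finite {i \<in> \<U>. \<exists>y\<in>V. \<epsilon> / 2 < p i y}"
      using x V W \<epsilon> finite_subset
      by (intro exI[of _ ?V] exI[of _ \<epsilon>] exI[of _ W]) auto
  qed (use p_cont that in blast)+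
  define U where "U W = {x \<in> topspace X. 0 < p W x}" for W
  have U_open: "openin X (U W)" if "W \<in> \<U>" for W
    using openin_continuous_map_preimage[OF p_cont[OF that], of "{0<..}"] by (simp add: U_def)
  have "\<exists>h. continuous_map (prod_topology (top_of_set {0..1::real}) (subtopology X (U W))) X h \<and>
      (\<forall>x \<in> topspace X \<inter> U W. h (0, x) = x \<and> h (1, x) = x0)" if W: "W \<in> \<U>" for W
  proof -
    have "U W \<subseteq> W"
    proof
      fix x assume "x \<in> U W"
      then have "x \<in> closed_support X (p W)" by (intro in_supp) (auto simp: U_def)
      then show "x \<in> W" using supp_p[OF W] by blast
    qed
    then have "continuous_map (subtopology X (U W)) (subtopology X W) id"
      by (auto simp: continuous_map_in_subtopology continuous_map_from_subtopology)
    from homotopic_with_compose_continuous_map_right[OF ambiently_contractible_to_point[OF X x0 amb[OF W]] this]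
    have "homotopic_with (\<lambda>_. True) (subtopology X (U W)) X id (\<lambda>_. x0)" by simp
    then obtain k :: "real \<times> 'a \<Rightarrow> 'a" where "continuous_map (prod_topology (top_of_set {0..1::real}) (subtopology X (U W))) X k"
        "\<forall>x. k (0, x) = id x" "\<forall>x. k (1, x) = x0"
      unfolding homotopic_with_def by (elim exE conjE)
    then show ?thesis by (intro exI[of _ k]) simp
  qed
  then have "\<forall>W\<in>\<U>. \<exists>h. continuous_map (prod_topology (top_of_set {0..1::real}) (subtopology X (U W))) X h \<and>
      (\<forall>x \<in> topspace X \<inter> U W. h (0, x) = x \<and> h (1, x) = x0)" by (rule ballI)
  from bchoice[OF this] obtain h where h: "\<forall>W\<in>\<U>. continuous_map (prod_topology (top_of_set {0..1::real}) (subtopology X (U W))) X (h W) \<and>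
      (\<forall>x \<in> topspace X \<inter> U W. h W (0, x) = x \<and> h W (1, x) = x0)" ..
  from exists_strict_total_order[where 'i = "'a set"]
  obtain lt :: "'a set \<Rightarrow> 'a set \<Rightarrow> bool" where lt: "\<forall>i. \<not> lt i i"
    "\<forall>i j k. lt i j \<longrightarrow> lt j k \<longrightarrow> lt i k" "\<forall>i j. i \<noteq> j \<longrightarrow> lt i j \<or> lt j i"
    by (elim exE conjE)
  interpret contracting_partition X x0 \<U> f U h lt
  proof
    show "continuous_map X euclideanreal (f W)" if "W \<in> \<U>" for W
      using f that by (auto simp: partition_of_unity_on_def continuous_map_in_subtopology)
    show "0 \<le> f W x" if "W \<in> \<U>" "x \<in> topspace X" for W x
      using f that by (force simp: partition_of_unity_on_def continuous_map_in_subtopology)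
    fix x assume x: "x \<in> topspace X"
    let ?supp = "\<lambda>W. closed_support X (f W)"
    obtain V where V: "openin X V" "x \<in> V" "finite {W \<in> \<U>. V \<inter> ?supp W \<noteq> {}}"
      using f x unfolding partition_of_unity_on_def by blast
    define F0 where "F0 = {W \<in> \<U>. V \<inter> ?supp W \<noteq> {}}"
    define F where "F = {W \<in> F0. x \<in> ?supp W}"
    \<comment> \<open>\<open>V'\<close> lies in \<open>U W\<close> for the finitely many members
      whose support contains \<open>x\<close>, each such \<open>U W\<close> being open around
      \<open>x\<close>, and avoids the supports of the other members meeting \<open>V\<close>, whose
      finite union is closed. Only members of \<open>F\<close> can be nonzero there.\<close>
    define V' where "V' = V \<inter> (topspace X \<inter> \<Inter>(U ` F)) - \<Union>(?supp ` (F0 - F))"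
    have "finite F0" using V(3) by (simp add: F0_def)
    then have fin: "finite F0" "finite F" "F \<subseteq> \<U>" by (auto simp: F_def) (simp add: F0_def)
    have "openin X (topspace X \<inter> \<Inter>(U ` F))"
      using fin U_open by (intro openin_Int_Inter) auto
    moreover have "closedin X (\<Union>(?supp ` (F0 - F)))"
      using fin by (intro closedin_Union) (auto simp: closed_support_def)
    ultimately have "openin X V'"
      unfolding V'_def using openin_diff[OF openin_Int[OF V(1)]] by blast
    have zero: "f W y = 0" if "y \<in> V'" "W \<in> \<U> - F" for W y
    proof (rule ccontr)
      assume "f W y \<noteq> 0"
      moreover have "y \<in> V" "y \<in> topspace X" using that by (auto simp: V'_def)
      ultimately have "y \<in> ?supp W" "W \<in> F0" using that in_supp[of y "f W"] by (auto simp: F0_def)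
      then show False using that by (auto simp: V'_def)
    qed
    have sum1: "(\<Sum>W\<in>F. f W y) = 1" if y: "y \<in> V'" for y
    proof -
      have "(\<Sum>W\<in>F. f W y) = (\<Sum>W | W \<in> \<U> \<and> f W y \<noteq> 0. f W y)"
        using zero[OF y] fin by (intro sum.mono_neutral_right) auto
      then show ?thesis using f y by (auto simp: V'_def partition_of_unity_on_def)
    qed
    have "x \<in> U W" if "W \<in> F" for W
      using that supp_f[of W] fin(3) by (auto simp: F_def U_def)
    then have "x \<in> V'" using x V(2) by (auto simp: V'_def F_def)
    moreover from this have "F \<noteq> {}" using sum1[of x] by auto
    ultimately show "\<exists>F V. finite F \<and> F \<noteq> {} \<and> F \<subseteq> \<U> \<and> openin X V \<and> x \<in> V \<and>
          (\<forall>y\<in>V. (\<forall>W\<in>F. y \<in> U W) \<and> (\<forall>W\<in>\<U> - F. f W y = 0) \<and> (\<Sum>W\<in>F. f W y) = 1)"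
      using fin \<open>openin X V'\<close> zero sum1 by (intro exI[of _ F] exI[of _ V']) (auto simp: V'_def)
  next
    show "lt i k" if "lt i j" "lt j k" for i j k using lt(2) that by blast
    show "lt i j \<or> lt j i" if "i \<noteq> j" for i j using lt(3) that by blast
    show "continuous_map (prod_topology (top_of_set {0..1}) (subtopology X (U W))) X (h W)" if "W \<in> \<U>" for W
      using h that by blast
    show "h W (0, x) = x" if "W \<in> \<U>" "x \<in> topspace X" "x \<in> U W" for W x
      using h that by blast
    show "h W (1, x) = x0" if "W \<in> \<U>" "x \<in> topspace X" "x \<in> U W" for W x
      using h that by blast
  qed (use x0 lt(1) in auto)
  show ?thesis by (rule homotopy_equivalence_counit)
qed

theorem proposition4p10:
  fixes X :: "'a topology" and x0 :: 'a
  assumes "path_connected_space X" and "x0 \<in> topspace X"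
  shows "dold_space X \<longleftrightarrow>
         homotopy_equivalence_map (fat_realization (Omega_space X x0) Omega_act) X Omega_counit"
proof
  assume "dold_space X"
  with assms show "homotopy_equivalence_map (fat_realization (Omega_space X x0) Omega_act) X Omega_counit"
    by (rule dold_space_imp_homotopy_equivalence_counit)
next
  let ?E = "fat_realization (Omega_space X x0) Omega_act"
  assume "homotopy_equivalence_map ?E X Omega_counit"
  then obtain g where v: "continuous_map ?E X Omega_counit" and g: "continuous_map X ?E g"
      and vg: "homotopic_with (\<lambda>_. True) X X (Omega_counit \<circ> g) id"
    unfolding homotopy_equivalence_map_def by (elim conjE exE)
  have "dold_space ?E"
    by (rule reduced_semisimplicial_space.dold_space_fat_realization[OF reduced_semisimplicial_space_Omega[OF assms(2)]])
  then show "dold_space X" by (rule dold_space_homotopy_dominated[OF _ g v vg])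
qed

end
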